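(* Let $S$ and $T$ be Cu-semigroups. Then the composition product $\circ\colon[\![T,T]\!]\otimes[\![S,T]\!]\to[\![S,T]\!]$ defines a left action of the Cu-semiring $[\![T,T]\!]$ on $[\![S,T]\!]$. Analogously, the composition product $\circ\colon[\![S,T]\!]\otimes[\![S,S]\!]\to[\![S,T]\!]$ defines a right action of $[\![S,S]\!]$ on $[\![S,T]\!]$. These actions are compatible, and thus $[\![S,T]\!]$ is a $([\![T,T]\!],[\![S,S]\!])$-Cu-semibimodule.
   Context: A positively ordered semigroup is a commutative monoid $(S,+,0)$ with a partial order $\le$ compatible with addition such that $0\le a$ for all $a$. For $a,b\in S$, $a\ll b$ (way-below) means: whenever $(c_n)_n$ is an increasing sequence in $S$ whose supremum exists and satisfies $b\le\sup_n c_n$, there is $k$ with $a\le c_k$. A Cu-semigroup is a positively ordered semigroup satisfying: (O1) every increasing sequence has a supremum; (O2) every $a$ is the supremum of a sequence $(a_n)_n$ with $a_n\ll a_{n+1}$ for all $n$; (O3) $a'\ll a$ and $b'\ll b$ imply $a'+b'\ll a+b$; (O4) $\sup_n(a_n+b_n)=\sup_n a_n+\sup_n b_n$ for increasing sequences. A generalized Cu-morphism is a map between Cu-semigroups preserving addition, zero, order and suprema of increasing sequences; a Cu-morphism additionally preserves $\ll$. $\mathrm{Cu}[S,T]$ and $\mathrm{Cu}(S,T)$ denote the sets of generalized Cu-morphisms and of Cu-morphisms $S\to T$, with pointwise order and addition. A Cu-bimorphism $\varphi\colon S\times T\to P$ is a map that is additive, zero- and order-preserving in each variable, satisfies $\sup_k\varphi(a_k,b_k)=\varphi(\sup_k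 a_k,\sup_k b_k)$ for increasing sequences, and satisfies $\varphi(a',b')\ll\varphi(a,b)$ whenever $a'\ll a$ and $b'\ll b$. $S\otimes T$ denotes the Cu-semigroup with universal Cu-bimorphism $S\times T\to S\otimes T$, $(a,b)\mapsto a\otimes b$: every Cu-bimorphism $S\times T\to P$ factors through a unique Cu-morphism $S\otimes T\to P$, and Cu-morphisms $\alpha_1,\alpha_2\colon S\otimes T\to P$ satisfy $\alpha_1\le\alpha_2$ iff $\alpha_1(a\otimes b)\le\alpha_2(a\otimes b)$ for all $a,b$. The tensor product is associative up to natural isomorphism. Let $I_{\mathbb Q}=\mathbb Q\cap(0,1)$. For $\varphi,\psi\in\mathrm{Cu}[S,T]$ write $\varphi\prec\psi$ if $\varphi(a')\ll\psi(a)$ whenever $a'\ll a$ in $S$. A path in $\mathrm{Cu}[S,T]$ is a family $\mathbf f=(f_\lambda)_{\lambda\in I_{\mathbb Q}}$ with $f_{\lambda'}\prec f_\lambda$ whenever $\lambda'<\lambda$. Write $\mathbf f\lesssim\mathbf g$ if for every $\lambda$ there is $\mu$ with $f_\lambda\prec g_\mu$. The internal hom $[\![S,T]\!]$ is the set of classes $[\mathbf f]$ of paths modulo ($\mathbf f\lesssim\mathbf g$ and $\mathbf g\lesssim\mathbf f$), with $[\mathbf f]+[\mathbf g]=[(f_\lambda+g_\lambda)_\lambda]$ and $[\mathbf f]\le[\mathbf g]$ iff $\mathbf f\lesssim\mathbf g$; it is a Cu-semigroup. A Cu-morphism $\varphi\colon S\to T$ satisfies $\varphi\prec\varphi$ and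 is identified with the class of the constant path $(\varphi)_\lambda$ in $[\![S,T]\!]$. The endpoint map $\sigma_{S,T}\colon[\![S,T]\!]\to\mathrm{Cu}[S,T]$ is $\sigma_{S,T}([\mathbf f])(a)=\sup_\lambda f_\lambda(a)$. It is known that for Cu-semigroups $S,T,P$ there is a bijection $\mathrm{Cu}(S,[\![T,P]\!])\cong\mathrm{Cu}(S\otimes T,P)$ sending $\alpha$ to the Cu-morphism $a\otimes b\mapsto\sigma_{T,P}(\alpha(a))(b)$. The evaluation map $\mathrm e_{S,T}\colon[\![S,T]\!]\otimes S\to T$ is the Cu-morphism corresponding to $\mathrm{id}_{[\![S,T]\!]}$. The composition product $\circ\colon[\![T,P]\!]\otimes[\![S,T]\!]\to[\![S,P]\!]$, $y\otimes x\mapsto y\circ x$, is the Cu-morphism corresponding to $\mathrm e_{T,P}\circ(\mathrm{id}_{[\![T,P]\!]}\otimes\mathrm e_{S,T})\colon[\![T,P]\!]\otimes[\![S,T]\!]\otimes S\to P$. A Cu-semiring is a Cu-semigroup $R$ with an associative Cu-bimorphism $R\times R\to R$, $(r,s)\mapsto rs$, and an element $1\in R$ with $r1=r=1r$ for all $r$ (not necessarily commutative). It is known that $[\![S,S]\!]$ is a Cu-semiring with the composition product and unit $\mathrm{id}_S$. A left action of a Cu-semiring $R$ on a Cu-semigroup $S$ is a Cu-bimorphism $R\times S\to S$, $(r,a)\mapsto ra$ (equivalently, a Cu-morphism $R\otimes S\to S$), such that $(r_1r_2)a=r_1(r_2a)$ and $1a=a$ for all $r_1,r_2\in R$, $a\in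 S$; right actions are defined analogously. For Cu-semirings $R_1,R_2$, an $(R_1,R_2)$-Cu-semibimodule is a Cu-semigroup $S$ with a left $R_1$-action and a right $R_2$-action such that $r_1(ar_2)=(r_1a)r_2$ for all $r_1\in R_1$, $r_2\in R_2$, $a\in S$. *)

theory Defs
  imports Complex_Main "HOL-Algebra.Group" "HOL-Library.Multiset"
begin

section \<open>Cu-semigroups\<close>

text \<open>Cu-semigroups are written additively; addition and zero are the fields \<open>mult\<close> and
  \<open>one\<close> of the library record of monoids.\<close>

no_notation monoid.mult (infixl \<open>\<otimes>\<index>\<close> 70)
no_notation monoid.one (\<open>\<one>\<index>\<close>)
notation monoid.mult (infixl \<open>\<oplus>\<index>\<close> 65)
notation monoid.one (\<open>\<zero>\<index>\<close>)

record 'a po_monoid = "'a monoid" +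
  leq :: "'a \<Rightarrow> 'a \<Rightarrow> bool" (infix \<open>\<preceq>\<index>\<close> 50)

locale positively_ordered_semigroup = comm_monoid S for S :: "'a po_monoid" (structure) +
  assumes leq_refl: "a \<in> carrier S \<Longrightarrow> a \<preceq> a"
    and leq_trans: "\<lbrakk>a \<preceq> b; b \<preceq> c; a \<in> carrier S; b \<in> carrier S; c \<in> carrier S\<rbrakk> \<Longrightarrow> a \<preceq> c"
    and leq_antisym: "\<lbrakk>a \<preceq> b; b \<preceq> a; a \<in> carrier S; b \<in> carrier S\<rbrakk> \<Longrightarrow> a = b"
    and add_mono: "\<lbrakk>a \<preceq> b; a \<in> carrier S; b \<in> carrier S; c \<in> carrier S\<rbrakk> \<Longrightarrow> a \<oplus> c \<preceq> b \<oplus> c"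
    and zero_leq: "a \<in> carrier S \<Longrightarrow> \<zero> \<preceq> a"

definition is_supremum :: "'a po_monoid \<Rightarrow> 'a set \<Rightarrow> 'a \<Rightarrow> bool" where
  "is_supremum S A s \<longleftrightarrow>
     s \<in> carrier S \<and> (\<forall>a\<in>A. a \<preceq>\<^bsub>S\<^esub> s) \<and>
     (\<forall>u\<in>carrier S. (\<forall>a\<in>A. a \<preceq>\<^bsub>S\<^esub> u) \<longrightarrow> s \<preceq>\<^bsub>S\<^esub> u)"

definition supremum :: "'a po_monoid \<Rightarrow> 'a set \<Rightarrow> 'a" where
  "supremum S A = (THE s. is_supremum S A s)"

definition increasing :: "'a po_monoid \<Rightarrow> (nat \<Rightarrow> 'a) \<Rightarrow> bool" where
  "increasing S c \<longleftrightarrow> (\<forall>n. c n \<in> carrier S \<and> c n \<preceq>\<^bsub>S\<^esub> c (Suc n))"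

definition way_below :: "'a po_monoid \<Rightarrow> 'a \<Rightarrow> 'a \<Rightarrow> bool" (infix \<open>\<lless>\<index>\<close> 50) where
  "a \<lless>\<^bsub>S\<^esub> b \<longleftrightarrow>
     a \<in> carrier S \<and> b \<in> carrier S \<and>
     (\<forall>c s. increasing S c \<and> is_supremum S (range c) s \<and> b \<preceq>\<^bsub>S\<^esub> s \<longrightarrow> (\<exists>k. a \<preceq>\<^bsub>S\<^esub> c k))"

locale cu_semigroup = positively_ordered_semigroup +
  assumes O1: "increasing S c \<Longrightarrow> \<exists>s. is_supremum S (range c) s"
    and O2: "a \<in> carrier S \<Longrightarrow> \<exists>c. (\<forall>n. c n \<lless> c (Suc n)) \<and> is_supremum S (range c) a"
    and O3: "\<lbrakk>a' \<lless> a; b' \<lless> b\<rbrakk> \<Longrightarrow> a' \<oplus> b' \<lless> a \<oplus> b"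
    and O4: "\<lbrakk>increasing S c; increasing S d; is_supremum S (range c) s; is_supremum S (range d) t\<rbrakk>
      \<Longrightarrow> is_supremum S (range (\<lambda>n. c n \<oplus> d n)) (s \<oplus> t)"

section \<open>Morphisms and bimorphisms\<close>

text \<open>Maps between carriers are extensional functions (\<open>\<rightarrow>\<^sub>E\<close>), so that equality of morphisms
  is equality of terms.\<close>

definition gen_cu_morphisms :: "'a po_monoid \<Rightarrow> 'b po_monoid \<Rightarrow> ('a \<Rightarrow> 'b) set" where
  "gen_cu_morphisms S T = {\<phi> \<in> carrier S \<rightarrow>\<^sub>E carrier T.
     (\<forall>a\<in>carrier S. \<forall>b\<in>carrier S. \<phi> (a \<oplus>\<^bsub>S\<^esub> b) = \<phi> a \<oplus>\<^bsub>T\<^esub> \<phi> b) \<and>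
     \<phi> \<zero>\<^bsub>S\<^esub> = \<zero>\<^bsub>T\<^esub> \<and>
     (\<forall>a\<in>carrier S. \<forall>b\<in>carrier S. a \<preceq>\<^bsub>S\<^esub> b \<longrightarrow> \<phi> a \<preceq>\<^bsub>T\<^esub> \<phi> b) \<and>
     (\<forall>c s. increasing S c \<and> is_supremum S (range c) s
        \<longrightarrow> is_supremum T (range (\<lambda>n. \<phi> (c n))) (\<phi> s))}"

definition cu_morphisms :: "'a po_monoid \<Rightarrow> 'b po_monoid \<Rightarrow> ('a \<Rightarrow> 'b) set" where
  "cu_morphisms S T = {\<phi> \<in> gen_cu_morphisms S T. \<forall>a' a. a' \<lless>\<^bsub>S\<^esub> a \<longrightarrow> \<phi> a' \<lless>\<^bsub>T\<^esub> \<phi> a}"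

definition cu_bimorphism ::
    "'a po_monoid \<Rightarrow> 'b po_monoid \<Rightarrow> 'c po_monoid \<Rightarrow> ('a \<Rightarrow> 'b \<Rightarrow> 'c) \<Rightarrow> bool" where
  "cu_bimorphism S T P \<phi> \<longleftrightarrow>
     (\<forall>a\<in>carrier S. \<forall>b\<in>carrier T. \<phi> a b \<in> carrier P) \<and>
     (\<forall>a\<in>carrier S. \<forall>a'\<in>carrier S. \<forall>b\<in>carrier T. \<phi> (a \<oplus>\<^bsub>S\<^esub> a') b = \<phi> a b \<oplus>\<^bsub>P\<^esub> \<phi> a' b) \<and>
     (\<forall>a\<in>carrier S. \<forall>b\<in>carrier T. \<forall>b'\<in>carrier T. \<phi> a (b \<oplus>\<^bsub>T\<^esub> b') = \<phi> a b \<oplus>\<^bsub>P\<^esub> \<phi> a b') \<and>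
     (\<forall>b\<in>carrier T. \<phi> \<zero>\<^bsub>S\<^esub> b = \<zero>\<^bsub>P\<^esub>) \<and>
     (\<forall>a\<in>carrier S. \<phi> a \<zero>\<^bsub>T\<^esub> = \<zero>\<^bsub>P\<^esub>) \<and>
     (\<forall>a\<in>carrier S. \<forall>a'\<in>carrier S. \<forall>b\<in>carrier T. a' \<preceq>\<^bsub>S\<^esub> a \<longrightarrow> \<phi> a' b \<preceq>\<^bsub>P\<^esub> \<phi> a b) \<and>
     (\<forall>a\<in>carrier S. \<forall>b\<in>carrier T. \<forall>b'\<in>carrier T. b' \<preceq>\<^bsub>T\<^esub> b \<longrightarrow> \<phi> a b' \<preceq>\<^bsub>P\<^esub> \<phi> a b) \<and>
     (\<forall>c d s t. increasing S c \<and> increasing T d \<and>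
        is_supremum S (range c) s \<and> is_supremum T (range d) t
        \<longrightarrow> is_supremum P (range (\<lambda>k. \<phi> (c k) (d k))) (\<phi> s t)) \<and>
     (\<forall>a' a b' b. a' \<lless>\<^bsub>S\<^esub> a \<and> b' \<lless>\<^bsub>T\<^esub> b \<longrightarrow> \<phi> a' b' \<lless>\<^bsub>P\<^esub> \<phi> a b)"

section \<open>Tensor products\<close>

text \<open>\<open>is_tensor_product TYPE('p) S T U \<omega>\<close>: the Cu-semigroup \<open>U\<close> with the Cu-bimorphism \<open>\<omega>\<close>
  is universal among the Cu-semigroups whose elements are of type \<open>'p\<close>.\<close>

definition is_tensor_product ::
    "'p itself \<Rightarrow> 'a po_monoid \<Rightarrow> 'b po_monoid \<Rightarrow> 'u po_monoid \<Rightarrow> ('a \<Rightarrow> 'b \<Rightarrow> 'u) \<Rightarrow> bool" where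
  "is_tensor_product _ S T U \<omega> \<longleftrightarrow>
     cu_semigroup U \<and> cu_bimorphism S T U \<omega> \<and>
     (\<forall>(P :: 'p po_monoid) \<phi>. cu_semigroup P \<and> cu_bimorphism S T P \<phi> \<longrightarrow>
        (\<exists>!\<alpha>. \<alpha> \<in> cu_morphisms U P \<and> (\<forall>a\<in>carrier S. \<forall>b\<in>carrier T. \<alpha> (\<omega> a b) = \<phi> a b))) \<and>
     (\<forall>(P :: 'p po_monoid). cu_semigroup P \<longrightarrow>
        (\<forall>\<alpha>\<^sub>1\<in>cu_morphisms U P. \<forall>\<alpha>\<^sub>2\<in>cu_morphisms U P.
           (\<forall>u\<in>carrier U. \<alpha>\<^sub>1 u \<preceq>\<^bsub>P\<^esub> \<alpha>\<^sub>2 u) \<longleftrightarrow>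
           (\<forall>a\<in>carrier S. \<forall>b\<in>carrier T. \<alpha>\<^sub>1 (\<omega> a b) \<preceq>\<^bsub>P\<^esub> \<alpha>\<^sub>2 (\<omega> a b))))"

text \<open>HOL cannot quantify over types inside a definition, so \<open>S \<otimes> T\<close> is chosen as a universal
  object within the type \<open>('a \<times> 'b) multiset set\<close>.  This type is large enough: the standard model
  of \<open>S \<otimes> T\<close>, universal for Cu-semigroups over every type, is the completion by rounded ideals
  of the commutative monoid of finite formal sums \<open>\<Sum>\<^sub>i a\<^sub>i \<otimes> b\<^sub>i\<close> (multisets of pairs) modulo the
  tensor relations, and its elements can be represented as sets of multisets.  By the usual
  uniqueness argument, an object universal within this type is isomorphic to that model, hence
  universal for Cu-semigroups over every type.\<close>

type_synonym ('a, 'b) tensor = "('a \<times> 'b) multiset set"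

definition tensor_pair ::
    "'a po_monoid \<Rightarrow> 'b po_monoid \<Rightarrow>
       ('a, 'b) tensor po_monoid \<times> ('a \<Rightarrow> 'b \<Rightarrow> ('a, 'b) tensor)" where
  "tensor_pair S T =
     (SOME (U, \<omega>). is_tensor_product TYPE(('a, 'b) tensor) S T U \<omega>)"

definition tensor_product :: "'a po_monoid \<Rightarrow> 'b po_monoid \<Rightarrow> ('a, 'b) tensor po_monoid" where
  "tensor_product S T = fst (tensor_pair S T)"

text \<open>\<open>pure_tensor S T a b\<close> is \<open>a \<otimes> b\<close>.\<close>

definition pure_tensor ::
    "'a po_monoid \<Rightarrow> 'b po_monoid \<Rightarrow> 'a \<Rightarrow> 'b \<Rightarrow> ('a, 'b) tensor" where
  "pure_tensor S T = snd (tensor_pair S T)"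

definition tensor_map ::
    "'a po_monoid \<Rightarrow> 'b po_monoid \<Rightarrow> 'c po_monoid \<Rightarrow> 'd po_monoid \<Rightarrow>
       ('a \<Rightarrow> 'c) \<Rightarrow> ('b \<Rightarrow> 'd) \<Rightarrow> ('a, 'b) tensor \<Rightarrow> ('c, 'd) tensor" where
  "tensor_map S T S' T' \<alpha> \<beta> =
     (THE \<gamma>. \<gamma> \<in> cu_morphisms (tensor_product S T) (tensor_product S' T') \<and>
        (\<forall>a\<in>carrier S. \<forall>b\<in>carrier T.
           \<gamma> (pure_tensor S T a b) = pure_tensor S' T' (\<alpha> a) (\<beta> b)))"

text \<open>The associativity isomorphism \<open>(X \<otimes> Y) \<otimes> Z \<rightarrow> X \<otimes> (Y \<otimes> Z)\<close>.\<close>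

definition tensor_assoc ::
    "'a po_monoid \<Rightarrow> 'b po_monoid \<Rightarrow> 'c po_monoid \<Rightarrow>
       (('a, 'b) tensor, 'c) tensor \<Rightarrow> ('a, ('b, 'c) tensor) tensor" where
  "tensor_assoc X Y Z =
     (THE \<gamma>. \<gamma> \<in> cu_morphisms (tensor_product (tensor_product X Y) Z)
                              (tensor_product X (tensor_product Y Z)) \<and>
        (\<forall>x\<in>carrier X. \<forall>y\<in>carrier Y. \<forall>z\<in>carrier Z.
           \<gamma> (pure_tensor (tensor_product X Y) Z (pure_tensor X Y x y) z) =
           pure_tensor X (tensor_product Y Z) x (pure_tensor Y Z y z)))"

section \<open>The internal hom\<close>

definition IQ :: "rat set" where
  "IQ = {0<..<1}"

definition mor_prec ::
    "'a po_monoid \<Rightarrow> 'b po_monoid \<Rightarrow> ('a \<Rightarrow> 'b) \<Rightarrow> ('a \<Rightarrow> 'b) \<Rightarrow> bool" where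
  "mor_prec S T \<phi> \<psi> \<longleftrightarrow> (\<forall>a' a. a' \<lless>\<^bsub>S\<^esub> a \<longrightarrow> \<phi> a' \<lless>\<^bsub>T\<^esub> \<psi> a)"

definition paths :: "'a po_monoid \<Rightarrow> 'b po_monoid \<Rightarrow> (rat \<Rightarrow> 'a \<Rightarrow> 'b) set" where
  "paths S T = {f \<in> IQ \<rightarrow>\<^sub>E gen_cu_morphisms S T.
     \<forall>l'\<in>IQ. \<forall>l\<in>IQ. l' < l \<longrightarrow> mor_prec S T (f l') (f l)}"

definition path_lesssim ::
    "'a po_monoid \<Rightarrow> 'b po_monoid \<Rightarrow> (rat \<Rightarrow> 'a \<Rightarrow> 'b) \<Rightarrow> (rat \<Rightarrow> 'a \<Rightarrow> 'b) \<Rightarrow> bool" where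
  "path_lesssim S T f g \<longleftrightarrow> (\<forall>l\<in>IQ. \<exists>m\<in>IQ. mor_prec S T (f l) (g m))"

definition path_class ::
    "'a po_monoid \<Rightarrow> 'b po_monoid \<Rightarrow> (rat \<Rightarrow> 'a \<Rightarrow> 'b) \<Rightarrow> (rat \<Rightarrow> 'a \<Rightarrow> 'b) set" where
  "path_class S T f = {g \<in> paths S T. path_lesssim S T f g \<and> path_lesssim S T g f}"

definition path_add ::
    "'a po_monoid \<Rightarrow> 'b po_monoid \<Rightarrow>
       (rat \<Rightarrow> 'a \<Rightarrow> 'b) \<Rightarrow> (rat \<Rightarrow> 'a \<Rightarrow> 'b) \<Rightarrow> rat \<Rightarrow> 'a \<Rightarrow> 'b" where
  "path_add S T f g = (\<lambda>l\<in>IQ. \<lambda>a\<in>carrier S. f l a \<oplus>\<^bsub>T\<^esub> g l a)"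

text \<open>The class of the constant path of a Cu-morphism.\<close>

definition const_class ::
    "'a po_monoid \<Rightarrow> 'b po_monoid \<Rightarrow> ('a \<Rightarrow> 'b) \<Rightarrow> (rat \<Rightarrow> 'a \<Rightarrow> 'b) set" where
  "const_class S T \<phi> = path_class S T (\<lambda>l\<in>IQ. \<phi>)"

text \<open>As usual for quotients, \<open>\<Union>f\<in>x. \<Union>g\<in>y. [f + g]\<close> is the sum of the classes \<open>x\<close> and \<open>y\<close>.\<close>

definition internal_hom ::
    "'a po_monoid \<Rightarrow> 'b po_monoid \<Rightarrow> (rat \<Rightarrow> 'a \<Rightarrow> 'b) set po_monoid" where
  "internal_hom S T =
     \<lparr>carrier = path_class S T ` paths S T,
      monoid.mult = (\<lambda>x y. \<Union>f\<in>x. \<Union>g\<in>y. path_class S T (path_add S T f g)),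
      monoid.one = const_class S T (\<lambda>a\<in>carrier S. \<zero>\<^bsub>T\<^esub>),
      leq = (\<lambda>x y. \<exists>f\<in>x. \<exists>g\<in>y. path_lesssim S T f g)\<rparr>"

text \<open>The endpoint map \<open>\<sigma>\<^sub>S\<^sub>,\<^sub>T\<close>; its value does not depend on the representing path.\<close>

definition endpoint ::
    "'a po_monoid \<Rightarrow> 'b po_monoid \<Rightarrow> (rat \<Rightarrow> 'a \<Rightarrow> 'b) set \<Rightarrow> 'a \<Rightarrow> 'b" where
  "endpoint S T x = (\<lambda>a\<in>carrier S. supremum T ((\<lambda>l. (SOME f. f \<in> x) l a) ` IQ))"

text \<open>The bijection \<open>Cu(S, \<lbrakk>T,P\<rbrakk>) \<rightarrow> Cu(S \<otimes> T, P)\<close>.\<close>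

definition hom_tensor ::
    "'a po_monoid \<Rightarrow> 'b po_monoid \<Rightarrow> 'c po_monoid \<Rightarrow>
       ('a \<Rightarrow> (rat \<Rightarrow> 'b \<Rightarrow> 'c) set) \<Rightarrow> ('a, 'b) tensor \<Rightarrow> 'c" where
  "hom_tensor S T P \<alpha> =
     (THE \<beta>. \<beta> \<in> cu_morphisms (tensor_product S T) P \<and>
        (\<forall>a\<in>carrier S. \<forall>b\<in>carrier T. \<beta> (pure_tensor S T a b) = endpoint T P (\<alpha> a) b))"

definition tensor_hom ::
    "'a po_monoid \<Rightarrow> 'b po_monoid \<Rightarrow> 'c po_monoid \<Rightarrow>
       (('a, 'b) tensor \<Rightarrow> 'c) \<Rightarrow> 'a \<Rightarrow> (rat \<Rightarrow> 'b \<Rightarrow> 'c) set" where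
  "tensor_hom S T P = the_inv_into (cu_morphisms S (internal_hom T P)) (hom_tensor S T P)"

definition evaluation ::
    "'a po_monoid \<Rightarrow> 'b po_monoid \<Rightarrow> ((rat \<Rightarrow> 'a \<Rightarrow> 'b) set, 'a) tensor \<Rightarrow> 'b" where
  "evaluation S T =
     hom_tensor (internal_hom S T) S T (\<lambda>x\<in>carrier (internal_hom S T). x)"

text \<open>The composition product as a Cu-morphism \<open>\<lbrakk>T,P\<rbrakk> \<otimes> \<lbrakk>S,T\<rbrakk> \<rightarrow> \<lbrakk>S,P\<rbrakk>\<close>.\<close>

definition composition_product ::
    "'a po_monoid \<Rightarrow> 'b po_monoid \<Rightarrow> 'c po_monoid \<Rightarrow>
       ((rat \<Rightarrow> 'b \<Rightarrow> 'c) set, (rat \<Rightarrow> 'a \<Rightarrow> 'b) set) tensor \<Rightarrow> (rat \<Rightarrow> 'a \<Rightarrow> 'c) set" where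
  "composition_product S T P =
     (let Y = internal_hom T P; X = internal_hom S T;
          A = tensor_product Y X; B = carrier (tensor_product A S)
      in tensor_hom A S P
           (compose B (evaluation T P)
             (compose B (tensor_map Y (tensor_product X S) Y T
                           (\<lambda>y\<in>carrier Y. y) (evaluation S T))
               (tensor_assoc Y X S))))"

definition comp_prod ::
    "'a po_monoid \<Rightarrow> 'b po_monoid \<Rightarrow> 'c po_monoid \<Rightarrow>
       (rat \<Rightarrow> 'b \<Rightarrow> 'c) set \<Rightarrow> (rat \<Rightarrow> 'a \<Rightarrow> 'b) set \<Rightarrow> (rat \<Rightarrow> 'a \<Rightarrow> 'c) set" where
  "comp_prod S T P y x =
     composition_product S T P (pure_tensor (internal_hom T P) (internal_hom S T) y x)"

definition hom_unit :: "'a po_monoid \<Rightarrow> (rat \<Rightarrow> 'a \<Rightarrow> 'a) set" where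
  "hom_unit S = const_class S S (\<lambda>a\<in>carrier S. a)"

section \<open>Cu-semirings, actions and semibimodules\<close>

locale cu_semiring = cu_semigroup R for R :: "'r po_monoid" (structure) +
  fixes times :: "'r \<Rightarrow> 'r \<Rightarrow> 'r" and unit :: 'r
  assumes times_bimorphism: "cu_bimorphism R R R times"
    and times_assoc: "\<lbrakk>r \<in> carrier R; s \<in> carrier R; t \<in> carrier R\<rbrakk>
      \<Longrightarrow> times (times r s) t = times r (times s t)"
    and unit_closed: "unit \<in> carrier R"
    and times_unit: "r \<in> carrier R \<Longrightarrow> times r unit = r"
    and unit_times: "r \<in> carrier R \<Longrightarrow> times unit r = r"

locale cu_left_action = R: cu_semiring R times unit + S: cu_semigroup S
  for R :: "'r po_monoid" and times unit and S :: "'s po_monoid" +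
  fixes act :: "'r \<Rightarrow> 's \<Rightarrow> 's"
  assumes act_bimorphism: "cu_bimorphism R S S act"
    and act_times: "\<lbrakk>r\<^sub>1 \<in> carrier R; r\<^sub>2 \<in> carrier R; a \<in> carrier S\<rbrakk>
      \<Longrightarrow> act (times r\<^sub>1 r\<^sub>2) a = act r\<^sub>1 (act r\<^sub>2 a)"
    and act_unit: "a \<in> carrier S \<Longrightarrow> act unit a = a"

locale cu_right_action = R: cu_semiring R times unit + S: cu_semigroup S
  for R :: "'r po_monoid" and times unit and S :: "'s po_monoid" +
  fixes act :: "'s \<Rightarrow> 'r \<Rightarrow> 's"
  assumes act_bimorphism: "cu_bimorphism S R S act"
    and act_times: "\<lbrakk>r\<^sub>1 \<in> carrier R; r\<^sub>2 \<in> carrier R; a \<in> carrier S\<rbrakk>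
      \<Longrightarrow> act a (times r\<^sub>1 r\<^sub>2) = act (act a r\<^sub>1) r\<^sub>2"
    and act_unit: "a \<in> carrier S \<Longrightarrow> act a unit = a"

locale cu_semibimodule =
  left: cu_left_action R\<^sub>1 times\<^sub>1 unit\<^sub>1 S lact + right: cu_right_action R\<^sub>2 times\<^sub>2 unit\<^sub>2 S ract
  for R\<^sub>1 :: "'r1 po_monoid" and times\<^sub>1 unit\<^sub>1
    and R\<^sub>2 :: "'r2 po_monoid" and times\<^sub>2 unit\<^sub>2
    and S :: "'s po_monoid" and lact ract +
  assumes compatible: "\<lbrakk>r\<^sub>1 \<in> carrier R\<^sub>1; r\<^sub>2 \<in> carrier R\<^sub>2; a \<in> carrier S\<rbrakk>
    \<Longrightarrow> lact r\<^sub>1 (ract a r\<^sub>2) = ract (lact r\<^sub>1 a) r\<^sub>2"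

end

theory Submission
  imports Defs "HOL-Library.Countable_Set"
begin

text \<open>Both \<open>S \<otimes> T\<close> and \<open>\<lbrakk>S,T\<rbrakk>\<close> are completions of a commutative monoid with an additive, transitive
  and interpolating relation: their elements can be taken to be the sets of elements below some
  increasing sequence.  For \<open>S \<otimes> T\<close> the monoid consists of the formal sums of pairs; for
  \<open>\<lbrakk>S,T\<rbrakk>\<close> it is \<open>Cu[S,T]\<close>, with \<open>\<phi>\<close> below \<open>\<psi>\<close> if some half-open path that starts in \<open>\<phi>\<close> stays
  \<open>\<prec> \<psi>\<close>.  A Cu-morphism into \<open>\<lbrakk>S,P\<rbrakk>\<close> is determined by its endpoints, and composing
  paths pointwise gives a Cu-bimorphism with the endpoints that define the composition product.
  Hence \<open>[f] \<circ> [g] = [(f\<^sub>\<lambda> \<circ> g\<^sub>\<lambda>)\<^sub>\<lambda>]\<close>, and associativity, unitality and compatibility are inherited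
  from composition of maps.\<close>

section \<open>Way-below in Cu-semigroups\<close>


text \<open>Two obstacles shape the proof. First, \<open>tensor_product\<close> is a Hilbert choice,
  universal only for targets over one fixed type, whereas morphisms into P, into internal homs and
  into iterated tensor products have to be constructed. The explicit model is universal over every
  type; it shows that the choice succeeds, and the chosen object is a retract of it, which carries
  its properties over. Second, \<prec> on Cu[S,T] gives no interpolation by itself. A half-open path
  that witnesses a relation can be cut at time 1/2, which yields interpolation, and such witnesses
  are also the pieces from which a chain of maps is joined into a path. The composition product is
  defined through the inverse of the hom-tensor bijection; it is identified by applying the
  bijection to a candidate and comparing values on triple pure tensors. There, one variable at a
  time, maps lose compatibility with way-below, so several facts are proved for generalized
  morphisms.\<close>

context positively_ordered_semigroup
begin

lemma is_supremum_unique: "is_supremum S A s \<Longrightarrow> is_supremum S A t \<Longrightarrow> s = t"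
  by (auto simp: is_supremum_def intro: leq_antisym)

lemma supremum_eq: "is_supremum S A s \<Longrightarrow> supremum S A = s"
  unfolding supremum_def by (blast intro: is_supremum_unique)

lemma add_mono_both:
  assumes "a \<preceq> b" "c \<preceq> d" "a \<in> carrier S" "b \<in> carrier S" "c \<in> carrier S" "d \<in> carrier S"
  shows "a \<oplus> c \<preceq> b \<oplus> d"
proof -
  have "a \<oplus> c \<preceq> b \<oplus> c" using assms by (simp add: add_mono)
  moreover have "b \<oplus> c \<preceq> b \<oplus> d" using assms add_mono[of c d b] by (simp add: m_comm)
  ultimately show ?thesis using assms by (blast intro: leq_trans m_closed)
qed

lemma increasing_carrier: "increasing S c \<Longrightarrow> c n \<in> carrier S"
  by (simp add: increasing_def)

lemma increasing_leq:
  assumes "increasing S c" "m \<le> n"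
  shows "c m \<preceq> c n"
  using assms(2)
proof (induction rule: dec_induct)
  case base
  show ?case using assms(1) by (simp add: increasing_carrier leq_refl)
next
  case (step n)
  then show ?case using assms(1) leq_trans[of "c m" "c n" "c (Suc n)"] by (auto simp: increasing_def)
qed

lemma is_supremum_cofinal:
  assumes "is_supremum S A s" "A \<subseteq> carrier S" "B \<subseteq> carrier S"
    and "\<And>a. a \<in> A \<Longrightarrow> \<exists>b\<in>B. a \<preceq> b" and "\<And>b. b \<in> B \<Longrightarrow> \<exists>a\<in>A. b \<preceq> a"
  shows "is_supremum S B s"
  unfolding is_supremum_def
proof (intro conjI ballI impI)
  show s: "s \<in> carrier S" using assms(1) by (simp add: is_supremum_def)
  show "b \<preceq> s" if b: "b \<in> B" for b
  proof -
    obtain a where "a \<in> A" "b \<preceq> a" using assms(5) b by blast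
    then show ?thesis using assms(1-3) s b by (meson is_supremum_def leq_trans subsetD)
  qed
  show "s \<preceq> u" if u: "u \<in> carrier S" "\<forall>b\<in>B. b \<preceq> u" for u
  proof -
    have "a \<preceq> u" if "a \<in> A" for a
      using assms(2-4) that u by (meson leq_trans subsetD)
    then show ?thesis using assms(1) u(1) by (simp add: is_supremum_def)
  qed
qed

lemma is_supremum_const: "a \<in> carrier S \<Longrightarrow> is_supremum S (range (\<lambda>n::nat. a)) a"
  by (auto simp: is_supremum_def leq_refl)

lemma increasing_const: "a \<in> carrier S \<Longrightarrow> increasing S (\<lambda>n. a)"
  by (simp add: increasing_def leq_refl)

lemma way_below_carrier: "a \<lless> b \<Longrightarrow> a \<in> carrier S \<and> b \<in> carrier S"
  by (simp add: way_below_def)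

lemma way_below_imp_leq:
  assumes "a \<lless> b"
  shows "a \<preceq> b"
  using assms increasing_const is_supremum_const leq_refl unfolding way_below_def by blast

lemma leq_way_below_trans:
  assumes "a \<preceq> b" "b \<lless> c" "a \<in> carrier S"
  shows "a \<lless> c"
  using assms leq_trans[of a b] unfolding way_below_def increasing_def by blast

lemma way_below_leq_trans:
  assumes "a \<lless> b" "b \<preceq> c" "c \<in> carrier S"
  shows "a \<lless> c"
  using assms leq_trans[of b c] unfolding way_below_def is_supremum_def by blast

lemma way_below_trans: "a \<lless> b \<Longrightarrow> b \<lless> c \<Longrightarrow> a \<lless> c"
  using leq_way_below_trans way_below_imp_leq way_below_carrier by blast

lemma zero_way_below: "a \<in> carrier S \<Longrightarrow> \<zero> \<lless> a"
  by (auto simp: way_below_def increasing_def zero_leq)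

lemma way_below_zero: "a \<lless> \<zero> \<Longrightarrow> a = \<zero>"
  using leq_antisym way_below_carrier way_below_imp_leq zero_leq by blast

lemma way_below_chain_increasing: "(\<And>n. c n \<lless> c (Suc n)) \<Longrightarrow> increasing S c"
  unfolding increasing_def using way_below_imp_leq way_below_carrier by blast

end

context cu_semigroup
begin

lemma way_below_chain_obtains:
  assumes "a \<in> carrier S"
  obtains c where "\<And>n. c n \<lless> c (Suc n)" "increasing S c" "is_supremum S (range c) a" "\<And>n. c n \<lless> a"
proof -
  obtain c where c: "\<And>n. c n \<lless> c (Suc n)" "is_supremum S (range c) a"
    using O2[OF assms] by blast
  have "c n \<lless> a" for n
    using c way_below_leq_trans[of "c n" "c (Suc n)" a] assms unfolding is_supremum_def by blast
  then show ?thesis using c that way_below_chain_increasing by blast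
qed

text \<open>A chain d with supremum s is inserted: a \<le> d m, which is way below d (m + 1) \<le> c
  k. This upgrades \<le> in the definition to way-below. A whole tail of indices is obtained so that
  finitely many such statements can be met at one index.\<close>

lemma way_below_supremum:
  assumes "a \<lless> s" "increasing S c" "is_supremum S (range c) s"
  obtains k where "\<And>n. n \<ge> k \<Longrightarrow> a \<lless> c n"
proof -
  have s: "s \<in> carrier S" "a \<in> carrier S" using way_below_carrier assms(1) by auto
  obtain d where d: "\<And>n. d n \<lless> d (Suc n)" "increasing S d" "is_supremum S (range d) s"
      "\<And>n. d n \<lless> s"
    using way_below_chain_obtains[OF s(1)] by metis
  obtain m where m: "a \<preceq> d m"
    using assms(1) d s(1) leq_refl unfolding way_below_def by blast
  obtain k where k: "d (Suc m) \<preceq> c k"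
    using d(4)[of "Suc m"] assms(2,3) s(1) leq_refl unfolding way_below_def by blast
  have "a \<lless> d (Suc m)" using m d(1) s leq_way_below_trans by blast
  then have "a \<lless> c n" if "n \<ge> k" for n
    using increasing_leq[OF assms(2) that] k assms(2) way_below_leq_trans increasing_carrier by meson
  then show ?thesis using that by blast
qed

text \<open>Both elements lie way below all late members of one chain that approximates c. It makes
  the set of elements way below c directed, which the join relations of the tensor product
  need.\<close>

lemma way_below_interpolate_two:
  assumes "a \<lless> c" "b \<lless> c"
  obtains d where "a \<lless> d" "b \<lless> d" "d \<lless> c"
proof -
  obtain e where e: "\<And>n. e n \<lless> e (Suc n)" "increasing S e" "is_supremum S (range e) c"
      "\<And>n. e n \<lless> c"
    using way_below_chain_obtains way_below_carrier[OF assms(1)] by metis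
  obtain k l where "\<And>n. n \<ge> k \<Longrightarrow> a \<lless> e n" "\<And>n. n \<ge> l \<Longrightarrow> b \<lless> e n"
    using way_below_supremum assms e by metis
  then show ?thesis using that[of "e (max k l)"] e(4) by simp
qed

lemma way_below_interpolate:
  assumes "a \<lless> c"
  obtains d where "a \<lless> d" "d \<lless> c"
  using way_below_interpolate_two[OF assms assms] by blast

text \<open>By O4 the sum is the supremum of the termwise sums of two approximating chains, so x is
  dominated by one of them. This substitutes for a Riesz decomposition of x, which need not
  exist.\<close>

lemma way_below_add_split:
  assumes "x \<lless> a \<oplus> b" "a \<in> carrier S" "b \<in> carrier S"
  obtains a' b' where "a' \<lless> a" "b' \<lless> b" "x \<preceq> a' \<oplus> b'"
proof -
  obtain c where c: "increasing S c" "is_supremum S (range c) a" "\<And>n. c n \<lless> a"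
    using way_below_chain_obtains[OF assms(2)] by metis
  obtain d where d: "increasing S d" "is_supremum S (range d) b" "\<And>n. d n \<lless> b"
    using way_below_chain_obtains[OF assms(3)] by metis
  have "increasing S (\<lambda>n. c n \<oplus> d n)"
    using c d by (auto simp: increasing_def intro: add_mono_both)
  then obtain n where "x \<preceq> c n \<oplus> d n"
    using assms O4[OF c(1) d(1) c(2) d(2)] leq_refl unfolding way_below_def by blast
  then show ?thesis using that c d by blast
qed

end

section \<open>Completion of an interpolating monoid\<close>


text \<open>An abstract basis in the sense of domain theory, with an addition. The relation need not
  be reflexive, and interpolation is asked only below single elements, so the elements below a given
  y need not be directed; ideals are therefore generated by chains.\<close>

locale interpolating_monoid = comm_monoid F for F :: "'x monoid" (structure) +
  fixes prec :: "'x \<Rightarrow> 'x \<Rightarrow> bool" (infix \<open>\<sqsubset>\<close> 50)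
  assumes prec_carrier: "x \<sqsubset> y \<Longrightarrow> x \<in> carrier F \<and> y \<in> carrier F"
    and prec_trans: "x \<sqsubset> y \<Longrightarrow> y \<sqsubset> z \<Longrightarrow> x \<sqsubset> z"
    and prec_interpolate: "x \<sqsubset> y \<Longrightarrow> \<exists>z. x \<sqsubset> z \<and> z \<sqsubset> y"
    and prec_add: "x \<sqsubset> x' \<Longrightarrow> y \<sqsubset> y' \<Longrightarrow> x \<oplus> y \<sqsubset> x' \<oplus> y'"
    and zero_prec: "x \<in> carrier F \<Longrightarrow> \<zero> \<sqsubset> x"
begin

definition chain :: "(nat \<Rightarrow> 'x) \<Rightarrow> bool" where
  "chain y \<longleftrightarrow> (\<forall>n. y n \<sqsubset> y (Suc n))"

definition generated :: "(nat \<Rightarrow> 'x) \<Rightarrow> 'x set" where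
  "generated y = {x. \<exists>n. x \<sqsubset> y n}"

text \<open>These are the countably generated rounded ideals. The elementwise sum of two ideals need
  not be a lower set, hence the closure under \<sqsubset> in the addition.\<close>

definition completion :: "'x set po_monoid" where
  "completion = \<lparr>carrier = generated ` Collect chain,
     monoid.mult = (\<lambda>I J. {x. \<exists>i\<in>I. \<exists>j\<in>J. x \<sqsubset> i \<oplus> j}),
     monoid.one = {x. x \<sqsubset> \<zero>}, leq = (\<subseteq>)\<rparr>"

lemma completion_leq [simp]: "I \<preceq>\<^bsub>completion\<^esub> J \<longleftrightarrow> I \<subseteq> J"
  by (simp add: completion_def)

lemma mem_completion_add [simp]:
  "x \<in> I \<oplus>\<^bsub>completion\<^esub> J \<longleftrightarrow> (\<exists>i\<in>I. \<exists>j\<in>J. x \<sqsubset> i \<oplus> j)"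
  by (simp add: completion_def)

lemma chain_prec: "chain y \<Longrightarrow> m < n \<Longrightarrow> y m \<sqsubset> y n"
  unfolding chain_def by (induction n) (auto simp: less_Suc_eq intro: prec_trans)

lemma chain_carrier: "chain y \<Longrightarrow> y n \<in> carrier F"
  using prec_carrier unfolding chain_def by blast

lemma generated_in_carrier: "chain y \<Longrightarrow> generated y \<in> carrier completion"
  by (simp add: completion_def)

lemma completion_carrierE:
  assumes "I \<in> carrier completion"
  obtains y where "chain y" "I = generated y"
  using assms by (auto simp: completion_def)

lemma chain_subset_generated: "chain y \<Longrightarrow> y n \<in> generated y"
  unfolding chain_def generated_def by blast

lemma chain_add: "chain y \<Longrightarrow> chain z \<Longrightarrow> chain (\<lambda>n. y n \<oplus> z n)"
  by (simp add: chain_def prec_add)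

lemma generated_eventually:
  assumes "chain y" "x \<in> generated y"
  obtains k where "\<And>n. n \<ge> k \<Longrightarrow> x \<sqsubset> y n"
proof -
  obtain k where "x \<sqsubset> y k" using assms(2) by (auto simp: generated_def)
  then have "x \<sqsubset> y n" if "n \<ge> k" for n
    using that chain_prec[OF assms(1)] prec_trans by (cases "n = k") (auto simp: le_neq_implies_less)
  then show ?thesis using that by blast
qed

text \<open>Elements of the two ideals meet at the larger of two indices. With this, the monoid laws
  of the completion become those of F, read termwise along chains.\<close>

lemma generated_add:
  assumes "chain y" "chain z"
  shows "generated y \<oplus>\<^bsub>completion\<^esub> generated z = generated (\<lambda>n. y n \<oplus> z n)"
proof (intro equalityI subsetI)
  fix x assume "x \<in> generated y \<oplus>\<^bsub>completion\<^esub> generated z"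
  then obtain i j where ij: "i \<in> generated y" "j \<in> generated z" "x \<sqsubset> i \<oplus> j"
    by (auto simp: completion_def)
  obtain k where k: "\<And>n. n \<ge> k \<Longrightarrow> i \<sqsubset> y n" using generated_eventually assms(1) ij(1) by blast
  obtain l where l: "\<And>n. n \<ge> l \<Longrightarrow> j \<sqsubset> z n" using generated_eventually assms(2) ij(2) by blast
  have "i \<oplus> j \<sqsubset> y (max k l) \<oplus> z (max k l)"
    using k[of "max k l"] l[of "max k l"] by (simp add: prec_add)
  with ij(3) have "x \<sqsubset> y (max k l) \<oplus> z (max k l)" by (rule prec_trans)
  then show "x \<in> generated (\<lambda>n. y n \<oplus> z n)" by (auto simp: generated_def)
next
  fix x assume "x \<in> generated (\<lambda>n. y n \<oplus> z n)"
  then show "x \<in> generated y \<oplus>\<^bsub>completion\<^esub> generated z"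
    using chain_subset_generated assms by (force simp: generated_def[of "\<lambda>n. y n \<oplus> z n"] completion_def)
qed

lemma chain_zero: "chain (\<lambda>n. \<zero>)"
  by (simp add: chain_def zero_prec)

lemma completion_zero: "\<zero>\<^bsub>completion\<^esub> = generated (\<lambda>n. \<zero>)"
  by (simp add: completion_def generated_def)

lemma completion_comm_monoid: "comm_monoid completion"
proof (rule comm_monoidI)
  show "I \<oplus>\<^bsub>completion\<^esub> J \<in> carrier completion"
    if "I \<in> carrier completion" "J \<in> carrier completion" for I J
    using that by (auto elim!: completion_carrierE simp: generated_add chain_add generated_in_carrier)
  show "\<zero>\<^bsub>completion\<^esub> \<in> carrier completion"
    by (simp add: completion_zero chain_zero generated_in_carrier)
  show "I \<oplus>\<^bsub>completion\<^esub> J \<oplus>\<^bsub>completion\<^esub> K = I \<oplus>\<^bsub>completion\<^esub> (J \<oplus>\<^bsub>completion\<^esub> K)"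
    if "I \<in> carrier completion" "J \<in> carrier completion" "K \<in> carrier completion" for I J K
    using that by (auto elim!: completion_carrierE simp: generated_add chain_add chain_carrier m_assoc)
  show "\<zero>\<^bsub>completion\<^esub> \<oplus>\<^bsub>completion\<^esub> I = I" if "I \<in> carrier completion" for I
    using that
    by (auto elim!: completion_carrierE simp: completion_zero chain_zero generated_add chain_carrier)
  show "I \<oplus>\<^bsub>completion\<^esub> J = J \<oplus>\<^bsub>completion\<^esub> I"
    if "I \<in> carrier completion" "J \<in> carrier completion" for I J
    using that by (auto elim!: completion_carrierE simp: generated_add chain_carrier m_comm)
qed

text \<open>A description without a generating chain, suited to unions of ideals, for which no chain
  is at hand.\<close>

lemma completion_carrier_iff:
  "I \<in> carrier completion \<longleftrightarrow>
     I \<noteq> {} \<and> (\<forall>x y. x \<sqsubset> y \<longrightarrow> y \<in> I \<longrightarrow> x \<in> I) \<and>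
     (\<forall>x\<in>I. \<forall>y\<in>I. \<exists>z\<in>I. x \<sqsubset> z \<and> y \<sqsubset> z) \<and>
     (\<exists>C\<subseteq>I. countable C \<and> (\<forall>x\<in>I. \<exists>c\<in>C. x \<sqsubset> c))" (is "_ \<longleftrightarrow> ?R")
proof
  assume "I \<in> carrier completion"
  then obtain y where y: "chain y" "I = generated y" by (rule completion_carrierE)
  have "\<exists>w\<in>I. x \<sqsubset> w \<and> z \<sqsubset> w" if "x \<in> I" "z \<in> I" for x z
  proof -
    obtain k where k: "\<And>n. n \<ge> k \<Longrightarrow> x \<sqsubset> y n" using generated_eventually y \<open>x \<in> I\<close> by blast
    obtain l where l: "\<And>n. n \<ge> l \<Longrightarrow> z \<sqsubset> y n" using generated_eventually y \<open>z \<in> I\<close> by blast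
    show ?thesis
      using k[of "max k l"] l[of "max k l"] chain_subset_generated[OF y(1), of "max k l"] y(2) by auto
  qed
  moreover have "\<exists>C\<subseteq>I. countable C \<and> (\<forall>x\<in>I. \<exists>c\<in>C. x \<sqsubset> c)"
    by (rule exI[of _ "range y"])
      (use chain_subset_generated y in \<open>auto simp: generated_def\<close>)
  moreover have "I \<noteq> {}" using chain_subset_generated y by blast
  moreover have "\<forall>x y. x \<sqsubset> y \<longrightarrow> y \<in> I \<longrightarrow> x \<in> I"
    unfolding y(2) generated_def using prec_trans by blast
  ultimately show ?R by blast
next
  assume R: ?R
  then obtain C where C: "C \<subseteq> I" "countable C" "\<forall>x\<in>I. \<exists>c\<in>C. x \<sqsubset> c" by blast
  have "C \<noteq> {}" using C R by blast
  define c where "c = from_nat_into C"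
  have c: "range c = C" unfolding c_def using C \<open>C \<noteq> {}\<close> by (simp add: range_from_nat_into)
  \<comment> \<open>Directedness lets the next member dominate both the previous one and the n-th
    element of the enumerated cofinal set, so the chain eventually passes everything in I.\<close>
  have "\<exists>y. \<forall>n. y n \<in> I \<and> y n \<sqsubset> y (Suc n) \<and> c n \<sqsubset> y (Suc n)"
  proof -
    have "\<exists>y. \<forall>n. y n \<in> I \<and> (y n \<sqsubset> y (Suc n) \<and> c n \<sqsubset> y (Suc n))"
      by (rule dependent_nat_choice) (use R c C(1) in blast)+
    then show ?thesis by blast
  qed
  then obtain y where y: "\<And>n. y n \<in> I" "\<And>n. y n \<sqsubset> y (Suc n)" "\<And>n. c n \<sqsubset> y (Suc n)" by blast
  have "I = generated y"
  proof (intro equalityI subsetI)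
    fix x assume "x \<in> I"
    then obtain n where "x \<sqsubset> c n" using C(3) c by blast
    then show "x \<in> generated y" unfolding generated_def using y(3) prec_trans by blast
  next
    fix x assume "x \<in> generated y"
    then show "x \<in> I" using R y(1) by (auto simp: generated_def)
  qed
  then show "I \<in> carrier completion" using y by (simp add: generated_in_carrier chain_def)
qed

lemma completion_down_closed: "I \<in> carrier completion \<Longrightarrow> x \<sqsubset> y \<Longrightarrow> y \<in> I \<Longrightarrow> x \<in> I"
  by (simp add: completion_carrier_iff)

lemma completion_directed:
  "I \<in> carrier completion \<Longrightarrow> x \<in> I \<Longrightarrow> y \<in> I \<Longrightarrow> \<exists>z\<in>I. x \<sqsubset> z \<and> y \<sqsubset> z"
  by (simp add: completion_carrier_iff)

lemma completion_subset_carrier: "I \<in> carrier completion \<Longrightarrow> I \<subseteq> carrier F"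
  using completion_directed prec_carrier by blast

text \<open>Countable cofinality survives because countably many countable cofinal sets have a
  countable union; directedness survives because the ideals are nested.\<close>

lemma completion_Union:
  assumes "increasing completion c"
  shows "\<Union>(range c) \<in> carrier completion"
proof -
  have c: "c n \<in> carrier completion" for n using assms by (simp add: increasing_def)
  have mono: "c m \<subseteq> c n" if "m \<le> n" for m n
    by (rule lift_Suc_mono_le[OF _ that]) (use assms in \<open>simp add: increasing_def\<close>)
  define C where "C n = (SOME C. C \<subseteq> c n \<and> countable C \<and> (\<forall>x\<in>c n. \<exists>y\<in>C. x \<sqsubset> y))" for n
  have "C n \<subseteq> c n \<and> countable (C n) \<and> (\<forall>x\<in>c n. \<exists>y\<in>C n. x \<sqsubset> y)" for n
    unfolding C_def by (rule someI_ex) (use c[of n] in \<open>simp add: completion_carrier_iff\<close>)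
  then have C: "\<And>n. C n \<subseteq> c n" "\<And>n. countable (C n)" "\<And>n. \<forall>x\<in>c n. \<exists>y\<in>C n. x \<sqsubset> y"
    by simp_all
  show ?thesis
    unfolding completion_carrier_iff
  proof (intro conjI)
    show "\<Union>(range c) \<noteq> {}" using c[of 0] by (auto simp: completion_carrier_iff)
    show "\<forall>x y. x \<sqsubset> y \<longrightarrow> y \<in> \<Union>(range c) \<longrightarrow> x \<in> \<Union>(range c)"
      using c completion_down_closed by blast
    show "\<forall>x\<in>\<Union>(range c). \<forall>y\<in>\<Union>(range c). \<exists>z\<in>\<Union>(range c). x \<sqsubset> z \<and> y \<sqsubset> z"
    proof (intro ballI)
      fix x y assume "x \<in> \<Union>(range c)" "y \<in> \<Union>(range c)"
      then obtain m n where "x \<in> c m" "y \<in> c n" by blast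
      then have "x \<in> c (max m n)" "y \<in> c (max m n)"
        using mono[of m "max m n"] mono[of n "max m n"] by auto
      then show "\<exists>z\<in>\<Union>(range c). x \<sqsubset> z \<and> y \<sqsubset> z" using completion_directed[OF c] by blast
    qed
    show "\<exists>D\<subseteq>\<Union>(range c). countable D \<and> (\<forall>x\<in>\<Union>(range c). \<exists>y\<in>D. x \<sqsubset> y)"
    proof (intro exI conjI ballI)
      show "(\<Union>n. C n) \<subseteq> \<Union>(range c)" using C(1) by (rule UN_mono[OF subset_refl])
      show "countable (\<Union>n. C n)" using C(2) by simp
      show "\<exists>y\<in>\<Union>n. C n. x \<sqsubset> y" if "x \<in> \<Union>(range c)" for x
      proof -
        obtain n where "x \<in> c n" using \<open>x \<in> \<Union>(range c)\<close> by blast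
        then obtain y where "y \<in> C n" "x \<sqsubset> y" using C(3) by metis
        then show ?thesis by blast
      qed
    qed
  qed
qed

lemma completion_is_supremum:
  assumes "increasing completion c"
  shows "is_supremum completion (range c) (\<Union>(range c))"
  using completion_Union[OF assms] by (auto simp: is_supremum_def)

lemma completion_pos: "positively_ordered_semigroup completion"
proof -
  interpret C: comm_monoid completion by (rule completion_comm_monoid)
  show ?thesis
  proof
    show "I \<oplus>\<^bsub>completion\<^esub> K \<preceq>\<^bsub>completion\<^esub> J \<oplus>\<^bsub>completion\<^esub> K" if "I \<preceq>\<^bsub>completion\<^esub> J" for I J K
      using that by (auto simp: completion_def)
    show "\<zero>\<^bsub>completion\<^esub> \<preceq>\<^bsub>completion\<^esub> I" if "I \<in> carrier completion" for I
    proof -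
      obtain y where "chain y" "I = generated y" using \<open>I \<in> carrier completion\<close> by (rule completion_carrierE)
      then show ?thesis
        using zero_prec chain_carrier prec_trans by (fastforce simp: completion_zero generated_def)
    qed
  qed auto
qed

lemma completion_supremum_eq:
  assumes "increasing completion c" "is_supremum completion (range c) s"
  shows "s = \<Union>(range c)"
  using positively_ordered_semigroup.is_supremum_unique[OF completion_pos] assms
    completion_is_supremum by blast

text \<open>Repeated interpolation towards y. The chain generates an ideal that contains x and lies
  below y, whereas the set of all elements below y may fail to be an ideal of the
  completion.\<close>

lemma prec_imp_chain:
  assumes "x \<sqsubset> y"
  obtains z where "chain z" "\<And>n. x \<sqsubset> z n" "\<And>n. z n \<sqsubset> y"
proof -
  have "\<exists>z. \<forall>n. (x \<sqsubset> z n \<and> z n \<sqsubset> y) \<and> z n \<sqsubset> z (Suc n)"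
  proof (rule dependent_nat_choice)
    show "\<exists>z. x \<sqsubset> z \<and> z \<sqsubset> y" using assms by (rule prec_interpolate)
    show "\<exists>w. (x \<sqsubset> w \<and> w \<sqsubset> y) \<and> z \<sqsubset> w" if "x \<sqsubset> z \<and> z \<sqsubset> y" for z and n :: nat
      using that prec_interpolate[of z y] prec_trans by blast
  qed
  then show ?thesis using that by (auto simp: chain_def)
qed

text \<open>The lower sets of the y n exhaust the ideal but may leave the carrier. Genuine ideals
  are interleaved with them, so that the ideal becomes the supremum of a sequence inside the
  completion.\<close>

lemma chain_interpolate:
  assumes y: "chain y"
  obtains z where "\<And>n. chain (z n)" "\<And>n. y n \<in> generated (z n)"
    "\<And>n. generated (z n) \<subseteq> {x. x \<sqsubset> y (Suc n)}" "\<And>n. {x. x \<sqsubset> y n} \<subseteq> generated (z n)"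
    "generated y = (\<Union>n. generated (z n))"
proof -
  have "\<exists>z. chain z \<and> (\<forall>m. y n \<sqsubset> z m \<and> z m \<sqsubset> y (Suc n))" for n
    using prec_imp_chain[of "y n" "y (Suc n)"] y unfolding chain_def by metis
  then obtain z where z: "\<And>n. chain (z n)" "\<And>n m. y n \<sqsubset> z n m" "\<And>n m. z n m \<sqsubset> y (Suc n)"
    by metis
  have sub: "generated (z n) \<subseteq> {x. x \<sqsubset> y (Suc n)}" "{x. x \<sqsubset> y n} \<subseteq> generated (z n)" for n
    using z prec_trans by (fastforce simp: generated_def)+
  moreover have "y n \<in> generated (z n)" for n using z(2) by (auto simp: generated_def)
  moreover have "generated y = (\<Union>n. generated (z n))"
    using sub by (fastforce simp: generated_def[of y])
  ultimately show ?thesis using that z(1) by blast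
qed

section \<open>Way-below for ideals and the axioms O1 to O4\<close>

lemma completion_way_below_iff:
  "I \<lless>\<^bsub>completion\<^esub> J \<longleftrightarrow>
     I \<in> carrier completion \<and> J \<in> carrier completion \<and> (\<exists>y\<in>J. \<forall>x\<in>I. x \<sqsubset> y)" (is "_ \<longleftrightarrow> ?R")
proof
  assume IJ: "I \<lless>\<^bsub>completion\<^esub> J"
  then have c: "I \<in> carrier completion" "J \<in> carrier completion" by (auto simp: way_below_def)
  obtain y where y: "chain y" "J = generated y" using c(2) by (rule completion_carrierE)
  obtain z where z: "\<And>n. chain (z n)"
    and sub: "\<And>n. generated (z n) \<subseteq> {x. x \<sqsubset> y (Suc n)}" "\<And>n. {x. x \<sqsubset> y n} \<subseteq> generated (z n)"
    and J: "J = (\<Union>n. generated (z n))"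
    using chain_interpolate[OF y(1)] y(2) by metis
  have inc: "increasing completion (\<lambda>n. generated (z n))"
    unfolding increasing_def using z sub by (fastforce simp: generated_in_carrier)
  \<comment> \<open>The interleaved ideals serve as the test sequence for J; the one that contains I
    is bounded by \<open>y (Suc n)\<close>.\<close>
  have "\<exists>n. I \<subseteq> generated (z n)"
    using IJ completion_is_supremum[OF inc] inc J unfolding way_below_def by fastforce
  then show ?R using c sub chain_subset_generated[OF y(1)] y(2) by blast
next
  assume R: ?R
  then obtain y where y: "y \<in> J" "\<forall>x\<in>I. x \<sqsubset> y" by blast
  show "I \<lless>\<^bsub>completion\<^esub> J"
    unfolding way_below_def
  proof (intro conjI allI impI)
    fix c s
    assume a: "increasing completion c \<and> is_supremum completion (range c) s \<and> J \<preceq>\<^bsub>completion\<^esub> s"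
    then have "y \<in> \<Union>(range c)" using y(1) completion_supremum_eq[of c s] by auto
    then obtain n where "y \<in> c n" by blast
    moreover have "c n \<in> carrier completion" using a by (simp add: increasing_def)
    ultimately show "\<exists>k. I \<preceq>\<^bsub>completion\<^esub> c k" using y(2) completion_down_closed by fastforce
  qed (use R in auto)
qed

lemma completion_cu_semigroup: "cu_semigroup completion"
proof -
  interpret C: positively_ordered_semigroup completion by (rule completion_pos)
  show ?thesis
  proof
    show "\<exists>s. is_supremum completion (range c) s" if "increasing completion c" for c
      using completion_is_supremum[OF that] by blast
    show "\<exists>c. (\<forall>n. c n \<lless>\<^bsub>completion\<^esub> c (Suc n)) \<and> is_supremum completion (range c) I"
      if I: "I \<in> carrier completion" for I
    proof -
      obtain y where y: "chain y" "I = generated y" using I by (rule completion_carrierE)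
      obtain z where z: "\<And>n. chain (z n)" "\<And>n. y n \<in> generated (z n)"
        and sub: "\<And>n. generated (z n) \<subseteq> {x. x \<sqsubset> y (Suc n)}"
        and I': "I = (\<Union>n. generated (z n))"
        using chain_interpolate[OF y(1)] y(2) by metis
      have wb: "generated (z n) \<lless>\<^bsub>completion\<^esub> generated (z (Suc n))" for n
        unfolding completion_way_below_iff using z sub[of n] generated_in_carrier by blast
      have inc: "increasing completion (\<lambda>n. generated (z n))"
        by (rule C.way_below_chain_increasing) (rule wb)
      have "is_supremum completion (range (\<lambda>n. generated (z n))) I"
        using completion_is_supremum[OF inc] I' by simp
      then show ?thesis using wb by (intro exI[of _ "\<lambda>n. generated (z n)"]) simp
    qed
    show "I' \<oplus>\<^bsub>completion\<^esub> J' \<lless>\<^bsub>completion\<^esub> I \<oplus>\<^bsub>completion\<^esub> J"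
      if wb: "I' \<lless>\<^bsub>completion\<^esub> I" "J' \<lless>\<^bsub>completion\<^esub> J" for I' I J' J
    proof -
      obtain x y where xy: "x \<in> I" "y \<in> J" "\<forall>z\<in>I'. z \<sqsubset> x" "\<forall>z\<in>J'. z \<sqsubset> y"
        and c: "I \<in> carrier completion" "J \<in> carrier completion"
          "I' \<in> carrier completion" "J' \<in> carrier completion"
        using wb unfolding completion_way_below_iff by blast
      \<comment> \<open>Membership in the sum demands strict domination, so the two bounds are first
        raised inside I and J; only then is x + y itself an element of I + J.\<close>
      obtain x' y' where "x' \<in> I" "x \<sqsubset> x'" "y' \<in> J" "y \<sqsubset> y'"
        using completion_directed[OF c(1) xy(1) xy(1)] completion_directed[OF c(2) xy(2) xy(2)]
        by blast
      then have "x \<oplus> y \<in> I \<oplus>\<^bsub>completion\<^esub> J"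
        by (simp add: completion_def) (blast intro: prec_add)
      moreover have "\<forall>z \<in> I' \<oplus>\<^bsub>completion\<^esub> J'. z \<sqsubset> x \<oplus> y"
        using xy(3,4) prec_add prec_trans by (simp add: completion_def) blast
      ultimately show ?thesis unfolding completion_way_below_iff using c by blast
    qed
    show "is_supremum completion (range (\<lambda>n. c n \<oplus>\<^bsub>completion\<^esub> d n)) (s \<oplus>\<^bsub>completion\<^esub> t)"
      if cd: "increasing completion c" "increasing completion d"
        "is_supremum completion (range c) s" "is_supremum completion (range d) t" for c d s t
    proof -
      have inc: "increasing completion (\<lambda>n. c n \<oplus>\<^bsub>completion\<^esub> d n)"
        unfolding increasing_def using cd(1,2)
        by (intro allI conjI C.m_closed C.add_mono_both) (auto simp: increasing_def)
      have mono: "c m \<subseteq> c n" "d m \<subseteq> d n" if "m \<le> n" for m n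
        using C.increasing_leq[OF cd(1) that] C.increasing_leq[OF cd(2) that] by auto
      have st: "s = \<Union>(range c)" "t = \<Union>(range d)"
        using completion_supremum_eq cd by blast+
      have "s \<oplus>\<^bsub>completion\<^esub> t = (\<Union>n. c n \<oplus>\<^bsub>completion\<^esub> d n)"
      proof (intro equalityI subsetI)
        fix x assume "x \<in> s \<oplus>\<^bsub>completion\<^esub> t"
        then obtain i j m n where "x \<sqsubset> i \<oplus> j" "i \<in> c m" "j \<in> d n"
          unfolding st by auto
        then have "x \<in> c (max m n) \<oplus>\<^bsub>completion\<^esub> d (max m n)"
          using mono(1)[of m "max m n"] mono(2)[of n "max m n"] by auto
        then show "x \<in> (\<Union>n. c n \<oplus>\<^bsub>completion\<^esub> d n)" by blast
      next
        fix x assume "x \<in> (\<Union>n. c n \<oplus>\<^bsub>completion\<^esub> d n)"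
        then show "x \<in> s \<oplus>\<^bsub>completion\<^esub> t" unfolding st by auto
      qed
      then show ?thesis using completion_is_supremum[OF inc] by simp
    qed
  qed
qed

section \<open>Principal ideals and extension of maps to ideals\<close>

definition principal :: "'x \<Rightarrow> 'x set" where
  "principal y = {x. x \<sqsubset> y}"

lemma generated_principal: "generated y = (\<Union>n. principal (y n))"
  by (auto simp: generated_def principal_def)

lemma increasing_principal:
  assumes "chain y" "\<And>n. principal (y n) \<in> carrier completion"
  shows "increasing completion (\<lambda>n. principal (y n))"
  using assms prec_trans by (auto simp: increasing_def principal_def chain_def)

text \<open>Along a generating chain the ideal is the supremum of principal ideals, and the
  comparison passes to suprema. The argument uses sequential continuity alone, so it applies to
  generalized morphisms.\<close>

lemma gen_cu_morphism_leq_if_principal: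
  assumes P: "cu_semigroup P"
    and \<alpha>: "\<alpha> \<in> gen_cu_morphisms completion P" and \<beta>: "\<beta> \<in> gen_cu_morphisms completion P"
    and principal: "\<And>y. y \<in> carrier F \<Longrightarrow> principal y \<in> carrier completion"
    and leq: "\<And>y. y \<in> carrier F \<Longrightarrow> \<alpha> (principal y) \<preceq>\<^bsub>P\<^esub> \<beta> (principal y)"
    and I: "I \<in> carrier completion"
  shows "\<alpha> I \<preceq>\<^bsub>P\<^esub> \<beta> I"
proof -
  interpret P: cu_semigroup P by (rule P)
  obtain y where y: "chain y" "I = generated y" using I by (rule completion_carrierE)
  have inc: "increasing completion (\<lambda>n. principal (y n))"
    by (rule increasing_principal[OF y(1)]) (simp add: principal chain_carrier[OF y(1)])
  have sup: "is_supremum completion (range (\<lambda>n. principal (y n))) I"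
    using completion_is_supremum[OF inc] by (simp add: y(2) generated_principal)
  have a: "is_supremum P (range (\<lambda>n. \<alpha> (principal (y n)))) (\<alpha> I)"
    and b: "is_supremum P (range (\<lambda>n. \<beta> (principal (y n)))) (\<beta> I)"
    using \<alpha> \<beta> inc sup by (auto simp: gen_cu_morphisms_def)
  have in_P: "\<alpha> J \<in> carrier P" "\<beta> J \<in> carrier P" if "J \<in> carrier completion" for J
    using \<alpha> \<beta> that by (auto simp: gen_cu_morphisms_def)
  have pr: "principal (y n) \<in> carrier completion" for n
    by (simp add: principal chain_carrier[OF y(1)])
  have "\<alpha> (principal (y n)) \<preceq>\<^bsub>P\<^esub> \<beta> I" for n
  proof (rule P.leq_trans)
    show "\<alpha> (principal (y n)) \<preceq>\<^bsub>P\<^esub> \<beta> (principal (y n))" by (simp add: leq chain_carrier[OF y(1)])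
    show "\<beta> (principal (y n)) \<preceq>\<^bsub>P\<^esub> \<beta> I" using b by (auto simp: is_supremum_def)
  qed (simp_all add: in_P pr I)
  then show ?thesis using a in_P(2)[OF I] by (auto simp: is_supremum_def)
qed

text \<open>No continuity is asked, so the extension may take a value strictly below h x at the
  principal ideal of x. For bimorphisms agreement on pure tensors is restored in
  \<open>model_lift_tensor\<close>.\<close>

definition monotone_hom :: "'p po_monoid \<Rightarrow> ('x \<Rightarrow> 'p) \<Rightarrow> bool" where
  "monotone_hom P h \<longleftrightarrow>
     (\<forall>x\<in>carrier F. h x \<in> carrier P) \<and>
     (\<forall>x\<in>carrier F. \<forall>y\<in>carrier F. h (x \<oplus> y) = h x \<oplus>\<^bsub>P\<^esub> h y) \<and>
     h \<zero> = \<zero>\<^bsub>P\<^esub> \<and> (\<forall>x y. x \<sqsubset> y \<longrightarrow> h x \<preceq>\<^bsub>P\<^esub> h y)"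

definition extension :: "'p po_monoid \<Rightarrow> ('x \<Rightarrow> 'p) \<Rightarrow> 'x set \<Rightarrow> 'p" where
  "extension P h = (\<lambda>I\<in>carrier completion. supremum P (h ` I))"

context
  fixes P :: "'p po_monoid"
  assumes P: "cu_semigroup P"
begin

interpretation P: cu_semigroup P by (rule P)

lemma monotone_hom_increasing:
  assumes "monotone_hom P h" "chain y"
  shows "increasing P (\<lambda>n. h (y n))"
  using assms chain_carrier[OF assms(2)] by (simp add: increasing_def monotone_hom_def chain_def)

lemma extension_generated:
  assumes h: "monotone_hom P h" and y: "chain y"
  shows "is_supremum P (range (\<lambda>n. h (y n))) (extension P h (generated y))"
    and "is_supremum P (h ` generated y) (extension P h (generated y))"
proof -
  obtain s where s: "is_supremum P (range (\<lambda>n. h (y n))) s"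
    using P.O1 monotone_hom_increasing[OF h y] by blast
  have "is_supremum P (h ` generated y) s"
  proof (rule P.is_supremum_cofinal[OF s])
    show "range (\<lambda>n. h (y n)) \<subseteq> carrier P" "h ` generated y \<subseteq> carrier P"
      using h chain_carrier[OF y] completion_subset_carrier[OF generated_in_carrier[OF y]]
      by (auto simp: monotone_hom_def)
    show "\<exists>b\<in>h ` generated y. a \<preceq>\<^bsub>P\<^esub> b" if "a \<in> range (\<lambda>n. h (y n))" for a
      using that chain_subset_generated[OF y] h chain_carrier[OF y] P.leq_refl
      unfolding monotone_hom_def by blast
    show "\<exists>a\<in>range (\<lambda>n. h (y n)). b \<preceq>\<^bsub>P\<^esub> a" if "b \<in> h ` generated y" for b
      using that h unfolding monotone_hom_def generated_def by blast
  qed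
  moreover from this have "extension P h (generated y) = s"
    using generated_in_carrier[OF y] by (simp add: extension_def P.supremum_eq)
  ultimately show "is_supremum P (range (\<lambda>n. h (y n))) (extension P h (generated y))"
    "is_supremum P (h ` generated y) (extension P h (generated y))"
    using s by simp_all
qed

lemma extension_is_supremum:
  assumes "monotone_hom P h" "I \<in> carrier completion"
  shows "is_supremum P (h ` I) (extension P h I)"
  using assms(2) extension_generated(2)[OF assms(1)] by (auto elim!: completion_carrierE)

lemma extension_closed:
  "monotone_hom P h \<Longrightarrow> I \<in> carrier completion \<Longrightarrow> extension P h I \<in> carrier P"
  using extension_is_supremum by (auto simp: is_supremum_def)

lemma extension_upper:
  "monotone_hom P h \<Longrightarrow> I \<in> carrier completion \<Longrightarrow> x \<in> I \<Longrightarrow> h x \<preceq>\<^bsub>P\<^esub> extension P h I"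
  using extension_is_supremum[of h I] by (simp add: is_supremum_def)

lemma extension_least:
  "monotone_hom P h \<Longrightarrow> I \<in> carrier completion \<Longrightarrow> u \<in> carrier P \<Longrightarrow>
    (\<And>x. x \<in> I \<Longrightarrow> h x \<preceq>\<^bsub>P\<^esub> u) \<Longrightarrow> extension P h I \<preceq>\<^bsub>P\<^esub> u"
  using extension_is_supremum[of h I] by (simp add: is_supremum_def)

lemma extension_mono:
  assumes "monotone_hom P h" "monotone_hom P h'" "I \<in> carrier completion" "J \<in> carrier completion"
    and "I \<subseteq> J" and leq: "\<And>x. x \<in> carrier F \<Longrightarrow> h x \<preceq>\<^bsub>P\<^esub> h' x"
  shows "extension P h I \<preceq>\<^bsub>P\<^esub> extension P h' J"
proof (rule extension_least)
  fix x assume "x \<in> I"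
  then have x: "x \<in> J" "x \<in> carrier F" using assms completion_subset_carrier by auto
  show "h x \<preceq>\<^bsub>P\<^esub> extension P h' J"
  proof (rule P.leq_trans)
    show "h' x \<preceq>\<^bsub>P\<^esub> extension P h' J" using assms x by (simp add: extension_upper)
  qed (use assms x in \<open>auto simp: monotone_hom_def intro: extension_closed\<close>)
qed (use assms extension_closed in auto)

lemma extension_gen_cu_morphism:
  assumes h: "monotone_hom P h"
  shows "extension P h \<in> gen_cu_morphisms completion P"
  unfolding gen_cu_morphisms_def
proof (intro CollectI conjI ballI allI impI)
  show "extension P h \<in> carrier completion \<rightarrow>\<^sub>E carrier P"
    using extension_closed[OF h] by (auto simp: extension_def)
  show "extension P h (I \<oplus>\<^bsub>completion\<^esub> J) = extension P h I \<oplus>\<^bsub>P\<^esub> extension P h J"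
    if IJ: "I \<in> carrier completion" "J \<in> carrier completion" for I J
  proof -
    obtain y z where yz: "chain y" "I = generated y" "chain z" "J = generated z"
      using IJ by (auto elim!: completion_carrierE)
    have "is_supremum P (range (\<lambda>n. h (y n) \<oplus>\<^bsub>P\<^esub> h (z n))) (extension P h I \<oplus>\<^bsub>P\<^esub> extension P h J)"
      unfolding yz using h yz(1,3) by (intro P.O4 monotone_hom_increasing extension_generated(1))
    moreover have "(\<lambda>n. h (y n) \<oplus>\<^bsub>P\<^esub> h (z n)) = (\<lambda>n. h (y n \<oplus> z n))"
      using h chain_carrier yz(1,3) by (simp add: monotone_hom_def)
    moreover have "is_supremum P (range (\<lambda>n. h (y n \<oplus> z n))) (extension P h (I \<oplus>\<^bsub>completion\<^esub> J))"
      unfolding yz generated_add[OF yz(1,3)]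
      by (rule extension_generated(1)[OF h chain_add[OF yz(1,3)]])
    ultimately show ?thesis using P.is_supremum_unique by metis
  qed
  show "extension P h \<zero>\<^bsub>completion\<^esub> = \<zero>\<^bsub>P\<^esub>"
    using extension_generated(1)[OF h chain_zero] P.is_supremum_const[OF P.one_closed] h
      P.is_supremum_unique by (simp add: completion_zero monotone_hom_def)
  show "extension P h I \<preceq>\<^bsub>P\<^esub> extension P h J"
    if "I \<in> carrier completion" "J \<in> carrier completion" "I \<preceq>\<^bsub>completion\<^esub> J" for I J
    using that h by (intro extension_mono) (auto simp: monotone_hom_def P.leq_refl)
  show "is_supremum P (range (\<lambda>n. extension P h (c n))) (extension P h s)"
    if cs: "increasing completion c \<and> is_supremum completion (range c) s" for c s
  proof -
    have s: "s = \<Union>(range c)" "s \<in> carrier completion"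
      using cs completion_supremum_eq by (auto simp: is_supremum_def)
    have c: "c n \<in> carrier completion" for n using cs by (simp add: increasing_def)
    show ?thesis
      unfolding is_supremum_def
    proof (intro conjI ballI impI)
      show "extension P h s \<in> carrier P" using extension_closed h s(2) .
      show "a \<preceq>\<^bsub>P\<^esub> extension P h s" if "a \<in> range (\<lambda>n. extension P h (c n))" for a
      proof -
        obtain n where a: "a = extension P h (c n)" using \<open>a \<in> _\<close> by blast
        have "c n \<subseteq> s" using s(1) by blast
        then show ?thesis
          unfolding a using h c s(2) by (intro extension_mono) (auto simp: monotone_hom_def P.leq_refl)
      qed
      show "extension P h s \<preceq>\<^bsub>P\<^esub> u"
        if u: "u \<in> carrier P" "\<forall>a\<in>range (\<lambda>n. extension P h (c n)). a \<preceq>\<^bsub>P\<^esub> u" for u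
      proof (rule extension_least[OF h s(2) u(1)])
        fix x assume "x \<in> s"
        then obtain n where n: "x \<in> c n" using s(1) by blast
        then have "x \<in> carrier F" using completion_subset_carrier c by blast
        show "h x \<preceq>\<^bsub>P\<^esub> u"
        proof (rule P.leq_trans)
          show "h x \<preceq>\<^bsub>P\<^esub> extension P h (c n)" using h c n by (intro extension_upper)
          show "extension P h (c n) \<preceq>\<^bsub>P\<^esub> u" using u(2) by blast
        qed (use h c u(1) \<open>x \<in> carrier F\<close> extension_closed in \<open>auto simp: monotone_hom_def\<close>)
      qed
    qed
  qed
qed

text \<open>One y in J bounds I, and J contains some z above y, so the extension at I is at most h
  y, which is way below h' z. Two maps are allowed because in the trilinear case the parameter
  varies together with the ideal.\<close>

lemma extension_way_below:
  assumes h: "monotone_hom P h" "monotone_hom P h'"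
    and wb: "\<And>x y. x \<sqsubset> y \<Longrightarrow> h x \<lless>\<^bsub>P\<^esub> h' y" and IJ: "I \<lless>\<^bsub>completion\<^esub> J"
  shows "extension P h I \<lless>\<^bsub>P\<^esub> extension P h' J"
proof -
  obtain y where y: "y \<in> J" "\<forall>x\<in>I. x \<sqsubset> y" and c: "I \<in> carrier completion" "J \<in> carrier completion"
    using IJ unfolding completion_way_below_iff by blast
  obtain z where z: "y \<sqsubset> z" "z \<in> J" using completion_directed[OF c(2) y(1) y(1)] by blast
  have "h y \<in> carrier P" using h(1) z(1) prec_carrier by (simp add: monotone_hom_def)
  have "extension P h I \<preceq>\<^bsub>P\<^esub> h y"
    by (rule extension_least[OF h(1) c(1)])
      (use h(1) y \<open>h y \<in> carrier P\<close> in \<open>auto simp: monotone_hom_def\<close>)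
  moreover have "h y \<lless>\<^bsub>P\<^esub> h' z" using wb z(1) .
  moreover have "h' z \<preceq>\<^bsub>P\<^esub> extension P h' J" using extension_upper[OF h(2) c(2) z(2)] .
  ultimately show ?thesis
    using P.leq_way_below_trans P.way_below_leq_trans extension_closed[OF h(1) c(1)]
      extension_closed[OF h(2) c(2)] by blast
qed

lemma extension_add:
  assumes h: "monotone_hom P h" "monotone_hom P h'" "monotone_hom P h''"
    and sum: "\<And>x. x \<in> carrier F \<Longrightarrow> h'' x = h x \<oplus>\<^bsub>P\<^esub> h' x" and I: "I \<in> carrier completion"
  shows "extension P h'' I = extension P h I \<oplus>\<^bsub>P\<^esub> extension P h' I"
proof -
  obtain y where y: "chain y" "I = generated y" using I by (rule completion_carrierE)
  have "is_supremum P (range (\<lambda>n. h (y n) \<oplus>\<^bsub>P\<^esub> h' (y n))) (extension P h I \<oplus>\<^bsub>P\<^esub> extension P h' I)"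
    unfolding y(2) using h(1,2) y(1) by (intro P.O4 monotone_hom_increasing extension_generated(1))
  moreover have "is_supremum P (range (\<lambda>n. h'' (y n))) (extension P h'' I)"
    unfolding y(2) by (rule extension_generated(1)[OF h(3) y(1)])
  ultimately show ?thesis
    using P.is_supremum_unique by (simp add: sum chain_carrier[OF y(1)])
qed

text \<open>Joint continuity in the map and the ideal. An element of c m and a map h n are brought
  together at the index max m n.\<close>

lemma extension_supremum:
  assumes h: "\<And>n. monotone_hom P (h n)" "monotone_hom P k"
    and sup: "\<And>x. x \<in> carrier F \<Longrightarrow> is_supremum P (range (\<lambda>n. h n x)) (k x)"
    and inc: "\<And>x. x \<in> carrier F \<Longrightarrow> increasing P (\<lambda>n. h n x)"
    and c: "increasing completion c" "is_supremum completion (range c) s"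
  shows "is_supremum P (range (\<lambda>n. extension P (h n) (c n))) (extension P k s)"
  unfolding is_supremum_def
proof (intro conjI ballI impI)
  have s: "s = \<Union>(range c)" "s \<in> carrier completion"
    using c completion_supremum_eq by (auto simp: is_supremum_def)
  have c': "c n \<in> carrier completion" for n using c by (simp add: increasing_def)
  have mono: "c m \<subseteq> c n" if "m \<le> n" for m n
    by (rule lift_Suc_mono_le[OF _ that]) (use c in \<open>simp add: increasing_def\<close>)
  show "extension P k s \<in> carrier P" using extension_closed h(2) s(2) .
  show "a \<preceq>\<^bsub>P\<^esub> extension P k s" if "a \<in> range (\<lambda>n. extension P (h n) (c n))" for a
  proof -
    obtain n where a: "a = extension P (h n) (c n)" using \<open>a \<in> _\<close> by blast
    have "c n \<subseteq> s" using s(1) by blast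
    moreover have "h n x \<preceq>\<^bsub>P\<^esub> k x" if "x \<in> carrier F" for x
      using sup[OF that] by (simp add: is_supremum_def)
    ultimately show ?thesis unfolding a using h c' s(2) by (intro extension_mono) auto
  qed
  show "extension P k s \<preceq>\<^bsub>P\<^esub> u"
    if u: "u \<in> carrier P" "\<forall>a\<in>range (\<lambda>n. extension P (h n) (c n)). a \<preceq>\<^bsub>P\<^esub> u" for u
  proof (rule extension_least[OF h(2) s(2) u(1)])
    fix x assume "x \<in> s"
    then obtain m where m: "x \<in> c m" using s(1) by blast
    then have x: "x \<in> carrier F" using completion_subset_carrier c' by blast
    have hx: "h n x \<in> carrier P" for n using h(1) x by (simp add: monotone_hom_def)
    have "h n x \<preceq>\<^bsub>P\<^esub> u" for n
    proof -
      have "h n x \<preceq>\<^bsub>P\<^esub> h (max m n) x" using P.increasing_leq[OF inc[OF x]] by simp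
      moreover have "h (max m n) x \<preceq>\<^bsub>P\<^esub> extension P (h (max m n)) (c (max m n))"
        using mono[of m "max m n"] m h(1) c' by (intro extension_upper) auto
      moreover have "extension P (h (max m n)) (c (max m n)) \<preceq>\<^bsub>P\<^esub> u" using u(2) by blast
      ultimately show ?thesis
        using P.leq_trans hx u(1) extension_closed[OF h(1) c'] by metis
    qed
    then show "k x \<preceq>\<^bsub>P\<^esub> u" using sup[OF x] u(1) by (auto simp: is_supremum_def)
  qed
qed

end

end

section \<open>Formal sums of pure tensors\<close>


lemma rel_mset_union:
  assumes "rel_mset R M N" "rel_mset R M' N'"
  shows "rel_mset R (M + M') (N + N')"
  using assms by (induction R M N rule: rel_mset_induct) (simp_all add: rel_mset_Plus)

lemma rel_mset_unionR:
  assumes "rel_mset R M (N + N')"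
  obtains M\<^sub>1 M\<^sub>2 where "M = M\<^sub>1 + M\<^sub>2" "rel_mset R M\<^sub>1 N" "rel_mset R M\<^sub>2 N'"
  using assms
proof (induction N' arbitrary: M thesis)
  case empty
  then show ?case by (metis add.right_neutral rel_mset_Zero)
next
  case (add b N')
  obtain M' a where M': "M = add_mset a M'" "R a b" "rel_mset R M' (N + N')"
    using add.prems(2) msed_rel_invR[of R M b "N + N'"] by auto
  obtain M\<^sub>1 M\<^sub>2 where "M' = M\<^sub>1 + M\<^sub>2" "rel_mset R M\<^sub>1 N" "rel_mset R M\<^sub>2 N'"
    using add.IH M'(3) by blast
  then show ?case using add.prems(1)[of M\<^sub>1 "add_mset a M\<^sub>2"] M'(1,2) by (simp add: rel_mset_Plus)
qed

lemma rel_mset_singleR: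
  assumes "rel_mset R M {#b#}"
  obtains a where "M = {#a#}" "R a b"
  using msed_rel_invR[OF assms] by auto

lemma rel_mset_pairR:
  assumes "rel_mset R M {#b, b'#}"
  obtains a a' where "M = {#a, a'#}" "R a b" "R a' b'"
  using msed_rel_invR[OF assms] by (auto elim: rel_mset_singleR)

text \<open>The guard makes the folded function commute everywhere, as \<open>fold_mset\<close> needs; \<open>P\<close> is
  commutative only on its carrier.\<close>

definition sum_in :: "('p, 'm) monoid_scheme \<Rightarrow> ('q \<Rightarrow> 'p) \<Rightarrow> 'q multiset \<Rightarrow> 'p" where
  "sum_in P f M =
     fold_mset (\<lambda>q s. if f q \<in> carrier P \<and> s \<in> carrier P then f q \<oplus>\<^bsub>P\<^esub> s else s) \<zero>\<^bsub>P\<^esub> M"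

lemma sum_in_empty [simp]: "sum_in P f {#} = \<zero>\<^bsub>P\<^esub>"
  by (simp add: sum_in_def)

context comm_monoid
begin

lemma sum_in_closed_add:
  shows "sum_in G f M \<in> carrier G"
    and "f q \<in> carrier G \<Longrightarrow> sum_in G f (add_mset q M) = f q \<oplus> sum_in G f M"
proof -
  interpret comp_fun_commute "\<lambda>q s. if f q \<in> carrier G \<and> s \<in> carrier G then f q \<oplus> s else s"
    by unfold_locales (auto simp: fun_eq_iff m_lcomm)
  show *: "sum_in G f M \<in> carrier G" for M
    by (induction M) (auto simp: sum_in_def)
  show "f q \<in> carrier G \<Longrightarrow> sum_in G f (add_mset q M) = f q \<oplus> sum_in G f M"
    using *[of M] by (auto simp: sum_in_def)
qed

lemma sum_in_union:
  "f ` set_mset M \<subseteq> carrier G \<Longrightarrow> sum_in G f (M + N) = sum_in G f M \<oplus> sum_in G f N"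
  by (induction M) (simp_all add: sum_in_closed_add m_assoc)

end

text \<open>\<open>cu_bimorphism\<close> without its way-below clause. That clause is lost when one
  argument of a trilinear map is held fixed.\<close>

definition gen_cu_bimorphism ::
    "'a po_monoid \<Rightarrow> 'b po_monoid \<Rightarrow> 'c po_monoid \<Rightarrow> ('a \<Rightarrow> 'b \<Rightarrow> 'c) \<Rightarrow> bool" where
  "gen_cu_bimorphism S T P \<phi> \<longleftrightarrow>
     (\<forall>a\<in>carrier S. \<forall>b\<in>carrier T. \<phi> a b \<in> carrier P) \<and>
     (\<forall>a\<in>carrier S. \<forall>a'\<in>carrier S. \<forall>b\<in>carrier T. \<phi> (a \<oplus>\<^bsub>S\<^esub> a') b = \<phi> a b \<oplus>\<^bsub>P\<^esub> \<phi> a' b) \<and>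
     (\<forall>a\<in>carrier S. \<forall>b\<in>carrier T. \<forall>b'\<in>carrier T. \<phi> a (b \<oplus>\<^bsub>T\<^esub> b') = \<phi> a b \<oplus>\<^bsub>P\<^esub> \<phi> a b') \<and>
     (\<forall>b\<in>carrier T. \<phi> \<zero>\<^bsub>S\<^esub> b = \<zero>\<^bsub>P\<^esub>) \<and>
     (\<forall>a\<in>carrier S. \<phi> a \<zero>\<^bsub>T\<^esub> = \<zero>\<^bsub>P\<^esub>) \<and>
     (\<forall>a\<in>carrier S. \<forall>a'\<in>carrier S. \<forall>b\<in>carrier T. a' \<preceq>\<^bsub>S\<^esub> a \<longrightarrow> \<phi> a' b \<preceq>\<^bsub>P\<^esub> \<phi> a b) \<and>
     (\<forall>a\<in>carrier S. \<forall>b\<in>carrier T. \<forall>b'\<in>carrier T. b' \<preceq>\<^bsub>T\<^esub> b \<longrightarrow> \<phi> a b' \<preceq>\<^bsub>P\<^esub> \<phi> a b) \<and>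
     (\<forall>c d s t. increasing S c \<and> increasing T d \<and>
        is_supremum S (range c) s \<and> is_supremum T (range d) t
        \<longrightarrow> is_supremum P (range (\<lambda>k. \<phi> (c k) (d k))) (\<phi> s t))"

lemma cu_bimorphism_iff:
  "cu_bimorphism S T P \<phi> \<longleftrightarrow> gen_cu_bimorphism S T P \<phi> \<and>
     (\<forall>a' a b' b. a' \<lless>\<^bsub>S\<^esub> a \<and> b' \<lless>\<^bsub>T\<^esub> b \<longrightarrow> \<phi> a' b' \<lless>\<^bsub>P\<^esub> \<phi> a b)"
  by (simp only: cu_bimorphism_def gen_cu_bimorphism_def conj_assoc)

lemma gen_cu_bimorphismD:
  assumes "gen_cu_bimorphism S T P \<phi>"
  shows "a \<in> carrier S \<Longrightarrow> b \<in> carrier T \<Longrightarrow> \<phi> a b \<in> carrier P"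
    and "a \<in> carrier S \<Longrightarrow> a' \<in> carrier S \<Longrightarrow> b \<in> carrier T \<Longrightarrow>
      \<phi> (a \<oplus>\<^bsub>S\<^esub> a') b = \<phi> a b \<oplus>\<^bsub>P\<^esub> \<phi> a' b"
    and "a \<in> carrier S \<Longrightarrow> b \<in> carrier T \<Longrightarrow> b' \<in> carrier T \<Longrightarrow>
      \<phi> a (b \<oplus>\<^bsub>T\<^esub> b') = \<phi> a b \<oplus>\<^bsub>P\<^esub> \<phi> a b'"
    and "b \<in> carrier T \<Longrightarrow> \<phi> \<zero>\<^bsub>S\<^esub> b = \<zero>\<^bsub>P\<^esub>"
    and "a \<in> carrier S \<Longrightarrow> \<phi> a \<zero>\<^bsub>T\<^esub> = \<zero>\<^bsub>P\<^esub>"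
    and "a \<in> carrier S \<Longrightarrow> a' \<in> carrier S \<Longrightarrow> b \<in> carrier T \<Longrightarrow> a' \<preceq>\<^bsub>S\<^esub> a \<Longrightarrow> \<phi> a' b \<preceq>\<^bsub>P\<^esub> \<phi> a b"
    and "a \<in> carrier S \<Longrightarrow> b \<in> carrier T \<Longrightarrow> b' \<in> carrier T \<Longrightarrow> b' \<preceq>\<^bsub>T\<^esub> b \<Longrightarrow> \<phi> a b' \<preceq>\<^bsub>P\<^esub> \<phi> a b"
    and "increasing S c \<Longrightarrow> increasing T d \<Longrightarrow> is_supremum S (range c) s \<Longrightarrow>
      is_supremum T (range d) t \<Longrightarrow> is_supremum P (range (\<lambda>k. \<phi> (c k) (d k))) (\<phi> s t)"
  using assms unfolding gen_cu_bimorphism_def by blast+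

lemma cu_bimorphism_gen: "cu_bimorphism S T P \<phi> \<Longrightarrow> gen_cu_bimorphism S T P \<phi>"
  by (simp add: cu_bimorphism_iff)

lemma cu_bimorphism_way_below:
  "cu_bimorphism S T P \<phi> \<Longrightarrow> a' \<lless>\<^bsub>S\<^esub> a \<Longrightarrow> b' \<lless>\<^bsub>T\<^esub> b \<Longrightarrow> \<phi> a' b' \<lless>\<^bsub>P\<^esub> \<phi> a b"
  by (simp add: cu_bimorphism_iff)

section \<open>Formal sums, their tensor preorder and the relation of shrinking\<close>

locale tensor_model = S: cu_semigroup S + T: cu_semigroup T
  for S :: "'a po_monoid" and T :: "'b po_monoid"
begin

definition formal_sums :: "('a \<times> 'b) multiset monoid" where
  "formal_sums = \<lparr>carrier = {x. set_mset x \<subseteq> carrier S \<times> carrier T}, monoid.mult = (+), one = {#}\<rparr>"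

lemma formal_sums_simps [simp]:
  "x \<oplus>\<^bsub>formal_sums\<^esub> y = x + y" "\<zero>\<^bsub>formal_sums\<^esub> = {#}"
  "x \<in> carrier formal_sums \<longleftrightarrow> set_mset x \<subseteq> carrier S \<times> carrier T"
  by (simp_all add: formal_sums_def)

text \<open>The smallest additive preorder that makes the pairing biadditive, monotone and
  zero-preserving. Each additivity law appears in both directions because no quotient is formed:
  mutual comparability plays the role of equality, and the ideals cannot tell such sums
  apart.\<close>

inductive tensor_le :: "('a \<times> 'b) multiset \<Rightarrow> ('a \<times> 'b) multiset \<Rightarrow> bool" (infix \<open>\<lesssim>\<close> 50) where
  refl: "set_mset x \<subseteq> carrier S \<times> carrier T \<Longrightarrow> x \<lesssim> x"
| trans: "x \<lesssim> y \<Longrightarrow> y \<lesssim> z \<Longrightarrow> x \<lesssim> z"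
| add: "x \<lesssim> y \<Longrightarrow> set_mset z \<subseteq> carrier S \<times> carrier T \<Longrightarrow> x + z \<lesssim> y + z"
| pair: "a \<preceq>\<^bsub>S\<^esub> a' \<Longrightarrow> b \<preceq>\<^bsub>T\<^esub> b' \<Longrightarrow> a \<in> carrier S \<Longrightarrow> a' \<in> carrier S \<Longrightarrow>
    b \<in> carrier T \<Longrightarrow> b' \<in> carrier T \<Longrightarrow> {#(a, b)#} \<lesssim> {#(a', b')#}"
| split1: "a \<in> carrier S \<Longrightarrow> a' \<in> carrier S \<Longrightarrow> b \<in> carrier T \<Longrightarrow>
    {#(a \<oplus>\<^bsub>S\<^esub> a', b)#} \<lesssim> {#(a, b), (a', b)#}"
| join1: "a \<in> carrier S \<Longrightarrow> a' \<in> carrier S \<Longrightarrow> b \<in> carrier T \<Longrightarrow>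
    {#(a, b), (a', b)#} \<lesssim> {#(a \<oplus>\<^bsub>S\<^esub> a', b)#}"
| split2: "a \<in> carrier S \<Longrightarrow> b \<in> carrier T \<Longrightarrow> b' \<in> carrier T \<Longrightarrow>
    {#(a, b \<oplus>\<^bsub>T\<^esub> b')#} \<lesssim> {#(a, b), (a, b')#}"
| join2: "a \<in> carrier S \<Longrightarrow> b \<in> carrier T \<Longrightarrow> b' \<in> carrier T \<Longrightarrow>
    {#(a, b), (a, b')#} \<lesssim> {#(a, b \<oplus>\<^bsub>T\<^esub> b')#}"
| zero1: "b \<in> carrier T \<Longrightarrow> {#(\<zero>\<^bsub>S\<^esub>, b)#} \<lesssim> {#}"
| zero2: "a \<in> carrier S \<Longrightarrow> {#(a, \<zero>\<^bsub>T\<^esub>)#} \<lesssim> {#}"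
| zero_le: "a \<in> carrier S \<Longrightarrow> b \<in> carrier T \<Longrightarrow> {#} \<lesssim> {#(a, b)#}"

declare tensor_le.trans [trans]

definition pair_below :: "'a \<times> 'b \<Rightarrow> 'a \<times> 'b \<Rightarrow> bool" where
  "pair_below p q \<longleftrightarrow> fst p \<lless>\<^bsub>S\<^esub> fst q \<and> snd p \<lless>\<^bsub>T\<^esub> snd q"

text \<open>Terms are shrunk on the right only. \<open>tensor_le_pair_below\<close> moves a
  shrinking past the preorder, so the composite is transitive all the same.\<close>

definition tensor_prec :: "('a \<times> 'b) multiset \<Rightarrow> ('a \<times> 'b) multiset \<Rightarrow> bool" (infix \<open>\<sqsubset>\<close> 50) where
  "x \<sqsubset> y \<longleftrightarrow> (\<exists>z. x \<lesssim> z \<and> rel_mset pair_below z y)"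

lemma tensor_le_carrier:
  "x \<lesssim> y \<Longrightarrow> set_mset x \<subseteq> carrier S \<times> carrier T \<and> set_mset y \<subseteq> carrier S \<times> carrier T"
  by (induction rule: tensor_le.induct) auto

lemma pair_below_carrier:
  "pair_below p q \<Longrightarrow> p \<in> carrier S \<times> carrier T \<and> q \<in> carrier S \<times> carrier T"
  by (auto simp: pair_below_def mem_Times_iff dest: S.way_below_carrier T.way_below_carrier)

lemma rel_pair_below_carrier:
  "rel_mset pair_below x y \<Longrightarrow>
    set_mset x \<subseteq> carrier S \<times> carrier T \<and> set_mset y \<subseteq> carrier S \<times> carrier T"
  unfolding multiset.in_rel by (force dest: pair_below_carrier)

lemma pair_below_trans: "pair_below p q \<Longrightarrow> pair_below q r \<Longrightarrow> pair_below p r"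
  unfolding pair_below_def using S.way_below_trans T.way_below_trans by blast

lemma pair_below_interpolate: "pair_below p q \<Longrightarrow> \<exists>r. pair_below p r \<and> pair_below r q"
  unfolding pair_below_def using S.way_below_interpolate T.way_below_interpolate
  by (metis fst_conv snd_conv)

lemma rel_pair_below_trans:
  assumes "rel_mset pair_below x y" "rel_mset pair_below y z"
  shows "rel_mset pair_below x z"
proof -
  have "rel_mset (pair_below OO pair_below) x z"
    unfolding multiset.rel_compp using assms by blast
  then show ?thesis
    by (rule multiset.rel_mono_strong) (auto intro: pair_below_trans)
qed

lemma rel_pair_below_interpolate:
  assumes "rel_mset pair_below x y"
  obtains z where "rel_mset pair_below x z" "rel_mset pair_below z y"
proof -
  have "rel_mset (pair_below OO pair_below) x y"
    using assms by (rule multiset.rel_mono_strong) (use pair_below_interpolate in blast)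
  then show ?thesis using that unfolding multiset.rel_compp by blast
qed

lemma rel_pair_below_single: "a' \<lless>\<^bsub>S\<^esub> a \<Longrightarrow> b' \<lless>\<^bsub>T\<^esub> b \<Longrightarrow> rel_mset pair_below {#(a', b')#} {#(a, b)#}"
  by (simp add: rel_mset_Plus pair_below_def)

lemma rel_pair_below_pair:
  "a' \<lless>\<^bsub>S\<^esub> a \<Longrightarrow> b' \<lless>\<^bsub>T\<^esub> b \<Longrightarrow> c' \<lless>\<^bsub>S\<^esub> c \<Longrightarrow> d' \<lless>\<^bsub>T\<^esub> d \<Longrightarrow>
    rel_mset pair_below {#(a', b'), (c', d')#} {#(a, b), (c, d)#}"
  by (simp add: rel_mset_Plus pair_below_def)

text \<open>Every generator of the preorder tolerates shrinking: sums split by O4 through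
  \<open>way_below_add_split\<close>, joins need a common interpolant and O3, and only zero is way
  below zero. This is where the axioms of S and T enter the tensor product.\<close>

lemma tensor_le_pair_below:
  assumes "x \<lesssim> y" "rel_mset pair_below x' x"
  shows "\<exists>y'. rel_mset pair_below y' y \<and> x' \<lesssim> y'"
  using assms
proof (induction arbitrary: x' rule: tensor_le.induct)
  case (refl x)
  then show ?case using rel_pair_below_carrier tensor_le.refl by blast
next
  case (trans x y z)
  then show ?case by (meson tensor_le.trans)
next
  case (add x y z)
  obtain u v where uv: "x' = u + v" "rel_mset pair_below u x" "rel_mset pair_below v z"
    using rel_mset_unionR[OF add.prems] .
  then obtain y' where "rel_mset pair_below y' y" "u \<lesssim> y'" using add.IH by blast
  then show ?case
    using uv rel_pair_below_carrier[OF uv(3)] by (blast intro: rel_mset_union tensor_le.add)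
next
  case (pair a a' b b')
  obtain p where "x' = {#p#}" "pair_below p (a, b)" using rel_mset_singleR[OF pair.prems] .
  then obtain c d where cd: "x' = {#(c, d)#}" "c \<lless>\<^bsub>S\<^esub> a" "d \<lless>\<^bsub>T\<^esub> b"
    by (cases p) (auto simp: pair_below_def)
  then have "c \<lless>\<^bsub>S\<^esub> a'" "d \<lless>\<^bsub>T\<^esub> b'"
    using pair S.way_below_leq_trans T.way_below_leq_trans by blast+
  then have "rel_mset pair_below x' {#(a', b')#}" using cd rel_pair_below_single by simp
  then show ?case using rel_pair_below_carrier tensor_le.refl by blast
next
  case (split1 a a' b)
  obtain p where "x' = {#p#}" "pair_below p (a \<oplus>\<^bsub>S\<^esub> a', b)" using rel_mset_singleR[OF split1.prems] .
  then obtain c d where cd: "x' = {#(c, d)#}" "c \<lless>\<^bsub>S\<^esub> a \<oplus>\<^bsub>S\<^esub> a'" "d \<lless>\<^bsub>T\<^esub> b"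
    by (cases p) (auto simp: pair_below_def)
  obtain e e' where e: "e \<lless>\<^bsub>S\<^esub> a" "e' \<lless>\<^bsub>S\<^esub> a'" "c \<preceq>\<^bsub>S\<^esub> e \<oplus>\<^bsub>S\<^esub> e'"
    using S.way_below_add_split cd(2) split1 by blast
  have c: "c \<in> carrier S" "d \<in> carrier T" "e \<in> carrier S" "e' \<in> carrier S"
    using cd e S.way_below_carrier T.way_below_carrier by blast+
  have "{#(c, d)#} \<lesssim> {#(e \<oplus>\<^bsub>S\<^esub> e', d)#}" using c e(3) by (intro tensor_le.pair) (auto intro: T.leq_refl)
  also have "\<dots> \<lesssim> {#(e, d), (e', d)#}" using c by (intro tensor_le.split1)
  finally show ?case using cd e rel_pair_below_pair by blast
next
  case (split2 a b b')
  obtain p where "x' = {#p#}" "pair_below p (a, b \<oplus>\<^bsub>T\<^esub> b')" using rel_mset_singleR[OF split2.prems] .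
  then obtain c d where cd: "x' = {#(c, d)#}" "c \<lless>\<^bsub>S\<^esub> a" "d \<lless>\<^bsub>T\<^esub> b \<oplus>\<^bsub>T\<^esub> b'"
    by (cases p) (auto simp: pair_below_def)
  obtain e e' where e: "e \<lless>\<^bsub>T\<^esub> b" "e' \<lless>\<^bsub>T\<^esub> b'" "d \<preceq>\<^bsub>T\<^esub> e \<oplus>\<^bsub>T\<^esub> e'"
    using T.way_below_add_split cd(3) split2 by blast
  have c: "c \<in> carrier S" "d \<in> carrier T" "e \<in> carrier T" "e' \<in> carrier T"
    using cd e S.way_below_carrier T.way_below_carrier by blast+
  have "{#(c, d)#} \<lesssim> {#(c, e \<oplus>\<^bsub>T\<^esub> e')#}" using c e(3) by (intro tensor_le.pair) (auto intro: S.leq_refl)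
  also have "\<dots> \<lesssim> {#(c, e), (c, e')#}" using c by (intro tensor_le.split2)
  finally show ?case using cd e rel_pair_below_pair by blast
next
  case (join1 a a' b)
  obtain p p' where "x' = {#p, p'#}" "pair_below p (a, b)" "pair_below p' (a', b)"
    using rel_mset_pairR[OF join1.prems] .
  then obtain c d c' d' where cd: "x' = {#(c, d), (c', d')#}"
      "c \<lless>\<^bsub>S\<^esub> a" "d \<lless>\<^bsub>T\<^esub> b" "c' \<lless>\<^bsub>S\<^esub> a'" "d' \<lless>\<^bsub>T\<^esub> b"
    by (cases p; cases p') (auto simp: pair_below_def)
  \<comment> \<open>The two shrunken pairs may have different second components; both are enlarged
    to a common e, still way below b, so that \<open>join1\<close> applies.\<close>
  obtain e where e: "d \<lless>\<^bsub>T\<^esub> e" "d' \<lless>\<^bsub>T\<^esub> e" "e \<lless>\<^bsub>T\<^esub> b"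
    using T.way_below_interpolate_two cd(3,5) by blast
  have c: "c \<in> carrier S" "c' \<in> carrier S" "d \<in> carrier T" "d' \<in> carrier T" "e \<in> carrier T"
    using cd e S.way_below_carrier T.way_below_carrier by blast+
  have "{#(c, d)#} \<lesssim> {#(c, e)#}" "{#(c', d')#} \<lesssim> {#(c', e)#}"
    using c e by (auto intro!: tensor_le.pair S.leq_refl T.way_below_imp_leq)
  then have "{#(c, d)#} + {#(c', d')#} \<lesssim> {#(c, e)#} + {#(c', d')#}"
    "{#(c', d')#} + {#(c, e)#} \<lesssim> {#(c', e)#} + {#(c, e)#}"
    using c by (auto intro!: tensor_le.add simp del: union_mset_add_mset_left union_mset_add_mset_right)
  then have "{#(c, d), (c', d')#} \<lesssim> {#(c, e), (c', e)#}"
    using tensor_le.trans by (simp add: add_mset_commute)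
  also have "\<dots> \<lesssim> {#(c \<oplus>\<^bsub>S\<^esub> c', e)#}" using c by (intro tensor_le.join1)
  finally show ?case using cd e S.O3 rel_pair_below_single by blast
next
  case (join2 a b b')
  obtain p p' where "x' = {#p, p'#}" "pair_below p (a, b)" "pair_below p' (a, b')"
    using rel_mset_pairR[OF join2.prems] .
  then obtain c d c' d' where cd: "x' = {#(c, d), (c', d')#}"
      "c \<lless>\<^bsub>S\<^esub> a" "d \<lless>\<^bsub>T\<^esub> b" "c' \<lless>\<^bsub>S\<^esub> a" "d' \<lless>\<^bsub>T\<^esub> b'"
    by (cases p; cases p') (auto simp: pair_below_def)
  obtain e where e: "c \<lless>\<^bsub>S\<^esub> e" "c' \<lless>\<^bsub>S\<^esub> e" "e \<lless>\<^bsub>S\<^esub> a"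
    using S.way_below_interpolate_two cd(2,4) by blast
  have c: "c \<in> carrier S" "c' \<in> carrier S" "d \<in> carrier T" "d' \<in> carrier T" "e \<in> carrier S"
    using cd e S.way_below_carrier T.way_below_carrier by blast+
  have "{#(c, d)#} \<lesssim> {#(e, d)#}" "{#(c', d')#} \<lesssim> {#(e, d')#}"
    using c e by (auto intro!: tensor_le.pair T.leq_refl S.way_below_imp_leq)
  then have "{#(c, d)#} + {#(c', d')#} \<lesssim> {#(e, d)#} + {#(c', d')#}"
    "{#(c', d')#} + {#(e, d)#} \<lesssim> {#(e, d')#} + {#(e, d)#}"
    using c by (auto intro!: tensor_le.add simp del: union_mset_add_mset_left union_mset_add_mset_right)
  then have "{#(c, d), (c', d')#} \<lesssim> {#(e, d), (e, d')#}"
    using tensor_le.trans by (simp add: add_mset_commute)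
  also have "\<dots> \<lesssim> {#(e, d \<oplus>\<^bsub>T\<^esub> d')#}" using c by (intro tensor_le.join2)
  finally show ?case using cd e T.O3 rel_pair_below_single by blast
next
  case (zero1 b)
  obtain p where p: "x' = {#p#}" "pair_below p (\<zero>\<^bsub>S\<^esub>, b)" using rel_mset_singleR[OF zero1.prems] .
  then have "p = (\<zero>\<^bsub>S\<^esub>, snd p)" "snd p \<in> carrier T"
    using S.way_below_zero T.way_below_carrier by (auto simp: pair_below_def prod_eq_iff)
  then show ?case using p tensor_le.zero1 rel_mset_Zero by metis
next
  case (zero2 a)
  obtain p where p: "x' = {#p#}" "pair_below p (a, \<zero>\<^bsub>T\<^esub>)" using rel_mset_singleR[OF zero2.prems] .
  then have "p = (fst p, \<zero>\<^bsub>T\<^esub>)" "fst p \<in> carrier S"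
    using T.way_below_zero S.way_below_carrier by (auto simp: pair_below_def prod_eq_iff)
  then show ?case using p tensor_le.zero2 rel_mset_Zero by metis
next
  case (zero_le a b)
  \<comment> \<open>The left side is empty, so any shrinking of the pair would do; (0, 0) is always
    available.\<close>
  then have "rel_mset pair_below {#(\<zero>\<^bsub>S\<^esub>, \<zero>\<^bsub>T\<^esub>)#} {#(a, b)#}"
    by (intro rel_pair_below_single S.zero_way_below T.zero_way_below)
  then show ?case using zero_le tensor_le.zero_le by auto
qed

lemma tensor_prec_le_trans:
  assumes "x \<sqsubset> y" "y \<lesssim> z"
  shows "x \<sqsubset> z"
  using assms tensor_le_pair_below tensor_le.trans unfolding tensor_prec_def by meson

lemma tensor_prec_imp_rel: "rel_mset pair_below x y \<Longrightarrow> x \<sqsubset> y"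
  unfolding tensor_prec_def using rel_pair_below_carrier tensor_le.refl by blast

lemma tensor_le_add_both:
  assumes "x \<lesssim> x'" "y \<lesssim> y'"
  shows "x + y \<lesssim> x' + y'"
proof -
  have "x + y \<lesssim> x' + y" using assms tensor_le_carrier by (intro tensor_le.add) auto
  moreover have "y + x' \<lesssim> y' + x'" using assms tensor_le_carrier by (intro tensor_le.add) auto
  ultimately show ?thesis by (metis add.commute tensor_le.trans)
qed

lemma formal_zero_le: "set_mset x \<subseteq> carrier S \<times> carrier T \<Longrightarrow> {#} \<lesssim> x"
proof (induction x)
  case empty
  then show ?case by (simp add: tensor_le.refl)
next
  case (add p x)
  then have "{#} \<lesssim> {#p#}" using tensor_le.zero_le by (cases p) auto
  then show ?case using tensor_le_add_both[of "{#}" "{#p#}" "{#}" x] add by simp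
qed

lemma tensor_prec_imp_le:
  assumes "x \<sqsubset> y"
  shows "x \<lesssim> y"
proof -
  have "z \<lesssim> y" if "rel_mset pair_below z y" for z
    using that
  proof (induction y arbitrary: z rule: multiset_induct)
    case empty
    then show ?case by (simp add: tensor_le.refl)
  next
    case (add q y)
    obtain p z' where z': "z = add_mset p z'" "pair_below p q" "rel_mset pair_below z' y"
      using msed_rel_invR[OF add.prems] by blast
    have "{#p#} \<lesssim> {#q#}"
      using z'(2) pair_below_carrier[OF z'(2)] S.way_below_imp_leq T.way_below_imp_leq
        tensor_le.pair[of "fst p" "fst q" "snd p" "snd q"]
      by (auto simp: pair_below_def mem_Times_iff)
    then show ?case using tensor_le_add_both[OF _ add.IH[OF z'(3)]] z'(1) by fastforce
  qed
  then show ?thesis using assms tensor_le.trans unfolding tensor_prec_def by blast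
qed

sublocale F: interpolating_monoid formal_sums tensor_prec
proof
  show "x \<in> carrier formal_sums \<and> y \<in> carrier formal_sums" if "x \<sqsubset> y" for x y
    using that tensor_le_carrier rel_pair_below_carrier unfolding tensor_prec_def formal_sums_simps
    by blast
  show "x \<sqsubset> z" if xy: "x \<sqsubset> y" "y \<sqsubset> z" for x y z
  proof -
    obtain z' where z': "y \<lesssim> z'" "rel_mset pair_below z' z" using xy(2) by (auto simp: tensor_prec_def)
    then have "x \<sqsubset> z'" using tensor_prec_le_trans xy(1) by blast
    then show ?thesis using z'(2) rel_pair_below_trans unfolding tensor_prec_def by blast
  qed
  show "\<exists>z. x \<sqsubset> z \<and> z \<sqsubset> y" if xy: "x \<sqsubset> y" for x y
  proof -
    obtain y' where y': "x \<lesssim> y'" "rel_mset pair_below y' y" using xy by (auto simp: tensor_prec_def)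
    then obtain z where "rel_mset pair_below y' z" "rel_mset pair_below z y"
      using rel_pair_below_interpolate by blast
    then show ?thesis using y'(1) tensor_prec_imp_rel unfolding tensor_prec_def by blast
  qed
  show "x \<oplus>\<^bsub>formal_sums\<^esub> y \<sqsubset> x' \<oplus>\<^bsub>formal_sums\<^esub> y'" if "x \<sqsubset> x'" "y \<sqsubset> y'" for x x' y y'
    using that tensor_le_add_both rel_mset_union unfolding tensor_prec_def formal_sums_simps by meson
  show "\<zero>\<^bsub>formal_sums\<^esub> \<sqsubset> x" if "x \<in> carrier formal_sums" for x
  proof -
    \<comment> \<open>Replacing every term by (0, 0) is a shrinking of x, and the empty sum lies
      below the result.\<close>
    have "rel_mset pair_below (image_mset (\<lambda>_. (\<zero>\<^bsub>S\<^esub>, \<zero>\<^bsub>T\<^esub>)) x) x"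
      unfolding multiset.rel_map
      using that S.zero_way_below T.zero_way_below
      by (intro multiset.rel_refl_strong) (auto simp: pair_below_def)
    moreover from this have "{#} \<lesssim> image_mset (\<lambda>_. (\<zero>\<^bsub>S\<^esub>, \<zero>\<^bsub>T\<^esub>)) x"
      using rel_pair_below_carrier formal_zero_le by blast
    ultimately show ?thesis unfolding tensor_prec_def by auto
  qed
qed (auto simp: formal_sums_def Units_def add_ac)

end

section \<open>The universal bimorphism\<close>


lemma gen_cu_morphismD:
  assumes "\<phi> \<in> gen_cu_morphisms S T"
  shows "\<phi> \<in> carrier S \<rightarrow>\<^sub>E carrier T"
    and "a \<in> carrier S \<Longrightarrow> \<phi> a \<in> carrier T"
    and "a \<in> carrier S \<Longrightarrow> b \<in> carrier S \<Longrightarrow> \<phi> (a \<oplus>\<^bsub>S\<^esub> b) = \<phi> a \<oplus>\<^bsub>T\<^esub> \<phi> b"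
    and "\<phi> \<zero>\<^bsub>S\<^esub> = \<zero>\<^bsub>T\<^esub>"
    and "a \<in> carrier S \<Longrightarrow> b \<in> carrier S \<Longrightarrow> a \<preceq>\<^bsub>S\<^esub> b \<Longrightarrow> \<phi> a \<preceq>\<^bsub>T\<^esub> \<phi> b"
    and "increasing S c \<Longrightarrow> is_supremum S (range c) s \<Longrightarrow> is_supremum T (range (\<lambda>n. \<phi> (c n))) (\<phi> s)"
    and "increasing S c \<Longrightarrow> increasing T (\<lambda>n. \<phi> (c n))"
  using assms unfolding gen_cu_morphisms_def increasing_def by blast+

lemma cu_morphismD:
  assumes "\<phi> \<in> cu_morphisms S T"
  shows "\<phi> \<in> gen_cu_morphisms S T" and "a' \<lless>\<^bsub>S\<^esub> a \<Longrightarrow> \<phi> a' \<lless>\<^bsub>T\<^esub> \<phi> a"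
  using assms by (auto simp: cu_morphisms_def)

lemma gen_cu_morphism_restrictI:
  assumes "cu_semigroup S"
    and closed: "\<And>a. a \<in> carrier S \<Longrightarrow> f a \<in> carrier T"
    and add: "\<And>a b. a \<in> carrier S \<Longrightarrow> b \<in> carrier S \<Longrightarrow> f (a \<oplus>\<^bsub>S\<^esub> b) = f a \<oplus>\<^bsub>T\<^esub> f b"
    and zero: "f \<zero>\<^bsub>S\<^esub> = \<zero>\<^bsub>T\<^esub>"
    and mono: "\<And>a b. a \<in> carrier S \<Longrightarrow> b \<in> carrier S \<Longrightarrow> a \<preceq>\<^bsub>S\<^esub> b \<Longrightarrow> f a \<preceq>\<^bsub>T\<^esub> f b"
    and sup: "\<And>c s. increasing S c \<Longrightarrow> is_supremum S (range c) s \<Longrightarrow>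
      is_supremum T (range (\<lambda>n. f (c n))) (f s)"
  shows "(\<lambda>a\<in>carrier S. f a) \<in> gen_cu_morphisms S T"
proof -
  interpret S: cu_semigroup S by (rule assms(1))
  have "is_supremum T (range (\<lambda>n. (\<lambda>a\<in>carrier S. f a) (c n))) ((\<lambda>a\<in>carrier S. f a) s)"
    if c: "increasing S c \<and> is_supremum S (range c) s" for c s
  proof -
    have "c n \<in> carrier S" "s \<in> carrier S" for n
      using c by (auto simp: increasing_def is_supremum_def)
    then show ?thesis using sup c by simp
  qed
  then show ?thesis using closed add zero mono by (simp add: gen_cu_morphisms_def)
qed

lemma cu_morphism_restrictI:
  assumes "(\<lambda>a\<in>carrier S. f a) \<in> gen_cu_morphisms S T"
    and "\<And>a' a. a' \<lless>\<^bsub>S\<^esub> a \<Longrightarrow> f a' \<lless>\<^bsub>T\<^esub> f a"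
  shows "(\<lambda>a\<in>carrier S. f a) \<in> cu_morphisms S T"
  using assms by (auto simp: cu_morphisms_def way_below_def[of S])

lemma gen_cu_morphism_compose:
  assumes S: "cu_semigroup S" and \<phi>: "\<phi> \<in> gen_cu_morphisms S T" and \<psi>: "\<psi> \<in> gen_cu_morphisms T P"
  shows "compose (carrier S) \<psi> \<phi> \<in> gen_cu_morphisms S P"
  unfolding compose_def
  by (rule gen_cu_morphism_restrictI[OF S])
    (simp_all add: gen_cu_morphismD(2-7)[OF \<phi>] gen_cu_morphismD(2-7)[OF \<psi>])

lemma cu_morphism_compose:
  assumes S: "cu_semigroup S" and "\<phi> \<in> cu_morphisms S T" and "\<psi> \<in> cu_morphisms T P"
  shows "compose (carrier S) \<psi> \<phi> \<in> cu_morphisms S P"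
  unfolding compose_def
proof (rule cu_morphism_restrictI)
  show "(\<lambda>a\<in>carrier S. \<psi> (\<phi> a)) \<in> gen_cu_morphisms S P"
    using gen_cu_morphism_compose[OF S] cu_morphismD(1) assms(2,3) unfolding compose_def by metis
qed (use assms cu_morphismD(2) in metis)

lemma gen_cu_morphism_id: "cu_semigroup S \<Longrightarrow> (\<lambda>a\<in>carrier S. a) \<in> gen_cu_morphisms S S"
  by (rule gen_cu_morphism_restrictI) simp_all

lemma cu_morphism_id: "cu_semigroup S \<Longrightarrow> (\<lambda>a\<in>carrier S. a) \<in> cu_morphisms S S"
  by (intro cu_morphism_restrictI gen_cu_morphism_id)

lemma gen_cu_bimorphism_left:
  assumes S: "cu_semigroup S" and "cu_semigroup T" "gen_cu_bimorphism S T P \<phi>" "b \<in> carrier T"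
  shows "(\<lambda>a\<in>carrier S. \<phi> a b) \<in> gen_cu_morphisms S P"
proof -
  interpret T: cu_semigroup T by (rule assms(2))
  note f = gen_cu_bimorphismD[OF assms(3)]
  show ?thesis
  proof (rule gen_cu_morphism_restrictI[OF S])
    show "is_supremum P (range (\<lambda>n. \<phi> (c n) b)) (\<phi> s b)"
      if "increasing S c" "is_supremum S (range c) s" for c s
      using f(8)[of c "\<lambda>_. b" s b] T.increasing_const T.is_supremum_const that assms(4) by simp
  qed (simp_all add: f(1-7) assms(4))
qed

lemma gen_cu_bimorphism_comp:
  assumes \<phi>: "gen_cu_bimorphism S T P \<phi>" and \<alpha>: "\<alpha> \<in> gen_cu_morphisms S' S"
    and \<beta>: "\<beta> \<in> gen_cu_morphisms T' T"
  shows "gen_cu_bimorphism S' T' P (\<lambda>a b. \<phi> (\<alpha> a) (\<beta> b))"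
  using gen_cu_bimorphismD[OF \<phi>] gen_cu_morphismD(2-7)[OF \<alpha>] gen_cu_morphismD(2-7)[OF \<beta>]
  by (simp add: gen_cu_bimorphism_def)

lemma cu_bimorphism_comp:
  assumes "cu_bimorphism S T P \<phi>" "\<alpha> \<in> cu_morphisms S' S" "\<beta> \<in> cu_morphisms T' T"
  shows "cu_bimorphism S' T' P (\<lambda>a b. \<phi> (\<alpha> a) (\<beta> b))"
  using assms gen_cu_bimorphism_comp[of S T P \<phi> \<alpha> S' \<beta> T']
  by (simp add: cu_bimorphism_iff cu_morphisms_def)

text \<open>Bimorphisms, unlike morphisms, are not extensional functions; agreement on the carriers
  has to be exchanged explicitly.\<close>

lemma cu_bimorphism_cong:
  assumes "cu_semigroup S" "cu_semigroup T" and \<phi>: "cu_bimorphism S T P \<phi>"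
    and eq: "\<And>a b. a \<in> carrier S \<Longrightarrow> b \<in> carrier T \<Longrightarrow> \<psi> a b = \<phi> a b"
  shows "cu_bimorphism S T P \<psi>"
proof -
  interpret S: cu_semigroup S by (rule assms(1))
  interpret T: cu_semigroup T by (rule assms(2))
  note f = gen_cu_bimorphismD[OF cu_bimorphism_gen[OF \<phi>]]
  have "is_supremum P (range (\<lambda>k. \<psi> (c k) (d k))) (\<psi> s t)"
    if "increasing S c \<and> increasing T d \<and> is_supremum S (range c) s \<and> is_supremum T (range d) t"
    for c d s t
  proof -
    have "c k \<in> carrier S" "d k \<in> carrier T" "s \<in> carrier S" "t \<in> carrier T" for k
      using that by (auto simp: increasing_def is_supremum_def)
    then show ?thesis using f(8)[of c d s t] that by (simp add: eq)
  qed
  moreover have "\<psi> a' b' \<lless>\<^bsub>P\<^esub> \<psi> a b" if "a' \<lless>\<^bsub>S\<^esub> a \<and> b' \<lless>\<^bsub>T\<^esub> b" for a' a b' b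
    using cu_bimorphism_way_below[OF \<phi>] that S.way_below_carrier T.way_below_carrier by (metis eq)
  ultimately show ?thesis using f(1-7) by (simp add: cu_bimorphism_def eq)
qed

lemma gen_cu_bimorphism_increasing:
  assumes "cu_semigroup P" and \<phi>: "gen_cu_bimorphism S T P \<phi>" and "increasing S c" "increasing T d"
  shows "increasing P (\<lambda>k. \<phi> (c k) (d k))"
proof -
  interpret P: cu_semigroup P by (rule assms(1))
  have c: "c k \<in> carrier S" "d k \<in> carrier T" "c k \<preceq>\<^bsub>S\<^esub> c (Suc k)" "d k \<preceq>\<^bsub>T\<^esub> d (Suc k)" for k
    using assms(3,4) by (auto simp: increasing_def)
  then have "\<phi> (c k) (d k) \<preceq>\<^bsub>P\<^esub> \<phi> (c (Suc k)) (d k)"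
    "\<phi> (c (Suc k)) (d k) \<preceq>\<^bsub>P\<^esub> \<phi> (c (Suc k)) (d (Suc k))" for k
    by (simp_all add: gen_cu_bimorphismD(6,7)[OF \<phi>])
  then have "\<phi> (c k) (d k) \<preceq>\<^bsub>P\<^esub> \<phi> (c (Suc k)) (d (Suc k))" for k
    using P.leq_trans c gen_cu_bimorphismD(1)[OF \<phi>] by meson
  then show ?thesis using c gen_cu_bimorphismD(1)[OF \<phi>] by (simp add: increasing_def)
qed

lemma cu_bimorphism_post:
  assumes P: "cu_semigroup P" and \<phi>: "cu_bimorphism S T P \<phi>" and \<gamma>: "\<gamma> \<in> cu_morphisms P Q"
  shows "cu_bimorphism S T Q (\<lambda>a b. \<gamma> (\<phi> a b))"
proof -
  note f = gen_cu_bimorphismD[OF cu_bimorphism_gen[OF \<phi>]]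
    and g = gen_cu_morphismD[OF cu_morphismD(1)[OF \<gamma>]]
  have "is_supremum Q (range (\<lambda>k. \<gamma> (\<phi> (c k) (d k)))) (\<gamma> (\<phi> s t))"
    if "increasing S c \<and> increasing T d \<and> is_supremum S (range c) s \<and> is_supremum T (range d) t"
    for c d s t
    using that
    by (intro g(6) f(8) gen_cu_bimorphism_increasing[OF P cu_bimorphism_gen[OF \<phi>]]) simp_all
  then show ?thesis
    using f(1-7) g(2-5) cu_bimorphism_way_below[OF \<phi>] cu_morphismD(2)[OF \<gamma>]
    by (simp add: cu_bimorphism_def)
qed

section \<open>Pure tensors as principal ideals, and their universality\<close>

context tensor_model
begin

lemma principal_mono: "x \<lesssim> y \<Longrightarrow> F.principal x \<subseteq> F.principal y"
  using tensor_prec_le_trans by (auto simp: F.principal_def)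

lemma principal_eq: "x \<lesssim> y \<Longrightarrow> y \<lesssim> x \<Longrightarrow> F.principal x = F.principal y"
  using principal_mono by blast

text \<open>A shrinking of a single pair is again a single pair, way below in each component, so it
  is already a shrinking of some (c k, d k). This is the joint continuity of pure tensors.\<close>

lemma principal_pair_supremum:
  assumes "increasing S c" "increasing T d" "is_supremum S (range c) s" "is_supremum T (range d) t"
  shows "F.principal {#(s, t)#} = (\<Union>k. F.principal {#(c k, d k)#})"
proof (intro equalityI subsetI)
  fix x assume "x \<in> F.principal {#(s, t)#}"
  then obtain z where z: "x \<lesssim> z" "rel_mset pair_below z {#(s, t)#}"
    by (auto simp: F.principal_def tensor_prec_def)
  obtain p where p: "z = {#p#}" "pair_below p (s, t)" using rel_mset_singleR[OF z(2)] .
  then have "fst p \<lless>\<^bsub>S\<^esub> s" "snd p \<lless>\<^bsub>T\<^esub> t" by (auto simp: pair_below_def)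
  then obtain k l where "\<And>n. n \<ge> k \<Longrightarrow> fst p \<lless>\<^bsub>S\<^esub> c n" "\<And>n. n \<ge> l \<Longrightarrow> snd p \<lless>\<^bsub>T\<^esub> d n"
    using assms by (metis S.way_below_supremum T.way_below_supremum)
  then have "pair_below p (c (max k l), d (max k l))" by (simp add: pair_below_def)
  then have "rel_mset pair_below z {#(c (max k l), d (max k l))#}" using p(1) by (simp add: rel_mset_Plus)
  then show "x \<in> (\<Union>k. F.principal {#(c k, d k)#})"
    using z(1) by (auto simp: F.principal_def tensor_prec_def)
next
  fix x assume "x \<in> (\<Union>k. F.principal {#(c k, d k)#})"
  then obtain k where k: "x \<in> F.principal {#(c k, d k)#}" by blast
  have "{#(c k, d k)#} \<lesssim> {#(s, t)#}"
    using assms by (intro tensor_le.pair) (auto simp: increasing_def is_supremum_def)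
  then show "x \<in> F.principal {#(s, t)#}" using k principal_mono by blast
qed

text \<open>Approximating chains of a and b, run in parallel, form a chain of one-term sums. In
  particular the principal ideal of a pair belongs to the completion.\<close>

lemma principal_pair_generated:
  assumes "a \<in> carrier S" "b \<in> carrier T"
  obtains c d where "increasing S c" "is_supremum S (range c) a" "increasing T d" "is_supremum T (range d) b"
    "F.chain (\<lambda>n. {#(c n, d n)#})" "F.principal {#(a, b)#} = F.generated (\<lambda>n. {#(c n, d n)#})"
proof -
  obtain c where c: "\<And>n. c n \<lless>\<^bsub>S\<^esub> c (Suc n)" "increasing S c" "is_supremum S (range c) a"
    using S.way_below_chain_obtains[OF assms(1)] by metis
  obtain d where d: "\<And>n. d n \<lless>\<^bsub>T\<^esub> d (Suc n)" "increasing T d" "is_supremum T (range d) b"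
    using T.way_below_chain_obtains[OF assms(2)] by metis
  have "F.chain (\<lambda>n. {#(c n, d n)#})"
    unfolding F.chain_def using c(1) d(1) by (auto intro: tensor_prec_imp_rel rel_pair_below_single)
  moreover have "F.principal {#(a, b)#} = F.generated (\<lambda>n. {#(c n, d n)#})"
    using principal_pair_supremum c d by (simp add: F.generated_principal)
  ultimately show ?thesis using c(2,3) d(2,3) that by blast
qed

text \<open>A shrinking of x + y falls apart into shrinkings of x and of y. They are interpolated
  because membership in a sum of ideals asks for summands whose sum lies strictly above.\<close>

lemma principal_add:
  assumes "x \<in> carrier formal_sums" "y \<in> carrier formal_sums"
  shows "F.principal (x + y) = F.principal x \<oplus>\<^bsub>F.completion\<^esub> F.principal y"
proof (intro equalityI subsetI)
  fix z assume "z \<in> F.principal (x + y)"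
  then obtain w where w: "z \<lesssim> w" "rel_mset pair_below w (x + y)"
    by (auto simp: F.principal_def tensor_prec_def)
  obtain u v where uv: "w = u + v" "rel_mset pair_below u x" "rel_mset pair_below v y"
    using rel_mset_unionR[OF w(2)] .
  obtain u' v' where "rel_mset pair_below u u'" "rel_mset pair_below u' x"
    "rel_mset pair_below v v'" "rel_mset pair_below v' y"
    using rel_pair_below_interpolate uv(2,3) by metis
  moreover from this have "z \<sqsubset> u' + v'" using w(1) uv(1) rel_mset_union unfolding tensor_prec_def by blast
  ultimately show "z \<in> F.principal x \<oplus>\<^bsub>F.completion\<^esub> F.principal y"
    using tensor_prec_imp_rel by (auto simp: F.principal_def)
next
  fix z assume "z \<in> F.principal x \<oplus>\<^bsub>F.completion\<^esub> F.principal y"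
  then obtain i j where ij: "i \<sqsubset> x" "j \<sqsubset> y" "z \<sqsubset> i + j" by (auto simp: F.principal_def)
  have "i + j \<sqsubset> x + y" using F.prec_add[OF ij(1,2)] by simp
  then show "z \<in> F.principal (x + y)" using F.prec_trans[OF ij(3)] by (simp add: F.principal_def)
qed

lemma principal_empty: "F.principal {#} = \<zero>\<^bsub>F.completion\<^esub>"
  by (simp add: F.completion_zero F.generated_principal)

sublocale M: cu_semigroup F.completion
  by (rule F.completion_cu_semigroup)

lemma principal_closed:
  "x \<in> carrier formal_sums \<Longrightarrow> F.principal x \<in> carrier F.completion"
proof (induction x)
  case empty
  then show ?case by (simp add: principal_empty)
next
  case (add p x)
  then obtain a b where p: "p = (a, b)" "a \<in> carrier S" "b \<in> carrier T" by (cases p) auto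
  have "F.principal {#p#} \<in> carrier F.completion"
    using principal_pair_generated[OF p(2,3)] F.generated_in_carrier p(1) by metis
  moreover have "F.principal x \<in> carrier F.completion" using add by simp
  moreover have "F.principal (add_mset p x) = F.principal {#p#} \<oplus>\<^bsub>F.completion\<^esub> F.principal x"
    using principal_add[of "{#p#}" x] add.prems by simp
  ultimately show ?case by simp
qed

definition model_tensor :: "'a \<Rightarrow> 'b \<Rightarrow> ('a, 'b) tensor" where
  "model_tensor a b = F.principal {#(a, b)#}"

lemma model_tensor_closed:
  "a \<in> carrier S \<Longrightarrow> b \<in> carrier T \<Longrightarrow> model_tensor a b \<in> carrier F.completion"
  by (simp add: model_tensor_def principal_closed)

lemma model_tensor_bimorphism: "cu_bimorphism S T F.completion model_tensor"
  unfolding cu_bimorphism_def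
proof (intro conjI ballI allI impI)
  show "model_tensor a b \<in> carrier F.completion" if "a \<in> carrier S" "b \<in> carrier T" for a b
    using that by (rule model_tensor_closed)
  show "model_tensor (a \<oplus>\<^bsub>S\<^esub> a') b = model_tensor a b \<oplus>\<^bsub>F.completion\<^esub> model_tensor a' b"
    if "a \<in> carrier S" "a' \<in> carrier S" "b \<in> carrier T" for a a' b
    using that principal_eq[OF tensor_le.split1 tensor_le.join1, of a a' b]
      principal_add[of "{#(a, b)#}" "{#(a', b)#}"] by (simp add: model_tensor_def add_mset_commute)
  show "model_tensor a (b \<oplus>\<^bsub>T\<^esub> b') = model_tensor a b \<oplus>\<^bsub>F.completion\<^esub> model_tensor a b'"
    if "a \<in> carrier S" "b \<in> carrier T" "b' \<in> carrier T" for a b b'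
    using that principal_eq[OF tensor_le.split2 tensor_le.join2, of a b b']
      principal_add[of "{#(a, b)#}" "{#(a, b')#}"] by (simp add: model_tensor_def add_mset_commute)
  show "model_tensor \<zero>\<^bsub>S\<^esub> b = \<zero>\<^bsub>F.completion\<^esub>" if "b \<in> carrier T" for b
    using principal_eq[OF tensor_le.zero1 tensor_le.zero_le, OF that _ that]
    by (simp add: model_tensor_def principal_empty)
  show "model_tensor a \<zero>\<^bsub>T\<^esub> = \<zero>\<^bsub>F.completion\<^esub>" if "a \<in> carrier S" for a
    using principal_eq[OF tensor_le.zero2 tensor_le.zero_le, OF that that]
    by (simp add: model_tensor_def principal_empty)
  show "model_tensor a' b \<preceq>\<^bsub>F.completion\<^esub> model_tensor a b"
    if "a \<in> carrier S" "a' \<in> carrier S" "b \<in> carrier T" "a' \<preceq>\<^bsub>S\<^esub> a" for a a' b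
    using that principal_mono[OF tensor_le.pair, of a' a b b] T.leq_refl by (simp add: model_tensor_def)
  show "model_tensor a b' \<preceq>\<^bsub>F.completion\<^esub> model_tensor a b"
    if "a \<in> carrier S" "b \<in> carrier T" "b' \<in> carrier T" "b' \<preceq>\<^bsub>T\<^esub> b" for a b b'
    using that principal_mono[OF tensor_le.pair, of a a b' b] S.leq_refl by (simp add: model_tensor_def)
  show "is_supremum F.completion (range (\<lambda>k. model_tensor (c k) (d k))) (model_tensor s t)"
    if cd: "increasing S c \<and> increasing T d \<and> is_supremum S (range c) s \<and> is_supremum T (range d) t"
    for c d s t
  proof -
    have "{#(c n, d n)#} \<lesssim> {#(c (Suc n), d (Suc n))#}" for n
      using cd by (intro tensor_le.pair) (auto simp: increasing_def)
    then have "increasing F.completion (\<lambda>k. model_tensor (c k) (d k))"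
      using cd principal_mono model_tensor_closed by (simp add: increasing_def model_tensor_def)
    then show ?thesis
      using F.completion_is_supremum principal_pair_supremum[of c d s t] cd
      by (simp add: model_tensor_def)
  qed
  show "model_tensor a' b' \<lless>\<^bsub>F.completion\<^esub> model_tensor a b"
    if wb: "a' \<lless>\<^bsub>S\<^esub> a \<and> b' \<lless>\<^bsub>T\<^esub> b" for a' a b' b
  proof -
    \<comment> \<open>The smaller pair itself is the bound that
      \<open>completion_way_below_iff\<close> asks for.\<close>
    have "{#(a', b')#} \<in> model_tensor a b"
      using wb tensor_prec_imp_rel rel_pair_below_single by (simp add: model_tensor_def F.principal_def)
    moreover have "\<forall>x\<in>model_tensor a' b'. x \<sqsubset> {#(a', b')#}"
      by (simp add: model_tensor_def F.principal_def)
    ultimately show ?thesis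
      using wb model_tensor_closed S.way_below_carrier T.way_below_carrier
      unfolding F.completion_way_below_iff by blast
  qed
qed

text \<open>Principal ideals are finite sums of pure tensors, so additivity reduces the comparison
  to these, and continuity extends it to all ideals.\<close>

lemma model_gen_cu_morphism_leq:
  assumes P: "cu_semigroup P"
    and \<alpha>: "\<alpha> \<in> gen_cu_morphisms F.completion P" and \<beta>: "\<beta> \<in> gen_cu_morphisms F.completion P"
    and leq: "\<And>a b. a \<in> carrier S \<Longrightarrow> b \<in> carrier T \<Longrightarrow>
      \<alpha> (model_tensor a b) \<preceq>\<^bsub>P\<^esub> \<beta> (model_tensor a b)"
    and I: "I \<in> carrier F.completion"
  shows "\<alpha> I \<preceq>\<^bsub>P\<^esub> \<beta> I"
proof (rule F.gen_cu_morphism_leq_if_principal[OF P \<alpha> \<beta> principal_closed _ I])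
  interpret P: cu_semigroup P by (rule P)
  note a = gen_cu_morphismD[OF \<alpha>] and b = gen_cu_morphismD[OF \<beta>]
  show "\<alpha> (F.principal x) \<preceq>\<^bsub>P\<^esub> \<beta> (F.principal x)" if "x \<in> carrier formal_sums" for x
    using that
  proof (induction x)
    case empty
    then show ?case by (simp add: principal_empty a(4) b(4) P.leq_refl)
  next
    case (add p x)
    then obtain c d where p: "p = (c, d)" "c \<in> carrier S" "d \<in> carrier T" by (cases p) auto
    have "F.principal (add_mset p x) = model_tensor c d \<oplus>\<^bsub>F.completion\<^esub> F.principal x"
      using principal_add[of "{#p#}" x] add.prems p by (simp add: model_tensor_def)
    moreover have "F.principal x \<in> carrier F.completion" using add.prems by (simp add: principal_closed)
    ultimately show ?case
      using add leq p(2,3) model_tensor_closed by (simp add: a(2,3) b(2,3) P.add_mono_both)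
  qed
qed

definition hom_sum :: "'p po_monoid \<Rightarrow> ('a \<Rightarrow> 'b \<Rightarrow> 'p) \<Rightarrow> ('a \<times> 'b) multiset \<Rightarrow> 'p" where
  "hom_sum P \<phi> = sum_in P (case_prod \<phi>)"

context
  fixes P :: "'p po_monoid"
  assumes P: "cu_semigroup P"
begin

interpretation P: cu_semigroup P by (rule P)

lemma hom_sum_closed: "hom_sum P \<phi> x \<in> carrier P"
  by (simp add: hom_sum_def P.sum_in_closed_add)

lemma hom_sum_empty: "hom_sum P \<phi> {#} = \<zero>\<^bsub>P\<^esub>"
  by (simp add: hom_sum_def)

lemma hom_sum_add_mset:
  "\<phi> (fst p) (snd p) \<in> carrier P \<Longrightarrow>
    hom_sum P \<phi> (add_mset p x) = \<phi> (fst p) (snd p) \<oplus>\<^bsub>P\<^esub> hom_sum P \<phi> x"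
  by (simp add: hom_sum_def P.sum_in_closed_add case_prod_beta)

lemma hom_sum_single: "\<phi> a b \<in> carrier P \<Longrightarrow> hom_sum P \<phi> {#(a, b)#} = \<phi> a b"
  by (simp add: hom_sum_add_mset hom_sum_empty)

lemma hom_sum_union:
  assumes "gen_cu_bimorphism S T P \<phi>" "set_mset x \<subseteq> carrier S \<times> carrier T"
  shows "hom_sum P \<phi> (x + y) = hom_sum P \<phi> x \<oplus>\<^bsub>P\<^esub> hom_sum P \<phi> y"
  unfolding hom_sum_def
  by (rule P.sum_in_union)
    (use assms(2) in \<open>auto simp: gen_cu_bimorphismD(1)[OF assms(1)] dest!: subsetD\<close>)

text \<open>The generators of the preorder are precisely laws that a generalized bimorphism
  satisfies.\<close>

lemma hom_sum_tensor_le: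
  assumes \<phi>: "gen_cu_bimorphism S T P \<phi>" and "x \<lesssim> y"
  shows "hom_sum P \<phi> x \<preceq>\<^bsub>P\<^esub> hom_sum P \<phi> y"
  using assms(2)
proof (induction rule: tensor_le.induct)
  case (trans x y z)
  then show ?case using P.leq_trans hom_sum_closed by blast
next
  case (add x y z)
  then show ?case
    using tensor_le_carrier[OF add.hyps(1)]
    by (simp add: hom_sum_union[OF \<phi>] P.add_mono hom_sum_closed)
next
  case (pair a a' b b')
  then have "\<phi> a b \<preceq>\<^bsub>P\<^esub> \<phi> a' b'"
    using gen_cu_bimorphismD(1,6,7)[OF \<phi>] P.leq_trans[of "\<phi> a b" "\<phi> a' b" "\<phi> a' b'"] by simp
  then show ?case using gen_cu_bimorphismD(1)[OF \<phi>] pair by (simp add: hom_sum_single)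
qed (simp_all add: gen_cu_bimorphismD[OF \<phi>] hom_sum_add_mset hom_sum_empty hom_sum_closed
      P.leq_refl P.zero_leq S.m_closed T.m_closed)

text \<open>The termwise way-below relations add up by O3, and the preorder is absorbed on the left.
  Two maps are allowed for the same reason as in \<open>extension_way_below\<close>.\<close>

lemma hom_sum_way_below:
  assumes \<phi>': "gen_cu_bimorphism S T P \<phi>'" and \<phi>: "gen_cu_bimorphism S T P \<phi>"
    and wb: "\<And>a' a b' b. a' \<lless>\<^bsub>S\<^esub> a \<Longrightarrow> b' \<lless>\<^bsub>T\<^esub> b \<Longrightarrow> \<phi>' a' b' \<lless>\<^bsub>P\<^esub> \<phi> a b"
    and "x \<sqsubset> y"
  shows "hom_sum P \<phi>' x \<lless>\<^bsub>P\<^esub> hom_sum P \<phi> y"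
proof -
  have *: "hom_sum P \<phi>' z \<lless>\<^bsub>P\<^esub> hom_sum P \<phi> y" if "rel_mset pair_below z y" for z
    using that
  proof (induction y arbitrary: z rule: multiset_induct)
    case empty
    from empty.prems have "z = {#}" by simp
    then show ?case by (simp add: hom_sum_empty P.zero_way_below)
  next
    case (add q y)
    obtain p z' where z': "z = add_mset p z'" "pair_below p q" "rel_mset pair_below z' y"
      using msed_rel_invR[OF add.prems] by blast
    have "\<phi>' (fst p) (snd p) \<lless>\<^bsub>P\<^esub> \<phi> (fst q) (snd q)"
      using z'(2) wb by (simp add: pair_below_def)
    moreover from this have "hom_sum P \<phi>' (add_mset p z') = \<phi>' (fst p) (snd p) \<oplus>\<^bsub>P\<^esub> hom_sum P \<phi>' z'"
      "hom_sum P \<phi> (add_mset q y) = \<phi> (fst q) (snd q) \<oplus>\<^bsub>P\<^esub> hom_sum P \<phi> y"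
      using P.way_below_carrier by (auto intro!: hom_sum_add_mset)
    ultimately show ?case using P.O3 add.IH[OF z'(3)] z'(1) by simp
  qed
  obtain z where "x \<lesssim> z" "rel_mset pair_below z y"
    using assms(4) by (auto simp: tensor_prec_def)
  then show ?thesis
    using * hom_sum_tensor_le[OF \<phi>'] P.leq_way_below_trans hom_sum_closed by blast
qed

lemma hom_sum_monotone_hom:
  assumes \<phi>: "gen_cu_bimorphism S T P \<phi>"
  shows "F.monotone_hom P (hom_sum P \<phi>)"
proof -
  have "hom_sum P \<phi> x \<preceq>\<^bsub>P\<^esub> hom_sum P \<phi> y" if "x \<sqsubset> y" for x y
    using that by (intro hom_sum_tensor_le[OF \<phi>] tensor_prec_imp_le)
  then show ?thesis
    using hom_sum_union[OF \<phi>] by (simp add: F.monotone_hom_def hom_sum_closed hom_sum_empty)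
qed

definition model_lift :: "('a \<Rightarrow> 'b \<Rightarrow> 'p) \<Rightarrow> ('a, 'b) tensor \<Rightarrow> 'p" where
  "model_lift \<phi> = F.extension P (hom_sum P \<phi>)"

lemma model_lift_gen:
  "gen_cu_bimorphism S T P \<phi> \<Longrightarrow> model_lift \<phi> \<in> gen_cu_morphisms F.completion P"
  unfolding model_lift_def by (intro F.extension_gen_cu_morphism P hom_sum_monotone_hom)

lemma model_lift_way_below:
  assumes "gen_cu_bimorphism S T P \<phi>'" and "gen_cu_bimorphism S T P \<phi>"
    and "\<And>a' a b' b. a' \<lless>\<^bsub>S\<^esub> a \<Longrightarrow> b' \<lless>\<^bsub>T\<^esub> b \<Longrightarrow> \<phi>' a' b' \<lless>\<^bsub>P\<^esub> \<phi> a b"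
    and "I \<lless>\<^bsub>F.completion\<^esub> J"
  shows "model_lift \<phi>' I \<lless>\<^bsub>P\<^esub> model_lift \<phi> J"
  unfolding model_lift_def
  by (intro F.extension_way_below[OF P _ _ _ assms(4)] hom_sum_monotone_hom hom_sum_way_below assms(1-3))

text \<open>The lift is computed along the parallel chains of
  \<open>principal_pair_generated\<close>; joint continuity of the bimorphism identifies the
  supremum with its value at (a, b).\<close>

lemma model_lift_tensor:
  assumes \<phi>: "gen_cu_bimorphism S T P \<phi>" and ab: "a \<in> carrier S" "b \<in> carrier T"
  shows "model_lift \<phi> (model_tensor a b) = \<phi> a b"
proof -
  obtain c d where cd: "increasing S c" "is_supremum S (range c) a" "increasing T d" "is_supremum T (range d) b"
    "F.chain (\<lambda>n. {#(c n, d n)#})" "F.principal {#(a, b)#} = F.generated (\<lambda>n. {#(c n, d n)#})"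
    using principal_pair_generated[OF ab] .
  have "is_supremum P (range (\<lambda>n. hom_sum P \<phi> {#(c n, d n)#})) (model_lift \<phi> (model_tensor a b))"
    unfolding model_lift_def model_tensor_def cd(6)
    using F.extension_generated(1)[OF P hom_sum_monotone_hom[OF \<phi>] cd(5)] .
  moreover have "hom_sum P \<phi> {#(c n, d n)#} = \<phi> (c n) (d n)" for n
    using cd gen_cu_bimorphismD(1)[OF \<phi>] by (simp add: hom_sum_single increasing_def)
  ultimately show ?thesis
    using gen_cu_bimorphismD(8)[OF \<phi> cd(1,3,2,4)] P.is_supremum_unique by simp
qed

lemma model_lift_cu_morphism:
  assumes "cu_bimorphism S T P \<phi>"
  shows "model_lift \<phi> \<in> cu_morphisms F.completion P"
  using model_lift_gen model_lift_way_below[of \<phi> \<phi>] assms by (auto simp: cu_morphisms_def cu_bimorphism_iff)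

end

end

section \<open>Tensor products\<close>


lemma gen_cu_morphism_eqI:
  assumes "cu_semigroup P" "\<alpha> \<in> gen_cu_morphisms S P" "\<beta> \<in> gen_cu_morphisms S P"
    and "\<And>a. a \<in> carrier S \<Longrightarrow> \<alpha> a \<preceq>\<^bsub>P\<^esub> \<beta> a" "\<And>a. a \<in> carrier S \<Longrightarrow> \<beta> a \<preceq>\<^bsub>P\<^esub> \<alpha> a"
  shows "\<alpha> = \<beta>"
proof -
  interpret P: cu_semigroup P by (rule assms(1))
  show ?thesis
    by (rule PiE_ext[OF gen_cu_morphismD(1)[OF assms(2)] gen_cu_morphismD(1)[OF assms(3)]])
      (use assms gen_cu_morphismD(2) P.leq_antisym in metis)
qed

context tensor_model
begin

text \<open>The target type is arbitrary here, unlike in the definition of the chosen tensor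
  product.\<close>

lemma model_is_tensor_product:
  "is_tensor_product TYPE('p) S T F.completion model_tensor"
  unfolding is_tensor_product_def
proof (intro conjI allI impI ballI)
  show "cu_semigroup F.completion" by (rule F.completion_cu_semigroup)
  show "cu_bimorphism S T F.completion model_tensor" by (rule model_tensor_bimorphism)
next
  fix P :: "'p po_monoid" and \<phi>
  assume "cu_semigroup P \<and> cu_bimorphism S T P \<phi>"
  then have P: "cu_semigroup P" and \<phi>: "cu_bimorphism S T P \<phi>" by blast+
  interpret P: cu_semigroup P by (rule P)
  note lift = model_lift_cu_morphism[OF P \<phi>] model_lift_tensor[OF P cu_bimorphism_gen[OF \<phi>]]
  show "\<exists>!\<alpha>. \<alpha> \<in> cu_morphisms F.completion P \<and>
      (\<forall>a\<in>carrier S. \<forall>b\<in>carrier T. \<alpha> (model_tensor a b) = \<phi> a b)"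
  proof (rule ex1I[of _ "model_lift P \<phi>"])
    fix \<alpha> assume \<alpha>: "\<alpha> \<in> cu_morphisms F.completion P \<and>
      (\<forall>a\<in>carrier S. \<forall>b\<in>carrier T. \<alpha> (model_tensor a b) = \<phi> a b)"
    then have m: "\<alpha> \<in> gen_cu_morphisms F.completion P" "model_lift P \<phi> \<in> gen_cu_morphisms F.completion P"
      using lift(1) by (simp_all add: cu_morphismD(1))
    note refl = P.leq_refl[OF gen_cu_bimorphismD(1)[OF cu_bimorphism_gen[OF \<phi>]]]
    show "\<alpha> = model_lift P \<phi>"
    proof (rule gen_cu_morphism_eqI[OF P m])
      show "\<alpha> u \<preceq>\<^bsub>P\<^esub> model_lift P \<phi> u" if "u \<in> carrier F.completion" for u
        by (rule model_gen_cu_morphism_leq[OF P m _ that]) (use \<alpha> lift(2) refl in simp)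
      show "model_lift P \<phi> u \<preceq>\<^bsub>P\<^esub> \<alpha> u" if "u \<in> carrier F.completion" for u
        by (rule model_gen_cu_morphism_leq[OF P m(2,1) _ that]) (use \<alpha> lift(2) refl in simp)
    qed
  qed (use lift in auto)
next
  fix P :: "'p po_monoid" and \<alpha> \<beta>
  assume P: "cu_semigroup P" and m: "\<alpha> \<in> cu_morphisms F.completion P" "\<beta> \<in> cu_morphisms F.completion P"
  show "(\<forall>u\<in>carrier F.completion. \<alpha> u \<preceq>\<^bsub>P\<^esub> \<beta> u) \<longleftrightarrow>
      (\<forall>a\<in>carrier S. \<forall>b\<in>carrier T. \<alpha> (model_tensor a b) \<preceq>\<^bsub>P\<^esub> \<beta> (model_tensor a b))"
    using model_gen_cu_morphism_leq[OF P m[THEN cu_morphismD(1)]] by (auto simp: model_tensor_closed)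
qed

text \<open>The constant sequence z stands in for the third variable. For way-below the same
  argument would ask that z be way below itself, hence the generalized notion.\<close>

lemma trilinear_gen_cu_bimorphism:
  assumes V: "cu_semigroup V" and Z: "cu_semigroup Z"
    and \<psi>: "gen_cu_bimorphism S V W \<psi>" and \<theta>: "gen_cu_bimorphism T Z V \<theta>" and z: "z \<in> carrier Z"
  shows "gen_cu_bimorphism S T W (\<lambda>x y. \<psi> x (\<theta> y z))"
proof -
  interpret Z: cu_semigroup Z by (rule Z)
  note f = gen_cu_bimorphismD[OF \<psi>] and g = gen_cu_bimorphismD[OF \<theta>]
  have "is_supremum W (range (\<lambda>k. \<psi> (c k) (\<theta> (d k) z))) (\<psi> s (\<theta> t z))"
    if "increasing S c \<and> increasing T d \<and> is_supremum S (range c) s \<and> is_supremum T (range d) t"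
    for c d s t
    using that g(8)[OF _ Z.increasing_const[OF z] _ Z.is_supremum_const[OF z]]
      gen_cu_bimorphism_increasing[OF V \<theta> _ Z.increasing_const[OF z]]
    by (intro f(8)) blast+
  then show ?thesis using f(1-7) g(1-7) z by (simp add: gen_cu_bimorphism_def)
qed

text \<open>For each z the map in x and y is lifted to ideals. The laws in z are first proved at
  formal sums, by induction on their terms, and then pass through the extension; the laws in the
  ideal come from the lift. This produces the bimorphism behind the associator.\<close>

lemma model_trilinear_lift:
  assumes V: "cu_semigroup V" and Z: "cu_semigroup Z" and W: "cu_semigroup W"
    and \<psi>: "cu_bimorphism S V W \<psi>" and \<theta>: "cu_bimorphism T Z V \<theta>"
  shows "cu_bimorphism F.completion Z W (\<lambda>I z. model_lift W (\<lambda>x y. \<psi> x (\<theta> y z)) I)"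
proof -
  interpret Z: cu_semigroup Z by (rule Z)
  interpret W: cu_semigroup W by (rule W)
  define \<tau> where "\<tau> z = (\<lambda>x y. \<psi> x (\<theta> y z))" for z
  note f = gen_cu_bimorphismD[OF cu_bimorphism_gen[OF \<psi>]]
    and g = gen_cu_bimorphismD[OF cu_bimorphism_gen[OF \<theta>]]
  have \<tau>: "gen_cu_bimorphism S T W (\<tau> z)" if "z \<in> carrier Z" for z
    unfolding \<tau>_def
    by (rule trilinear_gen_cu_bimorphism[OF V Z cu_bimorphism_gen[OF \<psi>] cu_bimorphism_gen[OF \<theta>] that])
  note lift = gen_cu_morphismD[OF model_lift_gen[OF W \<tau>]]
    and hom = hom_sum_monotone_hom[OF W \<tau>]
  have \<tau>_closed: "\<tau> z (fst p) (snd p) \<in> carrier W" if "z \<in> carrier Z" "p \<in> carrier S \<times> carrier T" for z p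
    using gen_cu_bimorphismD(1)[OF \<tau>] that by auto
  note [simp] = hom_sum_closed[OF W] hom_sum_empty[OF W] \<tau>_closed hom_sum_add_mset[OF W]
  have hom_add: "hom_sum W (\<tau> (z \<oplus>\<^bsub>Z\<^esub> z')) x = hom_sum W (\<tau> z) x \<oplus>\<^bsub>W\<^esub> hom_sum W (\<tau> z') x"
    if "x \<in> carrier formal_sums" "z \<in> carrier Z" "z' \<in> carrier Z" for x z z'
    using that(1)
  proof (induction x)
    case (add p x)
    then have "\<tau> (z \<oplus>\<^bsub>Z\<^esub> z') (fst p) (snd p) = \<tau> z (fst p) (snd p) \<oplus>\<^bsub>W\<^esub> \<tau> z' (fst p) (snd p)"
      using that(2,3) f(3) g(1,3) by (auto simp: \<tau>_def)
    then show ?case using add that(2,3) by (simp add: W.m_ac)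
  qed simp
  have hom_zero: "hom_sum W (\<tau> \<zero>\<^bsub>Z\<^esub>) x = \<zero>\<^bsub>W\<^esub>" if "x \<in> carrier formal_sums" for x
    using that
  proof (induction x)
    case (add p x)
    then have "\<tau> \<zero>\<^bsub>Z\<^esub> (fst p) (snd p) = \<zero>\<^bsub>W\<^esub>" using f(5) g(5) by (auto simp: \<tau>_def)
    then show ?case using add by simp
  qed simp
  have hom_mono: "hom_sum W (\<tau> z') x \<preceq>\<^bsub>W\<^esub> hom_sum W (\<tau> z) x"
    if "x \<in> carrier formal_sums" "z' \<preceq>\<^bsub>Z\<^esub> z" "z \<in> carrier Z" "z' \<in> carrier Z" for x z z'
    using that(1)
  proof (induction x)
    case (add p x)
    then have "\<tau> z' (fst p) (snd p) \<preceq>\<^bsub>W\<^esub> \<tau> z (fst p) (snd p)"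
      using that(2-4) f(7) g(1,7) by (auto simp: \<tau>_def)
    then show ?case using add that(3,4) by (simp add: W.add_mono_both)
  qed (simp add: W.leq_refl)
  have hom_inc: "increasing W (\<lambda>n. hom_sum W (\<tau> (d n)) x)"
    if "x \<in> carrier formal_sums" "increasing Z d" for x d
    using that hom_mono by (simp add: increasing_def)
  have hom_sup: "is_supremum W (range (\<lambda>n. hom_sum W (\<tau> (d n)) x)) (hom_sum W (\<tau> t) x)"
    if "x \<in> carrier formal_sums" and d: "increasing Z d" "is_supremum Z (range d) t" for x d t
    using that(1)
  proof (induction x)
    case empty
    show ?case using W.is_supremum_const[OF W.one_closed] by (simp only: hom_sum_empty[OF W])
  next
    case (add p x)
    have dt: "d n \<in> carrier Z" "t \<in> carrier Z" for n
      using d by (auto simp: increasing_def is_supremum_def)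
    obtain a b where p: "p = (a, b)" "a \<in> carrier S" "b \<in> carrier T" using add.prems by (cases p) auto
    have inc: "increasing V (\<lambda>n. \<theta> b (d n))"
      using gen_cu_bimorphism_increasing[OF V cu_bimorphism_gen[OF \<theta>] T.increasing_const d(1)] p(3) .
    have "is_supremum V (range (\<lambda>n. \<theta> b (d n))) (\<theta> b t)"
      using g(8)[OF T.increasing_const[OF p(3)] d(1) T.is_supremum_const[OF p(3)] d(2)] .
    then have "is_supremum W (range (\<lambda>n. \<tau> (d n) a b)) (\<tau> t a b)"
      unfolding \<tau>_def
      by (rule f(8)[OF S.increasing_const[OF p(2)] inc S.is_supremum_const[OF p(2)]])
    moreover have "increasing W (\<lambda>n. \<tau> (d n) a b)"
      unfolding \<tau>_def
      using gen_cu_bimorphism_increasing[OF W cu_bimorphism_gen[OF \<psi>] S.increasing_const inc] p(2) .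
    ultimately have "is_supremum W (range (\<lambda>n. \<tau> (d n) a b \<oplus>\<^bsub>W\<^esub> hom_sum W (\<tau> (d n)) x))
        (\<tau> t a b \<oplus>\<^bsub>W\<^esub> hom_sum W (\<tau> t) x)"
      using add hom_inc d(1) by (intro W.O4) auto
    moreover have "hom_sum W (\<tau> z) (add_mset p x) = \<tau> z a b \<oplus>\<^bsub>W\<^esub> hom_sum W (\<tau> z) x"
      if "z \<in> carrier Z" for z
      using gen_cu_bimorphismD(1)[OF \<tau>[OF that] p(2,3)] by (simp add: p(1))
    ultimately show ?case by (simp add: dt)
  qed
  show ?thesis
    unfolding cu_bimorphism_def \<tau>_def[symmetric]
  proof (intro conjI ballI allI impI)
    show "model_lift W (\<tau> (z \<oplus>\<^bsub>Z\<^esub> z')) I = model_lift W (\<tau> z) I \<oplus>\<^bsub>W\<^esub> model_lift W (\<tau> z') I"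
      if "I \<in> carrier F.completion" "z \<in> carrier Z" "z' \<in> carrier Z" for I z z'
      unfolding model_lift_def[OF W] using that hom_add
      by (intro F.extension_add[OF W] hom Z.m_closed) auto
    show "model_lift W (\<tau> \<zero>\<^bsub>Z\<^esub>) I = \<zero>\<^bsub>W\<^esub>" if I: "I \<in> carrier F.completion" for I
    proof (rule W.leq_antisym)
      show "model_lift W (\<tau> \<zero>\<^bsub>Z\<^esub>) I \<preceq>\<^bsub>W\<^esub> \<zero>\<^bsub>W\<^esub>"
        unfolding model_lift_def[OF W] using I F.completion_subset_carrier[OF I] hom_zero
        by (intro F.extension_least[OF W] hom) (auto simp: W.leq_refl)
    qed (use I lift(2) W.zero_leq in auto)
    show "model_lift W (\<tau> z') I \<preceq>\<^bsub>W\<^esub> model_lift W (\<tau> z) I"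
      if "I \<in> carrier F.completion" "z \<in> carrier Z" "z' \<in> carrier Z" "z' \<preceq>\<^bsub>Z\<^esub> z" for I z z'
      unfolding model_lift_def[OF W] using that hom_mono
      by (intro F.extension_mono[OF W] hom) auto
    show "is_supremum W (range (\<lambda>k. model_lift W (\<tau> (d k)) (c k))) (model_lift W (\<tau> t) s)"
      if "increasing F.completion c \<and> increasing Z d \<and> is_supremum F.completion (range c) s \<and>
        is_supremum Z (range d) t" for c d s t
    proof -
      have dt: "d n \<in> carrier Z" "t \<in> carrier Z" for n
        using that by (auto simp: increasing_def is_supremum_def)
      show ?thesis
        unfolding model_lift_def[OF W] using that dt hom_sup hom_inc
        by (intro F.extension_supremum[OF W] hom) auto
    qed
    show "model_lift W (\<tau> z') I' \<lless>\<^bsub>W\<^esub> model_lift W (\<tau> z) I"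
      if wb: "I' \<lless>\<^bsub>F.completion\<^esub> I \<and> z' \<lless>\<^bsub>Z\<^esub> z" for I' I z' z
    proof (rule model_lift_way_below[OF W])
      show "\<tau> z' a' b' \<lless>\<^bsub>W\<^esub> \<tau> z a b" if "a' \<lless>\<^bsub>S\<^esub> a" "b' \<lless>\<^bsub>T\<^esub> b" for a' a b' b
        unfolding \<tau>_def using that wb
        by (intro cu_bimorphism_way_below[OF \<psi>] cu_bimorphism_way_below[OF \<theta>]) auto
    qed (use wb Z.way_below_carrier \<tau> in auto)
  qed (use lift(2-5) in auto)
qed

end

text \<open>The model lives in the very type over which the choice ranges, so it witnesses that the
  choice succeeds. So far the chosen object is universal for that one type of targets.\<close>

lemma tensor_product_universal_property:
  fixes S :: "'a po_monoid" and T :: "'b po_monoid"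
  assumes "cu_semigroup S" "cu_semigroup T"
  shows "is_tensor_product TYPE(('a, 'b) tensor) S T (tensor_product S T) (pure_tensor S T)"
proof -
  interpret tensor_model S T using assms by (simp add: tensor_model_def)
  have "case_prod (is_tensor_product TYPE(('a, 'b) tensor) S T) (F.completion, model_tensor)"
    by (simp add: model_is_tensor_product)
  then have "case_prod (is_tensor_product TYPE(('a, 'b) tensor) S T) (tensor_pair S T)"
    unfolding tensor_pair_def by (rule someI)
  then show ?thesis by (simp add: tensor_product_def pure_tensor_def case_prod_beta)
qed

lemma tensor_product_cu_semigroup:
  "cu_semigroup S \<Longrightarrow> cu_semigroup T \<Longrightarrow> cu_semigroup (tensor_product S T)"
  using tensor_product_universal_property by (auto simp: is_tensor_product_def)

lemma pure_tensor_bimorphism: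
  "cu_semigroup S \<Longrightarrow> cu_semigroup T \<Longrightarrow> cu_bimorphism S T (tensor_product S T) (pure_tensor S T)"
  using tensor_product_universal_property by (auto simp: is_tensor_product_def)

lemma pure_tensor_closed:
  "cu_semigroup S \<Longrightarrow> cu_semigroup T \<Longrightarrow> a \<in> carrier S \<Longrightarrow> b \<in> carrier T \<Longrightarrow>
    pure_tensor S T a b \<in> carrier (tensor_product S T)"
  using gen_cu_bimorphismD(1)[OF cu_bimorphism_gen[OF pure_tensor_bimorphism]] .

context tensor_model
begin

text \<open>j uses universality of the chosen object, whose allowed target type is that of the
  model; k uses universality of the model. Both k after j and the identity fix pure tensors, so
  uniqueness makes them equal.\<close>

lemma tensor_product_model_iso:
  obtains j k where "j \<in> cu_morphisms (tensor_product S T) F.completion"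
    "k \<in> cu_morphisms F.completion (tensor_product S T)"
    "\<And>u. u \<in> carrier (tensor_product S T) \<Longrightarrow> k (j u) = u"
    "\<And>a b. a \<in> carrier S \<Longrightarrow> b \<in> carrier T \<Longrightarrow> j (pure_tensor S T a b) = model_tensor a b"
    "\<And>a b. a \<in> carrier S \<Longrightarrow> b \<in> carrier T \<Longrightarrow> k (model_tensor a b) = pure_tensor S T a b"
proof -
  let ?U = "tensor_product S T"
  note U = tensor_product_universal_property[OF S.cu_semigroup_axioms T.cu_semigroup_axioms]
  have cuU: "cu_semigroup ?U" and bi: "cu_bimorphism S T ?U (pure_tensor S T)"
    using U by (auto simp: is_tensor_product_def)
  interpret U: cu_semigroup ?U by (rule cuU)
  obtain j where j: "j \<in> cu_morphisms ?U F.completion"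
      "\<And>a b. a \<in> carrier S \<Longrightarrow> b \<in> carrier T \<Longrightarrow> j (pure_tensor S T a b) = model_tensor a b"
    using U F.completion_cu_semigroup model_tensor_bimorphism unfolding is_tensor_product_def by metis
  define k where "k = model_lift ?U (pure_tensor S T)"
  have k: "k \<in> cu_morphisms F.completion ?U"
      "\<And>a b. a \<in> carrier S \<Longrightarrow> b \<in> carrier T \<Longrightarrow> k (model_tensor a b) = pure_tensor S T a b"
    using model_lift_cu_morphism[OF cuU bi] model_lift_tensor[OF cuU cu_bimorphism_gen[OF bi]]
    by (simp_all add: k_def)
  have closed: "pure_tensor S T a b \<in> carrier ?U" if "a \<in> carrier S" "b \<in> carrier T" for a b
    using gen_cu_bimorphismD(1)[OF cu_bimorphism_gen[OF bi]] that .
  have id: "(\<lambda>u\<in>carrier ?U. u) \<in> cu_morphisms ?U ?U" by (rule cu_morphism_id[OF cuU])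
  have kj: "compose (carrier ?U) k j \<in> cu_morphisms ?U ?U" by (rule cu_morphism_compose[OF cuU j(1) k(1)])
  let ?fixes_pure = "\<lambda>\<alpha>. \<alpha> \<in> cu_morphisms ?U ?U \<and>
      (\<forall>a\<in>carrier S. \<forall>b\<in>carrier T. \<alpha> (pure_tensor S T a b) = pure_tensor S T a b)"
  have "\<exists>!\<alpha>. ?fixes_pure \<alpha>"
    using U cuU bi unfolding is_tensor_product_def by blast
  moreover have "?fixes_pure (\<lambda>u\<in>carrier ?U. u)" using id closed by simp
  moreover have "?fixes_pure (compose (carrier ?U) k j)"
    using kj j(2) k(2) closed by (simp add: compose_def)
  ultimately have "compose (carrier ?U) k j = (\<lambda>u\<in>carrier ?U. u)" by blast
  then have "k (j u) = u" if "u \<in> carrier ?U" for u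
    using that by (auto simp: compose_def dest: fun_cong[of _ _ u])
  then show ?thesis using that j k by blast
qed

end

section \<open>Transfer of universality to the chosen tensor product\<close>

context
  fixes S :: "'a po_monoid" and T :: "'b po_monoid"
  assumes S: "cu_semigroup S" and T: "cu_semigroup T"
begin

interpretation tensor_model S T
  using S T by (simp add: tensor_model_def)

lemma tensor_product_gen_cu_morphism_leq:
  assumes P: "cu_semigroup P"
    and \<alpha>: "\<alpha> \<in> gen_cu_morphisms (tensor_product S T) P"
    and \<beta>: "\<beta> \<in> gen_cu_morphisms (tensor_product S T) P"
    and leq: "\<And>a b. a \<in> carrier S \<Longrightarrow> b \<in> carrier T \<Longrightarrow>
      \<alpha> (pure_tensor S T a b) \<preceq>\<^bsub>P\<^esub> \<beta> (pure_tensor S T a b)"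
    and u: "u \<in> carrier (tensor_product S T)"
  shows "\<alpha> u \<preceq>\<^bsub>P\<^esub> \<beta> u"
proof -
  obtain j k where jk: "j \<in> cu_morphisms (tensor_product S T) F.completion"
    "k \<in> cu_morphisms F.completion (tensor_product S T)"
    "\<And>u. u \<in> carrier (tensor_product S T) \<Longrightarrow> k (j u) = u"
    "\<And>a b. a \<in> carrier S \<Longrightarrow> b \<in> carrier T \<Longrightarrow> j (pure_tensor S T a b) = model_tensor a b"
    "\<And>a b. a \<in> carrier S \<Longrightarrow> b \<in> carrier T \<Longrightarrow> k (model_tensor a b) = pure_tensor S T a b"
    using tensor_product_model_iso by metis
  have ju: "j u \<in> carrier F.completion" using jk(1) u cu_morphismD(1) gen_cu_morphismD(2) by metis
  \<comment> \<open>Both maps are pulled back along k to the model and compared at j u, which k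
    sends back to u.\<close>
  have "compose (carrier F.completion) \<alpha> k (j u) \<preceq>\<^bsub>P\<^esub> compose (carrier F.completion) \<beta> k (j u)"
    by (rule model_gen_cu_morphism_leq[OF P
          gen_cu_morphism_compose[OF M.cu_semigroup_axioms cu_morphismD(1)[OF jk(2)] \<alpha>]
          gen_cu_morphism_compose[OF M.cu_semigroup_axioms cu_morphismD(1)[OF jk(2)] \<beta>] _ ju])
      (simp_all add: compose_def model_tensor_closed jk(5) leq)
  then show ?thesis using ju jk(3)[OF u] by (simp add: compose_def)
qed

lemma tensor_product_gen_cu_morphism_eq:
  assumes P: "cu_semigroup P"
    and "\<alpha> \<in> gen_cu_morphisms (tensor_product S T) P" "\<beta> \<in> gen_cu_morphisms (tensor_product S T) P"
    and "\<And>a b. a \<in> carrier S \<Longrightarrow> b \<in> carrier T \<Longrightarrow>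
      \<alpha> (pure_tensor S T a b) = \<beta> (pure_tensor S T a b)"
  shows "\<alpha> = \<beta>"
proof -
  interpret P: cu_semigroup P by (rule P)
  have "\<beta> (pure_tensor S T a b) \<in> carrier P" if "a \<in> carrier S" "b \<in> carrier T" for a b
    using assms(3) pure_tensor_closed[OF S T that] by (rule gen_cu_morphismD(2))
  note refl = P.leq_refl[OF this]
  show ?thesis
  proof (rule gen_cu_morphism_eqI[OF P assms(2,3)])
    show "\<alpha> u \<preceq>\<^bsub>P\<^esub> \<beta> u" if "u \<in> carrier (tensor_product S T)" for u
      by (rule tensor_product_gen_cu_morphism_leq[OF P assms(2,3) _ that]) (simp add: assms(4) refl)
    show "\<beta> u \<preceq>\<^bsub>P\<^esub> \<alpha> u" if "u \<in> carrier (tensor_product S T)" for u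
      by (rule tensor_product_gen_cu_morphism_leq[OF P assms(3,2) _ that]) (simp add: assms(4) refl)
  qed
qed

text \<open>The lift of the model, precomposed with j. It removes the restriction on the type of the
  target.\<close>

lemma tensor_product_lift:
  assumes P: "cu_semigroup P" and \<phi>: "cu_bimorphism S T P \<phi>"
  shows "\<exists>!\<alpha>. \<alpha> \<in> cu_morphisms (tensor_product S T) P \<and>
    (\<forall>a\<in>carrier S. \<forall>b\<in>carrier T. \<alpha> (pure_tensor S T a b) = \<phi> a b)"
proof -
  obtain j k where jk: "j \<in> cu_morphisms (tensor_product S T) F.completion"
    "k \<in> cu_morphisms F.completion (tensor_product S T)"
    "\<And>u. u \<in> carrier (tensor_product S T) \<Longrightarrow> k (j u) = u"
    "\<And>a b. a \<in> carrier S \<Longrightarrow> b \<in> carrier T \<Longrightarrow> j (pure_tensor S T a b) = model_tensor a b"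
    "\<And>a b. a \<in> carrier S \<Longrightarrow> b \<in> carrier T \<Longrightarrow> k (model_tensor a b) = pure_tensor S T a b"
    using tensor_product_model_iso by metis
  let ?\<alpha> = "compose (carrier (tensor_product S T)) (model_lift P \<phi>) j"
  have 1: "?\<alpha> \<in> cu_morphisms (tensor_product S T) P"
    by (rule cu_morphism_compose[OF tensor_product_cu_semigroup[OF S T] jk(1) model_lift_cu_morphism[OF P \<phi>]])
  have 2: "?\<alpha> (pure_tensor S T a b) = \<phi> a b" if "a \<in> carrier S" "b \<in> carrier T" for a b
    using that jk(4) model_lift_tensor[OF P cu_bimorphism_gen[OF \<phi>]] pure_tensor_closed[OF S T]
    by (simp add: compose_def)
  show ?thesis
  proof (rule ex1I[of _ ?\<alpha>])
    fix \<alpha> assume "\<alpha> \<in> cu_morphisms (tensor_product S T) P \<and>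
      (\<forall>a\<in>carrier S. \<forall>b\<in>carrier T. \<alpha> (pure_tensor S T a b) = \<phi> a b)"
    then show "\<alpha> = ?\<alpha>"
      by (intro tensor_product_gen_cu_morphism_eq[OF P _ cu_morphismD(1)[OF 1]])
        (simp_all add: 2 cu_morphismD(1))
  qed (use 1 2 in auto)
qed

lemma tensor_product_trilinear_lift:
  assumes V: "cu_semigroup V" and Z: "cu_semigroup Z" and W: "cu_semigroup W"
    and \<psi>: "cu_bimorphism S V W \<psi>" and \<theta>: "cu_bimorphism T Z V \<theta>"
  obtains B where "cu_bimorphism (tensor_product S T) Z W B"
    "\<And>x y z. x \<in> carrier S \<Longrightarrow> y \<in> carrier T \<Longrightarrow> z \<in> carrier Z \<Longrightarrow>
      B (pure_tensor S T x y) z = \<psi> x (\<theta> y z)"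
proof -
  obtain j k where jk: "j \<in> cu_morphisms (tensor_product S T) F.completion"
    "k \<in> cu_morphisms F.completion (tensor_product S T)"
    "\<And>u. u \<in> carrier (tensor_product S T) \<Longrightarrow> k (j u) = u"
    "\<And>a b. a \<in> carrier S \<Longrightarrow> b \<in> carrier T \<Longrightarrow> j (pure_tensor S T a b) = model_tensor a b"
    "\<And>a b. a \<in> carrier S \<Longrightarrow> b \<in> carrier T \<Longrightarrow> k (model_tensor a b) = pure_tensor S T a b"
    using tensor_product_model_iso by metis
  \<comment> \<open>The identity of Z is spelled out as a morphism so that
    \<open>cu_bimorphism_comp\<close> applies in both arguments.\<close>
  let ?B = "\<lambda>u z. model_lift W (\<lambda>x y. \<psi> x (\<theta> y ((\<lambda>z\<in>carrier Z. z) z))) (j u)"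
  have "cu_bimorphism (tensor_product S T) Z W ?B"
    using cu_bimorphism_comp[OF model_trilinear_lift[OF V Z W \<psi> \<theta>] jk(1) cu_morphism_id[OF Z]] .
  moreover have "?B (pure_tensor S T x y) z = \<psi> x (\<theta> y z)"
    if "x \<in> carrier S" "y \<in> carrier T" "z \<in> carrier Z" for x y z
    using that jk(4) model_lift_tensor[OF W trilinear_gen_cu_bimorphism[OF V Z]]
      cu_bimorphism_gen[OF \<psi>] cu_bimorphism_gen[OF \<theta>] by simp
  ultimately show ?thesis using that by blast
qed

end

section \<open>The internal hom as a completion\<close>


text \<open>Transport of structure along an isomorphism of ordered monoids. Suprema and way-below
  are defined from the order, so the axioms O1 to O4 are transported too; the internal hom consists
  of path classes and gets its structure from ideals in this way.\<close>

locale cu_transfer = U: cu_semigroup U for U :: "'u po_monoid" +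
  fixes V :: "'v po_monoid" and J :: "'v \<Rightarrow> 'u"
  assumes bij: "bij_betw J (carrier V) (carrier U)"
    and leq_iff: "x \<in> carrier V \<Longrightarrow> y \<in> carrier V \<Longrightarrow> x \<preceq>\<^bsub>V\<^esub> y \<longleftrightarrow> J x \<preceq>\<^bsub>U\<^esub> J y"
    and add_closed: "x \<in> carrier V \<Longrightarrow> y \<in> carrier V \<Longrightarrow> x \<oplus>\<^bsub>V\<^esub> y \<in> carrier V"
    and J_add: "x \<in> carrier V \<Longrightarrow> y \<in> carrier V \<Longrightarrow> J (x \<oplus>\<^bsub>V\<^esub> y) = J x \<oplus>\<^bsub>U\<^esub> J y"
    and zero_closed: "\<zero>\<^bsub>V\<^esub> \<in> carrier V"
    and J_zero: "J \<zero>\<^bsub>V\<^esub> = \<zero>\<^bsub>U\<^esub>"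
begin

lemma J_closed: "x \<in> carrier V \<Longrightarrow> J x \<in> carrier U"
  using bij bij_betwE by blast

lemma J_eq_iff: "x \<in> carrier V \<Longrightarrow> y \<in> carrier V \<Longrightarrow> J x = J y \<longleftrightarrow> x = y"
  using bij by (auto simp: bij_betw_def inj_on_def)

lemma J_surj:
  assumes "u \<in> carrier U"
  obtains x where "x \<in> carrier V" "u = J x"
  using assms bij by (auto simp: bij_betw_def)

lemma J_surj_seq:
  assumes "\<And>n. c n \<in> carrier U"
  obtains d :: "nat \<Rightarrow> 'v" where "\<And>n. d n \<in> carrier V" "\<And>n. c n = J (d n)"
proof
  have "\<exists>x. x \<in> carrier V \<and> c n = J x" for n using assms J_surj by blast
  then have *: "(SOME x. x \<in> carrier V \<and> c n = J x) \<in> carrier V \<and>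
      c n = J (SOME x. x \<in> carrier V \<and> c n = J x)" for n
    by (rule someI_ex)
  show "(SOME x. x \<in> carrier V \<and> c n = J x) \<in> carrier V"
    "c n = J (SOME x. x \<in> carrier V \<and> c n = J x)" for n
    using *[of n] by blast+
qed

lemma increasing_iff: "(\<And>n. c n \<in> carrier V) \<Longrightarrow> increasing V c \<longleftrightarrow> increasing U (\<lambda>n. J (c n))"
  by (simp add: increasing_def J_closed leq_iff)

lemma is_supremum_iff:
  assumes c: "\<And>n::nat. c n \<in> carrier V" and s: "s \<in> carrier V"
  shows "is_supremum V (range c) s \<longleftrightarrow> is_supremum U (range (\<lambda>n. J (c n))) (J s)"
proof
  assume sup: "is_supremum V (range c) s"
  show "is_supremum U (range (\<lambda>n. J (c n))) (J s)"
    unfolding is_supremum_def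
  proof (intro conjI ballI impI)
    show "J s \<preceq>\<^bsub>U\<^esub> u" if u: "u \<in> carrier U" "\<forall>a\<in>range (\<lambda>n. J (c n)). a \<preceq>\<^bsub>U\<^esub> u" for u
    proof -
      obtain x where x: "x \<in> carrier V" "u = J x" using J_surj u(1) .
      then have "c n \<preceq>\<^bsub>V\<^esub> x" for n using u(2) c by (simp add: leq_iff)
      then show ?thesis using sup x s by (auto simp: is_supremum_def leq_iff)
    qed
  qed (use sup c s J_closed in \<open>auto simp: is_supremum_def leq_iff\<close>)
next
  assume sup: "is_supremum U (range (\<lambda>n. J (c n))) (J s)"
  then show "is_supremum V (range c) s"
    using c s J_closed by (auto simp: is_supremum_def leq_iff)
qed

lemma way_below_iff:
  assumes "a \<in> carrier V" "b \<in> carrier V"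
  shows "a \<lless>\<^bsub>V\<^esub> b \<longleftrightarrow> J a \<lless>\<^bsub>U\<^esub> J b"
proof
  assume ab: "a \<lless>\<^bsub>V\<^esub> b"
  show "J a \<lless>\<^bsub>U\<^esub> J b"
    unfolding way_below_def
  proof (intro conjI allI impI)
    fix c s assume cs: "increasing U c \<and> is_supremum U (range c) s \<and> J b \<preceq>\<^bsub>U\<^esub> s"
    then obtain d where d: "\<And>n. d n \<in> carrier V" "\<And>n. c n = J (d n)"
      using J_surj_seq[of c] by (auto simp: increasing_def)
    obtain t where t: "t \<in> carrier V" "s = J t" using J_surj[of s] cs by (auto simp: is_supremum_def)
    have c: "c = (\<lambda>n. J (d n))" using d(2) by blast
    have "increasing V d \<and> is_supremum V (range d) t \<and> b \<preceq>\<^bsub>V\<^esub> t"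
      using cs d(1) t assms(2) unfolding c by (simp add: increasing_iff is_supremum_iff leq_iff)
    then obtain k where "a \<preceq>\<^bsub>V\<^esub> d k" using ab unfolding way_below_def by blast
    then show "\<exists>k. J a \<preceq>\<^bsub>U\<^esub> c k" using assms d by (auto simp: leq_iff)
  qed (use assms J_closed in auto)
next
  assume ab: "J a \<lless>\<^bsub>U\<^esub> J b"
  show "a \<lless>\<^bsub>V\<^esub> b"
    unfolding way_below_def
  proof (intro conjI allI impI)
    fix c s assume cs: "increasing V c \<and> is_supremum V (range c) s \<and> b \<preceq>\<^bsub>V\<^esub> s"
    then have c: "c n \<in> carrier V" "s \<in> carrier V" for n by (auto simp: increasing_def is_supremum_def)
    then have "increasing U (\<lambda>n. J (c n)) \<and> is_supremum U (range (\<lambda>n. J (c n))) (J s) \<and> J b \<preceq>\<^bsub>U\<^esub> J s"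
      using cs assms(2) by (simp add: increasing_iff is_supremum_iff leq_iff)
    then obtain k where "J a \<preceq>\<^bsub>U\<^esub> J (c k)"
      using ab way_below_def[of U "J a" "J b"] by (elim conjE allE[of _ "\<lambda>n. J (c n)"]) blast
    then show "\<exists>k. a \<preceq>\<^bsub>V\<^esub> c k" using assms c by (auto simp: leq_iff)
  qed (use assms in auto)
qed

lemma cu_semigroup_V: "cu_semigroup V"
proof -
  have "comm_monoid V"
  proof (rule comm_monoidI)
    show "x \<oplus>\<^bsub>V\<^esub> y \<oplus>\<^bsub>V\<^esub> z = x \<oplus>\<^bsub>V\<^esub> (y \<oplus>\<^bsub>V\<^esub> z)"
      if "x \<in> carrier V" "y \<in> carrier V" "z \<in> carrier V" for x y z
      using that J_eq_iff[of "x \<oplus>\<^bsub>V\<^esub> y \<oplus>\<^bsub>V\<^esub> z" "x \<oplus>\<^bsub>V\<^esub> (y \<oplus>\<^bsub>V\<^esub> z)"]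
      by (simp add: add_closed J_add J_closed U.m_assoc)
    show "\<zero>\<^bsub>V\<^esub> \<oplus>\<^bsub>V\<^esub> x = x" if "x \<in> carrier V" for x
      using that J_eq_iff[of "\<zero>\<^bsub>V\<^esub> \<oplus>\<^bsub>V\<^esub> x" x]
      by (simp add: add_closed zero_closed J_add J_zero J_closed)
    show "x \<oplus>\<^bsub>V\<^esub> y = y \<oplus>\<^bsub>V\<^esub> x" if "x \<in> carrier V" "y \<in> carrier V" for x y
      using that J_eq_iff[of "x \<oplus>\<^bsub>V\<^esub> y" "y \<oplus>\<^bsub>V\<^esub> x"]
      by (simp add: add_closed J_add J_closed U.m_comm)
  qed (simp_all add: add_closed zero_closed)
  then interpret V: comm_monoid V .
  interpret V: positively_ordered_semigroup V
  proof
    show "a \<preceq>\<^bsub>V\<^esub> c" if "a \<preceq>\<^bsub>V\<^esub> b" "b \<preceq>\<^bsub>V\<^esub> c" "a \<in> carrier V" "b \<in> carrier V" "c \<in> carrier V" for a b c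
      using that U.leq_trans[of "J a" "J b" "J c"] by (simp add: leq_iff J_closed)
    show "a = b" if "a \<preceq>\<^bsub>V\<^esub> b" "b \<preceq>\<^bsub>V\<^esub> a" "a \<in> carrier V" "b \<in> carrier V" for a b
      using that U.leq_antisym[of "J a" "J b"] by (simp add: leq_iff J_closed J_eq_iff)
  qed (simp_all add: leq_iff J_closed J_add J_zero U.leq_refl U.add_mono U.zero_leq)
  have inc: "c n \<in> carrier V" if "increasing V c" for c and n :: nat using that by (simp add: increasing_def)
  show ?thesis
  proof
    show "\<exists>s. is_supremum V (range c) s" if c: "increasing V c" for c
    proof -
      obtain u where u: "is_supremum U (range (\<lambda>n. J (c n))) u"
        using U.O1 c increasing_iff[of c] inc[OF c] by blast
      then obtain s where "s \<in> carrier V" "u = J s" using J_surj by (auto simp: is_supremum_def)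
      then show ?thesis using u is_supremum_iff[of c] inc[OF c] by blast
    qed
    show "\<exists>c. (\<forall>n. c n \<lless>\<^bsub>V\<^esub> c (Suc n)) \<and> is_supremum V (range c) a" if a: "a \<in> carrier V" for a
    proof -
      obtain c where c: "\<And>n. c n \<lless>\<^bsub>U\<^esub> c (Suc n)" "is_supremum U (range c) (J a)"
        using U.O2[OF J_closed[OF a]] by blast
      then obtain d where d: "\<And>n. d n \<in> carrier V" "\<And>n. c n = J (d n)"
        using J_surj_seq[of c] U.way_below_carrier by blast
      have "c = (\<lambda>n. J (d n))" using d(2) by blast
      then have "(\<forall>n. d n \<lless>\<^bsub>V\<^esub> d (Suc n)) \<and> is_supremum V (range d) a"
        using c d(1) a by (simp add: is_supremum_iff way_below_iff)
      then show ?thesis by blast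
    qed
    show "a' \<oplus>\<^bsub>V\<^esub> b' \<lless>\<^bsub>V\<^esub> a \<oplus>\<^bsub>V\<^esub> b" if "a' \<lless>\<^bsub>V\<^esub> a" "b' \<lless>\<^bsub>V\<^esub> b" for a' a b' b
      using that V.way_below_carrier[OF that(1)] V.way_below_carrier[OF that(2)]
      by (simp add: way_below_iff J_add U.O3)
    show "is_supremum V (range (\<lambda>n. c n \<oplus>\<^bsub>V\<^esub> d n)) (s \<oplus>\<^bsub>V\<^esub> t)"
      if cd: "increasing V c" "increasing V d" "is_supremum V (range c) s" "is_supremum V (range d) t"
      for c d s t
    proof -
      have "s \<in> carrier V" "t \<in> carrier V" using cd by (auto simp: is_supremum_def)
      then show ?thesis
        using cd inc[OF cd(1)] inc[OF cd(2)] U.O4[of "\<lambda>n. J (c n)" "\<lambda>n. J (d n)" "J s" "J t"]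
        by (simp add: is_supremum_iff increasing_iff J_add)
    qed
  qed
qed

end

section \<open>The monoid of generalized morphisms and the half-open path relation\<close>

lemma IQ_iff: "l \<in> IQ \<longleftrightarrow> 0 < l \<and> l < 1"
  by (auto simp: IQ_def)

lemma IQ_greater:
  assumes "l \<in> IQ"
  obtains m where "m \<in> IQ" "l < m"
  using assms dense[of l 1] by (auto simp: IQ_iff)

lemma pathsD:
  assumes "f \<in> paths S T"
  shows "l \<in> IQ \<Longrightarrow> f l \<in> gen_cu_morphisms S T"
    and "l \<in> IQ \<Longrightarrow> m \<in> IQ \<Longrightarrow> l < m \<Longrightarrow> mor_prec S T (f l) (f m)"
  using assms by (auto simp: paths_def)

locale hom_model = S: cu_semigroup S + T: cu_semigroup T
  for S :: "'a po_monoid" and T :: "'b po_monoid"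
begin

abbreviation prec (infix \<open>\<prec>\<close> 50) where
  "\<phi> \<prec> \<psi> \<equiv> mor_prec S T \<phi> \<psi>"

text \<open>The relation speaks only of way-below pairs; approximating a from below and continuity
  of the smaller map give the value at a.\<close>

lemma mor_prec_leq:
  assumes "\<phi> \<prec> \<psi>" "\<phi> \<in> gen_cu_morphisms S T" "\<psi> \<in> gen_cu_morphisms S T" "a \<in> carrier S"
  shows "\<phi> a \<preceq>\<^bsub>T\<^esub> \<psi> a"
proof -
  obtain c where c: "increasing S c" "is_supremum S (range c) a" "\<And>n. c n \<lless>\<^bsub>S\<^esub> a"
    using S.way_below_chain_obtains[OF assms(4)] by metis
  have "\<phi> (c n) \<preceq>\<^bsub>T\<^esub> \<psi> a" for n
    using c(3) assms(1) T.way_below_imp_leq unfolding mor_prec_def by blast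
  then show ?thesis
    using gen_cu_morphismD(6)[OF assms(2) c(1,2)] gen_cu_morphismD(2)[OF assms(3,4)]
    by (auto simp: is_supremum_def)
qed

lemma mor_prec_trans: "\<phi> \<prec> \<psi> \<Longrightarrow> \<psi> \<prec> \<chi> \<Longrightarrow> \<phi> \<prec> \<chi>"
  unfolding mor_prec_def
proof (intro allI impI)
  fix a' a
  assume *: "\<forall>a' a. a' \<lless>\<^bsub>S\<^esub> a \<longrightarrow> \<phi> a' \<lless>\<^bsub>T\<^esub> \<psi> a" "\<forall>a' a. a' \<lless>\<^bsub>S\<^esub> a \<longrightarrow> \<psi> a' \<lless>\<^bsub>T\<^esub> \<chi> a"
    and "a' \<lless>\<^bsub>S\<^esub> a"
  then obtain b where "a' \<lless>\<^bsub>S\<^esub> b" "b \<lless>\<^bsub>S\<^esub> a" using S.way_below_interpolate by blast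
  then have "\<phi> a' \<lless>\<^bsub>T\<^esub> \<psi> b" "\<psi> b \<lless>\<^bsub>T\<^esub> \<chi> a" using * by simp_all
  then show "\<phi> a' \<lless>\<^bsub>T\<^esub> \<chi> a" by (rule T.way_below_trans)
qed

lemma mor_prec_leq_trans:
  assumes "\<phi> \<prec> \<psi>" "\<chi> \<in> gen_cu_morphisms S T" "\<And>a. a \<in> carrier S \<Longrightarrow> \<psi> a \<preceq>\<^bsub>T\<^esub> \<chi> a"
  shows "\<phi> \<prec> \<chi>"
  unfolding mor_prec_def
proof (intro allI impI)
  fix a' a assume "a' \<lless>\<^bsub>S\<^esub> a"
  then show "\<phi> a' \<lless>\<^bsub>T\<^esub> \<chi> a"
    using assms(1,3) T.way_below_leq_trans gen_cu_morphismD(2)[OF assms(2)] S.way_below_carrier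
    unfolding mor_prec_def by metis
qed

definition hom_monoid :: "('a \<Rightarrow> 'b) monoid" where
  "hom_monoid = \<lparr>carrier = gen_cu_morphisms S T,
     monoid.mult = (\<lambda>\<phi> \<psi>. \<lambda>a\<in>carrier S. \<phi> a \<oplus>\<^bsub>T\<^esub> \<psi> a), one = (\<lambda>a\<in>carrier S. \<zero>\<^bsub>T\<^esub>)\<rparr>"

lemma hom_monoid_simps [simp]:
  "carrier hom_monoid = gen_cu_morphisms S T"
  "\<phi> \<oplus>\<^bsub>hom_monoid\<^esub> \<psi> = (\<lambda>a\<in>carrier S. \<phi> a \<oplus>\<^bsub>T\<^esub> \<psi> a)"
  "\<zero>\<^bsub>hom_monoid\<^esub> = (\<lambda>a\<in>carrier S. \<zero>\<^bsub>T\<^esub>)"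
  by (simp_all add: hom_monoid_def)

lemma gen_cu_morphism_add:
  assumes "\<phi> \<in> gen_cu_morphisms S T" "\<psi> \<in> gen_cu_morphisms S T"
  shows "(\<lambda>a\<in>carrier S. \<phi> a \<oplus>\<^bsub>T\<^esub> \<psi> a) \<in> gen_cu_morphisms S T"
  by (rule gen_cu_morphism_restrictI[OF S.cu_semigroup_axioms])
    (simp_all add: gen_cu_morphismD(2-7)[OF assms(1)] gen_cu_morphismD(2-7)[OF assms(2)]
      T.m_ac T.add_mono_both T.O4)

lemma gen_cu_morphism_zero: "(\<lambda>a\<in>carrier S. \<zero>\<^bsub>T\<^esub>) \<in> gen_cu_morphisms S T"
  by (rule gen_cu_morphism_restrictI[OF S.cu_semigroup_axioms])
    (use T.is_supremum_const[OF T.one_closed] in \<open>simp_all add: T.leq_refl\<close>)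

lemma mor_prec_add:
  "\<phi> \<prec> \<psi> \<Longrightarrow> \<phi>' \<prec> \<psi>' \<Longrightarrow>
    (\<lambda>a\<in>carrier S. \<phi> a \<oplus>\<^bsub>T\<^esub> \<phi>' a) \<prec> (\<lambda>a\<in>carrier S. \<psi> a \<oplus>\<^bsub>T\<^esub> \<psi>' a)"
  unfolding mor_prec_def using T.O3 S.way_below_carrier by simp

lemma zero_mor_prec: "\<phi> \<in> gen_cu_morphisms S T \<Longrightarrow> (\<lambda>a\<in>carrier S. \<zero>\<^bsub>T\<^esub>) \<prec> \<phi>"
  unfolding mor_prec_def by (simp add: S.way_below_carrier T.zero_way_below gen_cu_morphismD(2))

text \<open>Time 1 is excluded: \<psi> only bounds the path and need not be its limit. Hence \<psi>
  can be enlarged along \<prec> with the same witness, and a witness that ends below \<psi> can be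
  followed by one that starts in \<psi>.\<close>

definition path_below :: "('a \<Rightarrow> 'b) \<Rightarrow> ('a \<Rightarrow> 'b) \<Rightarrow> bool" (infix \<open>\<lhd>\<close> 50) where
  "\<phi> \<lhd> \<psi> \<longleftrightarrow> \<psi> \<in> gen_cu_morphisms S T \<and>
     (\<exists>p. p (0::rat) = \<phi> \<and> (\<forall>q\<in>{0..<1}. p q \<in> gen_cu_morphisms S T \<and> p q \<prec> \<psi>) \<and>
       (\<forall>q\<in>{0..<1}. \<forall>r\<in>{0..<1}. q < r \<longrightarrow> p q \<prec> p r))"

lemma path_belowI:
  assumes "\<psi> \<in> gen_cu_morphisms S T"
    and "\<And>q. 0 \<le> q \<Longrightarrow> q < 1 \<Longrightarrow> p q \<in> gen_cu_morphisms S T"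
    and "\<And>q. 0 \<le> q \<Longrightarrow> q < 1 \<Longrightarrow> p q \<prec> \<psi>"
    and "\<And>q r. 0 \<le> q \<Longrightarrow> q < r \<Longrightarrow> r < 1 \<Longrightarrow> p q \<prec> p r"
  shows "p (0::rat) \<lhd> \<psi>"
  unfolding path_below_def using assms by (intro conjI exI[of _ p]) auto

lemma path_belowE:
  assumes "\<phi> \<lhd> \<psi>"
  obtains p where "p (0::rat) = \<phi>" "\<And>q. 0 \<le> q \<Longrightarrow> q < 1 \<Longrightarrow> p q \<in> gen_cu_morphisms S T"
    "\<And>q. 0 \<le> q \<Longrightarrow> q < 1 \<Longrightarrow> p q \<prec> \<psi>"
    "\<And>q r. 0 \<le> q \<Longrightarrow> q < r \<Longrightarrow> r < 1 \<Longrightarrow> p q \<prec> p r"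
  using assms unfolding path_below_def by (auto simp: Ball_def)

lemma path_below_carrier:
  "\<phi> \<lhd> \<psi> \<Longrightarrow> \<phi> \<in> gen_cu_morphisms S T \<and> \<psi> \<in> gen_cu_morphisms S T"
  unfolding path_below_def by force

lemma path_below_imp_prec: "\<phi> \<lhd> \<psi> \<Longrightarrow> \<phi> \<prec> \<psi>"
  unfolding path_below_def by force

lemma path_below_prec_trans:
  assumes "\<phi> \<lhd> \<psi>" "\<psi> \<prec> \<chi>" "\<chi> \<in> gen_cu_morphisms S T"
  shows "\<phi> \<lhd> \<chi>"
proof -
  obtain p where p: "p (0::rat) = \<phi>" "\<And>q. 0 \<le> q \<Longrightarrow> q < 1 \<Longrightarrow> p q \<in> gen_cu_morphisms S T"
    "\<And>q. 0 \<le> q \<Longrightarrow> q < 1 \<Longrightarrow> p q \<prec> \<psi>"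
    "\<And>q r. 0 \<le> q \<Longrightarrow> q < r \<Longrightarrow> r < 1 \<Longrightarrow> p q \<prec> p r"
    using path_belowE[OF assms(1)] by metis
  have "p 0 \<lhd> \<chi>" by (rule path_belowI) (use p assms(2,3) mor_prec_trans in blast)+
  then show ?thesis using p(1) by simp
qed

lemma path_below_interpolate:
  assumes "\<phi> \<lhd> \<psi>"
  shows "\<exists>\<chi>. \<phi> \<lhd> \<chi> \<and> \<chi> \<lhd> \<psi>"
proof -
  obtain p where p: "p (0::rat) = \<phi>" "\<And>q. 0 \<le> q \<Longrightarrow> q < 1 \<Longrightarrow> p q \<in> gen_cu_morphisms S T"
    "\<And>q. 0 \<le> q \<Longrightarrow> q < 1 \<Longrightarrow> p q \<prec> \<psi>"
    "\<And>q r. 0 \<le> q \<Longrightarrow> q < r \<Longrightarrow> r < 1 \<Longrightarrow> p q \<prec> p r"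
    using path_belowE[OF assms] by metis
  \<comment> \<open>The witness is cut at time 1/2 and each half is stretched to [0, 1); the first
    half is bounded by p (1/2), the second starts there and keeps the bound \<psi>.\<close>
  have "(\<lambda>q. p (q / 2)) 0 \<lhd> p (1/2)"
    by (rule path_belowI) (simp_all add: p(2,4))
  moreover have "(\<lambda>q. p (1/2 + q / 2)) 0 \<lhd> \<psi>"
    by (rule path_belowI) (simp_all add: p(2-4) path_below_carrier[OF assms])
  ultimately show ?thesis using p(1) by auto
qed

sublocale H: interpolating_monoid hom_monoid path_below
proof -
  have cong: "f = g" if "f \<in> gen_cu_morphisms S T" "g \<in> gen_cu_morphisms S T"
    "\<And>a. a \<in> carrier S \<Longrightarrow> f a = g a" for f g
    using PiE_ext that gen_cu_morphismD(1) by metis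
  have "comm_monoid hom_monoid"
  proof (rule comm_monoidI)
    show "\<phi> \<oplus>\<^bsub>hom_monoid\<^esub> \<psi> \<oplus>\<^bsub>hom_monoid\<^esub> \<chi> = \<phi> \<oplus>\<^bsub>hom_monoid\<^esub> (\<psi> \<oplus>\<^bsub>hom_monoid\<^esub> \<chi>)"
      if "\<phi> \<in> carrier hom_monoid" "\<psi> \<in> carrier hom_monoid" "\<chi> \<in> carrier hom_monoid" for \<phi> \<psi> \<chi>
      using that by (auto simp: fun_eq_iff T.m_assoc gen_cu_morphismD(2))
    show "\<zero>\<^bsub>hom_monoid\<^esub> \<oplus>\<^bsub>hom_monoid\<^esub> \<phi> = \<phi>" if "\<phi> \<in> carrier hom_monoid" for \<phi>
      using that gen_cu_morphism_add[OF gen_cu_morphism_zero, of \<phi>]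
      by (intro cong) (auto simp: gen_cu_morphismD(2))
    show "\<phi> \<oplus>\<^bsub>hom_monoid\<^esub> \<psi> = \<psi> \<oplus>\<^bsub>hom_monoid\<^esub> \<phi>"
      if "\<phi> \<in> carrier hom_monoid" "\<psi> \<in> carrier hom_monoid" for \<phi> \<psi>
      using that by (auto simp: fun_eq_iff T.m_comm gen_cu_morphismD(2))
  qed (simp_all add: gen_cu_morphism_add gen_cu_morphism_zero)
  moreover have "\<phi> \<oplus>\<^bsub>hom_monoid\<^esub> \<phi>' \<lhd> \<psi> \<oplus>\<^bsub>hom_monoid\<^esub> \<psi>'" if b: "\<phi> \<lhd> \<psi>" "\<phi>' \<lhd> \<psi>'" for \<phi> \<psi> \<phi>' \<psi>'
  proof -
    obtain p where p: "p (0::rat) = \<phi>" "\<And>q. 0 \<le> q \<Longrightarrow> q < 1 \<Longrightarrow> p q \<in> gen_cu_morphisms S T"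
      "\<And>q. 0 \<le> q \<Longrightarrow> q < 1 \<Longrightarrow> p q \<prec> \<psi>"
      "\<And>q r. 0 \<le> q \<Longrightarrow> q < r \<Longrightarrow> r < 1 \<Longrightarrow> p q \<prec> p r"
      using path_belowE[OF b(1)] by metis
    obtain p' where p': "p' (0::rat) = \<phi>'" "\<And>q. 0 \<le> q \<Longrightarrow> q < 1 \<Longrightarrow> p' q \<in> gen_cu_morphisms S T"
      "\<And>q. 0 \<le> q \<Longrightarrow> q < 1 \<Longrightarrow> p' q \<prec> \<psi>'"
      "\<And>q r. 0 \<le> q \<Longrightarrow> q < r \<Longrightarrow> r < 1 \<Longrightarrow> p' q \<prec> p' r"
      using path_belowE[OF b(2)] by metis
    have "(\<lambda>q. \<lambda>a\<in>carrier S. p q a \<oplus>\<^bsub>T\<^esub> p' q a) 0 \<lhd> (\<lambda>a\<in>carrier S. \<psi> a \<oplus>\<^bsub>T\<^esub> \<psi>' a)"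
      by (rule path_belowI; intro gen_cu_morphism_add mor_prec_add)
        (simp_all add: p(2-4) p'(2-4) path_below_carrier[OF b(1)] path_below_carrier[OF b(2)])
    then show ?thesis by (simp add: p(1) p'(1))
  qed
  moreover have "\<zero>\<^bsub>hom_monoid\<^esub> \<lhd> \<phi>" if "\<phi> \<in> carrier hom_monoid" for \<phi>
    using path_belowI[of \<phi> "\<lambda>_. \<lambda>a\<in>carrier S. \<zero>\<^bsub>T\<^esub>"] that gen_cu_morphism_zero zero_mor_prec by simp
  moreover have "\<phi> \<lhd> \<chi>" if "\<phi> \<lhd> \<psi>" "\<psi> \<lhd> \<chi>" for \<phi> \<psi> \<chi>
    using that path_below_prec_trans path_below_imp_prec path_below_carrier by blast
  ultimately show "interpolating_monoid hom_monoid path_below"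
    unfolding interpolating_monoid_def interpolating_monoid_axioms_def
    using path_below_carrier path_below_interpolate by (simp only: hom_monoid_simps(1)) blast
qed

text \<open>Ideals are taken for \<lhd> although paths are compared by \<prec>; the two fit because
  the segments of a path are themselves witnesses for \<lhd>.\<close>

definition path_ideal :: "(rat \<Rightarrow> 'a \<Rightarrow> 'b) \<Rightarrow> ('a \<Rightarrow> 'b) set" where
  "path_ideal f = {\<phi>. \<exists>l\<in>IQ. \<phi> \<lhd> f l}"

text \<open>The part of f over [l, m), rescaled affinely to [0, 1), is the witness.\<close>

lemma path_below_path:
  assumes f: "f \<in> paths S T" and "l \<in> IQ" "m \<in> IQ" "l < m"
  shows "f l \<lhd> f m"
proof -
  have between: "l \<le> l + q * (m - l) \<and> l + q * (m - l) < m" if "0 \<le> q" "q < 1" for q :: rat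
  proof -
    have "q * (m - l) < 1 * (m - l)" using that assms(4) by (intro mult_strict_right_mono) auto
    then have "q * (m - l) < m - l" by (simp only: mult_1_left)
    moreover have "0 \<le> q * (m - l)" using that assms(4) by simp
    moreover have "l \<le> l + d \<and> l + d < m" if "0 \<le> d" "d < m - l" for d using that by linarith
    ultimately show ?thesis by blast
  qed
  then have IQ: "l + q * (m - l) \<in> IQ" if "0 \<le> q" "q < 1" for q
    using that assms(2,3) unfolding IQ_iff by fastforce
  have "(\<lambda>q. f (l + q * (m - l))) 0 \<lhd> f m"
    by (rule path_belowI) (use pathsD[OF f] IQ between assms in \<open>auto intro!: pathsD[OF f]\<close>)
  then show ?thesis by simp
qed

text \<open>The cofinal times 1/2, 2/3, 3/4 and so on, which turn a path into a chain; the shift by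
  2 keeps the first of them inside (0, 1).\<close>

definition level :: "nat \<Rightarrow> rat" where
  "level n = 1 - 1 / of_nat (n + 2)"

lemma level_IQ: "level n \<in> IQ"
  by (simp add: level_def IQ_iff field_simps)

lemma level_less: "level n < level (Suc n)"
  by (simp add: level_def field_simps)

lemma level_cofinal:
  assumes "l \<in> IQ"
  obtains n where "l < level n"
proof -
  obtain n where n: "inverse (of_nat (Suc n)) < 1 - l" using reals_Archimedean[of "1 - l"] assms by (auto simp: IQ_iff)
  have "1 / of_nat (n + 2) \<le> inverse (of_nat (Suc n) :: rat)" by (simp add: field_simps)
  then have "l < level n" using n unfolding level_def by linarith
  then show ?thesis using that by blast
qed

lemma path_chain: "f \<in> paths S T \<Longrightarrow> H.chain (\<lambda>n. f (level n))"
  by (simp add: H.chain_def path_below_path level_IQ level_less)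

lemma path_ideal_generated:
  assumes f: "f \<in> paths S T"
  shows "path_ideal f = H.generated (\<lambda>n. f (level n))"
proof (intro equalityI subsetI)
  fix \<phi> assume "\<phi> \<in> path_ideal f"
  then obtain l where l: "l \<in> IQ" "\<phi> \<lhd> f l" by (auto simp: path_ideal_def)
  obtain n where "l < level n" using level_cofinal l(1) .
  then have "\<phi> \<lhd> f (level n)" using l f path_below_path level_IQ H.prec_trans by blast
  then show "\<phi> \<in> H.generated (\<lambda>n. f (level n))" by (auto simp: H.generated_def)
qed (auto simp: path_ideal_def H.generated_def level_IQ)

lemma path_mem_ideal:
  assumes "f \<in> paths S T" "l \<in> IQ"
  shows "f l \<in> path_ideal f"
proof -
  obtain m where "m \<in> IQ" "l < m" using IQ_greater[OF assms(2)] .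
  then show ?thesis using path_below_path[OF assms] by (auto simp: path_ideal_def)
qed

text \<open>From \<phi> \<lhd> f l and f l \<prec> g m follows \<phi> \<lhd> g m. Conversely each
  value f l lies in the ideal of f, because a path has no last time. So path classes correspond to
  ideals.\<close>

lemma path_lesssim_iff:
  assumes f: "f \<in> paths S T" and g: "g \<in> paths S T"
  shows "path_lesssim S T f g \<longleftrightarrow> path_ideal f \<subseteq> path_ideal g"
proof
  assume "path_lesssim S T f g"
  then show "path_ideal f \<subseteq> path_ideal g"
    unfolding path_lesssim_def path_ideal_def using path_below_prec_trans pathsD(1)[OF g] by blast
next
  assume sub: "path_ideal f \<subseteq> path_ideal g"
  show "path_lesssim S T f g"
    unfolding path_lesssim_def
  proof (intro ballI)
    fix l assume "l \<in> IQ"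
    then have "f l \<in> path_ideal g" using sub path_mem_ideal[OF f] by blast
    then show "\<exists>m\<in>IQ. f l \<prec> g m" by (auto simp: path_ideal_def intro: path_below_imp_prec)
  qed
qed

lemma path_class_ideal:
  "path_class S T f = {g \<in> paths S T. path_ideal g = path_ideal f}" if f: "f \<in> paths S T"
  unfolding path_class_def using path_lesssim_iff[OF f] path_lesssim_iff[OF _ f] by auto

lemma path_class_self: "f \<in> paths S T \<Longrightarrow> f \<in> path_class S T f"
  by (simp add: path_class_ideal)

lemma path_class_eq_iff:
  "f \<in> paths S T \<Longrightarrow> g \<in> paths S T \<Longrightarrow> path_class S T f = path_class S T g \<longleftrightarrow> path_ideal f = path_ideal g"
  by (auto simp: path_class_ideal)

lemma path_add_path:
  assumes "f \<in> paths S T" "g \<in> paths S T"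
  shows "path_add S T f g \<in> paths S T"
  using pathsD[OF assms(1)] pathsD[OF assms(2)]
  by (auto simp: paths_def path_add_def intro!: gen_cu_morphism_add mor_prec_add)

lemma path_ideal_add:
  assumes "f \<in> paths S T" "g \<in> paths S T"
  shows "path_ideal (path_add S T f g) = path_ideal f \<oplus>\<^bsub>H.completion\<^esub> path_ideal g"
  by (simp add: path_ideal_generated path_add_path assms H.generated_add path_chain)
    (simp add: path_add_def level_IQ)

lemma const_path: "\<phi> \<in> gen_cu_morphisms S T \<Longrightarrow> \<phi> \<prec> \<phi> \<Longrightarrow> (\<lambda>l\<in>IQ. \<phi>) \<in> paths S T"
  by (auto simp: paths_def)

lemma zero_path: "(\<lambda>l\<in>IQ. \<lambda>a\<in>carrier S. \<zero>\<^bsub>T\<^esub>) \<in> paths S T"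
  by (intro const_path gen_cu_morphism_zero zero_mor_prec)

lemma path_ideal_zero: "path_ideal (\<lambda>l\<in>IQ. \<lambda>a\<in>carrier S. \<zero>\<^bsub>T\<^esub>) = \<zero>\<^bsub>H.completion\<^esub>"
  by (simp add: path_ideal_generated zero_path H.completion_zero level_IQ)

lemma internal_hom_carrier: "carrier (internal_hom S T) = path_class S T ` paths S T"
  by (simp add: internal_hom_def)

lemma internal_hom_carrierE:
  assumes "x \<in> carrier (internal_hom S T)"
  obtains f where "f \<in> paths S T" "x = path_class S T f"
  using assms by (auto simp: internal_hom_carrier)

lemma path_class_closed: "f \<in> paths S T \<Longrightarrow> path_class S T f \<in> carrier (internal_hom S T)"
  by (simp add: internal_hom_carrier)

lemma internal_hom_leq_iff:
  "f \<in> paths S T \<Longrightarrow> g \<in> paths S T \<Longrightarrow>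
    path_class S T f \<preceq>\<^bsub>internal_hom S T\<^esub> path_class S T g \<longleftrightarrow> path_lesssim S T f g"
proof
  assume fg: "f \<in> paths S T" "g \<in> paths S T"
    and "path_class S T f \<preceq>\<^bsub>internal_hom S T\<^esub> path_class S T g"
  then show "path_lesssim S T f g"
    by (auto simp: internal_hom_def path_lesssim_iff path_class_ideal)
next
  assume "f \<in> paths S T" "g \<in> paths S T" "path_lesssim S T f g"
  then show "path_class S T f \<preceq>\<^bsub>internal_hom S T\<^esub> path_class S T g"
    using path_class_self by (auto simp: internal_hom_def)
qed

text \<open>The ideal of a sum depends only on the ideals of the summands, so the union over
  representatives is a union of copies of one class.\<close>

lemma internal_hom_add:
  assumes f: "f \<in> paths S T" and g: "g \<in> paths S T"
  shows "path_class S T f \<oplus>\<^bsub>internal_hom S T\<^esub> path_class S T g = path_class S T (path_add S T f g)"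
proof -
  have "path_class S T (path_add S T f' g') = path_class S T (path_add S T f g)"
    if "f' \<in> path_class S T f" "g' \<in> path_class S T g" for f' g'
    using that f g by (simp add: path_class_ideal path_class_eq_iff path_add_path path_ideal_add)
  then have "path_class S T f \<oplus>\<^bsub>internal_hom S T\<^esub> path_class S T g =
      (\<Union>f'\<in>path_class S T f. \<Union>g'\<in>path_class S T g. path_class S T (path_add S T f g))"
    unfolding internal_hom_def by simp
  also have "\<dots> = path_class S T (path_add S T f g)"
    using path_class_self[OF f] path_class_self[OF g] by blast
  finally show ?thesis .
qed

lemma internal_hom_zero:
  "\<zero>\<^bsub>internal_hom S T\<^esub> = path_class S T (\<lambda>l\<in>IQ. \<lambda>a\<in>carrier S. \<zero>\<^bsub>T\<^esub>)"
  by (simp add: internal_hom_def const_class_def)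

text \<open>A chain \<open>y\<close> is joined to a path by running through the half-open paths from \<open>y n\<close> to
  \<open>y (Suc n)\<close> one after the other, at the time \<open>t / (1 - t) \<in> [n, n + 1)\<close>.\<close>

lemma chain_path:
  assumes y: "H.chain y"
  obtains f where "f \<in> paths S T" "path_ideal f = H.generated y"
proof -
  have "\<exists>p. p (0::rat) = y n \<and> (\<forall>q\<in>{0..<1}. p q \<in> gen_cu_morphisms S T \<and> p q \<prec> y (Suc n)) \<and>
       (\<forall>q\<in>{0..<1}. \<forall>r\<in>{0..<1}. q < r \<longrightarrow> p q \<prec> p r)" for n
    using y unfolding H.chain_def path_below_def by blast
  then obtain p where p: "\<And>n. p n (0::rat) = y n"
    "\<And>n q. q \<in> {0..<1} \<Longrightarrow> p n q \<in> gen_cu_morphisms S T"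
    "\<And>n q. q \<in> {0..<1} \<Longrightarrow> p n q \<prec> y (Suc n)"
    "\<And>n q r. q \<in> {0..<1} \<Longrightarrow> r \<in> {0..<1} \<Longrightarrow> q < r \<Longrightarrow> p n q \<prec> p n r"
    by metis
  have y_leq: "y m \<prec> y n" if "m < n" for m n
    using H.chain_prec[OF y that] by (rule path_below_imp_prec)
  define time where "time t = t / (1 - t)" for t :: rat
  define f where "f = (\<lambda>t\<in>IQ. p (nat \<lfloor>time t\<rfloor>) (frac (time t)))"
  have time_pos: "0 < time t" if "t \<in> IQ" for t
    using that by (simp add: time_def IQ_iff)
  have time_less: "time s < time t" if "s \<in> IQ" "t \<in> IQ" "s < t" for s t
    using that by (simp add: time_def IQ_iff field_simps)
  have frac_mem: "frac x \<in> {0..<1}" for x :: rat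
    by (simp add: frac_lt_1)
  \<comment> \<open>At q = 0 the piece sits at y n, and y n \<prec> y n may fail, hence the
    alternative.\<close>
  have y_le_p': "y n \<prec> p n q \<or> y n = p n q" if "q \<in> {0..<1}" for n q
    using that p(1)[of n] p(4)[of 0 q n] by (cases "q = 0") auto
  have y_le_p: "y m \<prec> p n q" if "m < n" "q \<in> {0..<1}" for m n q
    using y_leq[OF that(1)] y_le_p'[OF that(2), of n] mor_prec_trans by metis
  have f: "f \<in> paths S T"
    unfolding paths_def
  proof (intro CollectI conjI ballI impI)
    show "f \<in> IQ \<rightarrow>\<^sub>E gen_cu_morphisms S T" using p(2)[OF frac_mem] by (simp add: f_def)
    show "f s \<prec> f t" if st: "s \<in> IQ" "t \<in> IQ" "s < t" for s t
    proof -
      let ?m = "nat \<lfloor>time s\<rfloor>" and ?n = "nat \<lfloor>time t\<rfloor>"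
      have le: "\<lfloor>time s\<rfloor> \<le> \<lfloor>time t\<rfloor>" "0 \<le> \<lfloor>time s\<rfloor>"
        using time_less[OF st] time_pos[OF st(1)] by (auto intro: floor_mono)
      \<comment> \<open>Same piece, neighbouring pieces, or a whole piece in between. In the last
        two cases the earlier value is \<prec> the starting point of the next piece.\<close>
      consider "\<lfloor>time s\<rfloor> = \<lfloor>time t\<rfloor>" | "?n = Suc ?m" | "Suc ?m < ?n" using le by linarith
      then show ?thesis
      proof cases
        case 1
        then have "frac (time s) < frac (time t)" using time_less[OF st] by (simp add: frac_def)
        then show ?thesis using 1 st p(4)[OF frac_mem frac_mem] by (simp add: f_def)
      next
        case 2
        have "p ?m (frac (time s)) \<prec> y ?n" using p(3)[OF frac_mem, of ?m] 2 by simp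
        moreover have "y ?n \<prec> p ?n (frac (time t)) \<or> y ?n = p ?n (frac (time t))"
          using y_le_p' frac_mem by blast
        ultimately show ?thesis using st mor_prec_trans by (auto simp: f_def)
      next
        case 3
        then show ?thesis
          using p(3)[OF frac_mem] y_le_p[OF 3 frac_mem] mor_prec_trans st by (simp add: f_def) blast
      qed
    qed
  qed
  moreover have "path_ideal f = H.generated y"
  proof (intro equalityI subsetI)
    fix \<phi> assume "\<phi> \<in> path_ideal f"
    then obtain t where "t \<in> IQ" "\<phi> \<lhd> f t" by (auto simp: path_ideal_def)
    then have "\<phi> \<lhd> p (nat \<lfloor>time t\<rfloor>) (frac (time t))" by (simp add: f_def)
    then have "\<phi> \<lhd> y (Suc (nat \<lfloor>time t\<rfloor>))"
      by (rule path_below_prec_trans[OF _ p(3)[OF frac_mem]]) (use H.chain_carrier[OF y] in simp)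
    then show "\<phi> \<in> H.generated y" by (auto simp: H.generated_def)
  next
    fix \<phi> assume "\<phi> \<in> H.generated y"
    then obtain n where "\<phi> \<lhd> y n" by (auto simp: H.generated_def)
    then have *: "\<phi> \<lhd> y (Suc n)" using y H.prec_trans unfolding H.chain_def by blast
    \<comment> \<open>The solution of t / (1 - t) = n + 1, when the path passes exactly through
      \<open>y (Suc n)\<close>. The index n itself would give t = 0 for n = 0, outside (0,
      1).\<close>
    define t :: rat where "t = of_nat (Suc n) / of_nat (Suc (Suc n))"
    have t: "t \<in> IQ" by (simp add: t_def IQ_iff)
    have "time t = of_nat (Suc n)" by (simp add: time_def t_def field_simps)
    then have "nat \<lfloor>time t\<rfloor> = Suc n" "frac (time t) = 0" by (simp_all only: floor_of_nat frac_def nat_int)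
    then have "f t = y (Suc n)" using t p(1)[of "Suc n"] by (simp only: f_def restrict_apply')
    then have "\<phi> \<lhd> f t" using * by simp
    then show "\<phi> \<in> path_ideal f" using t unfolding path_ideal_def by blast
  qed
  ultimately show ?thesis using that by blast
qed

definition class_ideal :: "(rat \<Rightarrow> 'a \<Rightarrow> 'b) set \<Rightarrow> ('a \<Rightarrow> 'b) set" where
  "class_ideal x = (\<Union>f\<in>x. path_ideal f)"

lemma class_ideal_path_class: "f \<in> paths S T \<Longrightarrow> class_ideal (path_class S T f) = path_ideal f"
  by (auto simp: class_ideal_def path_class_ideal)

text \<open>Injectivity comes from \<open>path_lesssim_iff\<close>, surjectivity from
  \<open>chain_path\<close>.\<close>

sublocale I: cu_transfer H.completion "internal_hom S T" class_ideal
proof (intro cu_transfer.intro cu_transfer_axioms.intro H.completion_cu_semigroup)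
  show "bij_betw class_ideal (carrier (internal_hom S T)) (carrier H.completion)"
    unfolding bij_betw_def
  proof (intro conjI)
    show "inj_on class_ideal (carrier (internal_hom S T))"
    proof (rule inj_onI)
      fix x y assume x: "x \<in> carrier (internal_hom S T)" and y: "y \<in> carrier (internal_hom S T)"
        and eq: "class_ideal x = class_ideal y"
      obtain f g where "f \<in> paths S T" "x = path_class S T f" "g \<in> paths S T" "y = path_class S T g"
        using internal_hom_carrierE[OF x] internal_hom_carrierE[OF y] by metis
      then show "x = y" using eq by (simp add: class_ideal_path_class path_class_eq_iff)
    qed
    show "class_ideal ` carrier (internal_hom S T) = carrier H.completion"
    proof (intro equalityI subsetI)
      fix I assume "I \<in> class_ideal ` carrier (internal_hom S T)"
      then show "I \<in> carrier H.completion"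
        by (auto elim!: internal_hom_carrierE
            simp: class_ideal_path_class path_ideal_generated H.generated_in_carrier path_chain)
    next
      fix I assume "I \<in> carrier H.completion"
      then obtain y where "H.chain y" "I = H.generated y" by (rule H.completion_carrierE)
      then obtain f where "f \<in> paths S T" "I = path_ideal f" using chain_path by metis
      then show "I \<in> class_ideal ` carrier (internal_hom S T)"
        by (intro image_eqI[of _ _ "path_class S T f"]) (simp_all add: class_ideal_path_class path_class_closed)
    qed
  qed
  show "\<zero>\<^bsub>internal_hom S T\<^esub> \<in> carrier (internal_hom S T)"
    "class_ideal \<zero>\<^bsub>internal_hom S T\<^esub> = \<zero>\<^bsub>H.completion\<^esub>"
    by (simp_all add: internal_hom_zero path_class_closed zero_path class_ideal_path_class path_ideal_zero)
  fix x y assume "x \<in> carrier (internal_hom S T)" "y \<in> carrier (internal_hom S T)"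
  then obtain f g where fg: "f \<in> paths S T" "x = path_class S T f" "g \<in> paths S T" "y = path_class S T g"
    by (auto elim!: internal_hom_carrierE)
  then show "x \<preceq>\<^bsub>internal_hom S T\<^esub> y \<longleftrightarrow> class_ideal x \<preceq>\<^bsub>H.completion\<^esub> class_ideal y"
    by (simp add: internal_hom_leq_iff path_lesssim_iff class_ideal_path_class)
  show "x \<oplus>\<^bsub>internal_hom S T\<^esub> y \<in> carrier (internal_hom S T)"
    using fg by (simp add: internal_hom_add path_add_path path_class_closed)
  show "class_ideal (x \<oplus>\<^bsub>internal_hom S T\<^esub> y) = class_ideal x \<oplus>\<^bsub>H.completion\<^esub> class_ideal y"
    using fg by (simp add: internal_hom_add path_add_path class_ideal_path_class path_ideal_add del: H.mem_completion_add)
qed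

lemmas internal_hom_cu_semigroup = I.cu_semigroup_V

text \<open>An element of the ideal of g that bounds the ideal of f may be replaced by a value g m
  above it. One time m then works for all l, in contrast to the order, where m depends on l.\<close>

lemma internal_hom_way_below_iff:
  assumes f: "f \<in> paths S T" and g: "g \<in> paths S T"
  shows "path_class S T f \<lless>\<^bsub>internal_hom S T\<^esub> path_class S T g \<longleftrightarrow> (\<exists>m\<in>IQ. \<forall>l\<in>IQ. f l \<prec> g m)"
proof -
  have c: "path_ideal f \<in> carrier H.completion" "path_ideal g \<in> carrier H.completion"
    using f g by (simp_all add: path_ideal_generated H.generated_in_carrier path_chain)
  have "path_class S T f \<lless>\<^bsub>internal_hom S T\<^esub> path_class S T g \<longleftrightarrow>
      (\<exists>\<psi>\<in>path_ideal g. \<forall>\<phi>\<in>path_ideal f. \<phi> \<lhd> \<psi>)"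
    using f g c
    by (simp add: I.way_below_iff path_class_closed class_ideal_path_class H.completion_way_below_iff)
  also have "\<dots> \<longleftrightarrow> (\<exists>m\<in>IQ. \<forall>l\<in>IQ. f l \<prec> g m)"
  proof
    assume "\<exists>\<psi>\<in>path_ideal g. \<forall>\<phi>\<in>path_ideal f. \<phi> \<lhd> \<psi>"
    then obtain \<psi> m where "m \<in> IQ" "\<psi> \<lhd> g m" "\<forall>\<phi>\<in>path_ideal f. \<phi> \<lhd> \<psi>"
      by (auto simp: path_ideal_def)
    then show "\<exists>m\<in>IQ. \<forall>l\<in>IQ. f l \<prec> g m"
      using path_mem_ideal[OF f] H.prec_trans path_below_imp_prec by blast
  next
    assume "\<exists>m\<in>IQ. \<forall>l\<in>IQ. f l \<prec> g m"
    then obtain m where m: "m \<in> IQ" "\<forall>l\<in>IQ. f l \<prec> g m" by blast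
    have "\<forall>\<phi>\<in>path_ideal f. \<phi> \<lhd> g m"
      using m path_below_prec_trans pathsD(1)[OF g m(1)] by (auto simp: path_ideal_def)
    then show "\<exists>\<psi>\<in>path_ideal g. \<forall>\<phi>\<in>path_ideal f. \<phi> \<lhd> \<psi>"
      using path_mem_ideal[OF g m(1)] by blast
  qed
  finally show ?thesis .
qed

text \<open>Suprema of ideals are unions, and f l lies in the ideal of f, hence in the ideal of some
  F n.\<close>

lemma internal_hom_supremumD:
  assumes F: "\<And>n. F n \<in> paths S T" and f: "f \<in> paths S T"
    and inc: "increasing (internal_hom S T) (\<lambda>n. path_class S T (F n))"
    and sup: "is_supremum (internal_hom S T) (range (\<lambda>n. path_class S T (F n))) (path_class S T f)"
    and l: "l \<in> IQ"
  shows "\<exists>n. \<exists>m\<in>IQ. f l \<prec> F n m"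
proof -
  have "increasing H.completion (\<lambda>n. path_ideal (F n))"
    using inc I.increasing_iff[of "\<lambda>n. path_class S T (F n)"] F
    by (simp add: path_class_closed class_ideal_path_class)
  moreover have "is_supremum H.completion (range (\<lambda>n. path_ideal (F n))) (path_ideal f)"
    using sup I.is_supremum_iff[of "\<lambda>n. path_class S T (F n)"] F f
    by (simp add: path_class_closed class_ideal_path_class)
  ultimately have "path_ideal f = (\<Union>n. path_ideal (F n))"
    using H.completion_supremum_eq by blast
  then obtain n where "f l \<in> path_ideal (F n)" using path_mem_ideal[OF f l] by blast
  then show ?thesis by (auto simp: path_ideal_def dest: path_below_imp_prec)
qed

lemma internal_hom_supremumI:
  assumes F: "\<And>n. F n \<in> paths S T" and f: "f \<in> paths S T"
    and upper: "\<And>n. path_lesssim S T (F n) f"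
    and least: "\<And>l. l \<in> IQ \<Longrightarrow> \<exists>n. \<exists>m\<in>IQ. f l \<prec> F n m"
  shows "is_supremum (internal_hom S T) (range (\<lambda>n. path_class S T (F n))) (path_class S T f)"
  unfolding is_supremum_def
proof (intro conjI ballI impI)
  fix u assume u: "u \<in> carrier (internal_hom S T)"
    "\<forall>x\<in>range (\<lambda>n. path_class S T (F n)). x \<preceq>\<^bsub>internal_hom S T\<^esub> u"
  then obtain g where g: "g \<in> paths S T" "u = path_class S T g" by (auto elim!: internal_hom_carrierE)
  have Fg: "path_lesssim S T (F n) g" for n using u(2) g F by (simp add: internal_hom_leq_iff)
  have "path_lesssim S T f g"
    unfolding path_lesssim_def
  proof (intro ballI)
    fix l assume "l \<in> IQ"
    then obtain n m where m: "m \<in> IQ" "f l \<prec> F n m" using least by blast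
    then obtain k where "k \<in> IQ" "F n m \<prec> g k" using Fg unfolding path_lesssim_def by blast
    then show "\<exists>k\<in>IQ. f l \<prec> g k" using m mor_prec_trans by blast
  qed
  then show "path_class S T f \<preceq>\<^bsub>internal_hom S T\<^esub> u" using f g by (simp add: internal_hom_leq_iff)
qed (use F f upper in \<open>auto simp: path_class_closed internal_hom_leq_iff\<close>)

end

section \<open>Endpoints and composition of paths\<close>


context hom_model
begin

lemma mor_prec_path_mono:
  assumes "f \<in> paths S T" "\<phi> \<prec> f m" "m \<in> IQ" "k \<in> IQ" "m \<le> k"
  shows "\<phi> \<prec> f k"
  using assms mor_prec_trans[of \<phi> "f m" "f k"] pathsD(2)[OF assms(1,3,4)] by (cases "m = k") auto

lemma path_class_eqI:
  "f \<in> paths S T \<Longrightarrow> g \<in> paths S T \<Longrightarrow> path_lesssim S T f g \<Longrightarrow> path_lesssim S T g f \<Longrightarrow>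
    path_class S T f = path_class S T g"
  by (simp add: path_class_eq_iff path_lesssim_iff)

sublocale IH: cu_semigroup "internal_hom S T"
  by (rule internal_hom_cu_semigroup)

lemma internal_hom_increasing_leq:
  "increasing (internal_hom S T) c \<Longrightarrow> i \<le> j \<Longrightarrow> c i \<preceq>\<^bsub>internal_hom S T\<^esub> c j"
  by (rule IH.increasing_leq)

lemma internal_hom_seqE:
  assumes "\<And>n::nat. c n \<in> carrier (internal_hom S T)"
  obtains F where "\<And>n. F n \<in> paths S T" "c = (\<lambda>n. path_class S T (F n))"
proof
  have *: "\<exists>f. f \<in> paths S T \<and> c n = path_class S T f" for n
    using internal_hom_carrierE[OF assms] by metis
  show "(SOME f. f \<in> paths S T \<and> c n = path_class S T f) \<in> paths S T" for n
    using someI_ex[OF *[of n]] by blast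
  show "c = (\<lambda>n. path_class S T (SOME f. f \<in> paths S T \<and> c n = path_class S T f))"
    using someI_ex[OF *] by blast
qed

lemma path_leq:
  assumes f: "f \<in> paths S T" and lm: "l \<in> IQ" "m \<in> IQ" "l \<le> m" and a: "a \<in> carrier S"
  shows "f l a \<preceq>\<^bsub>T\<^esub> f m a"
proof (cases "l = m")
  case True
  then show ?thesis using gen_cu_morphismD(2)[OF pathsD(1)[OF f lm(2)] a] by (simp add: T.leq_refl)
next
  case False
  then show ?thesis using lm a by (intro mor_prec_leq pathsD[OF f]) auto
qed

lemma path_value_closed: "f \<in> paths S T \<Longrightarrow> l \<in> IQ \<Longrightarrow> a \<in> carrier S \<Longrightarrow> f l a \<in> carrier T"
  using pathsD(1) gen_cu_morphismD(2) by metis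

lemma path_levels_increasing:
  "f \<in> paths S T \<Longrightarrow> a \<in> carrier S \<Longrightarrow> increasing T (\<lambda>n. f (level n) a)"
  by (simp add: increasing_def path_value_closed level_IQ path_leq less_imp_le level_less)

lemma path_lesssim_leq:
  assumes f: "f \<in> paths S T" and g: "g \<in> paths S T" and "path_lesssim S T f g"
    and l: "l \<in> IQ" and a: "a \<in> carrier S"
  shows "\<exists>m\<in>IQ. f l a \<preceq>\<^bsub>T\<^esub> g m a"
  using assms(3) l unfolding path_lesssim_def using mor_prec_leq[OF _ pathsD(1)[OF f] pathsD(1)[OF g] a] by blast

lemma path_supremum_iff_levels:
  assumes f: "f \<in> paths S T" and a: "a \<in> carrier S"
  shows "is_supremum T ((\<lambda>l. f l a) ` IQ) s \<longleftrightarrow> is_supremum T (range (\<lambda>n. f (level n) a)) s"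
proof -
  have c: "(\<lambda>l. f l a) ` IQ \<subseteq> carrier T" "range (\<lambda>n. f (level n) a) \<subseteq> carrier T"
    using path_value_closed[OF f _ a] level_IQ by auto
  have 1: "\<exists>b\<in>range (\<lambda>n. f (level n) a). x \<preceq>\<^bsub>T\<^esub> b" if x: "x \<in> (\<lambda>l. f l a) ` IQ" for x
  proof -
    obtain l where l: "l \<in> IQ" "x = f l a" using x by blast
    obtain n where "l < level n" using level_cofinal[OF l(1)] .
    then have "f l a \<preceq>\<^bsub>T\<^esub> f (level n) a" using path_leq[OF f l(1) level_IQ _ a] by simp
    then show ?thesis using l(2) by blast
  qed
  have 2: "\<exists>b\<in>(\<lambda>l. f l a) ` IQ. x \<preceq>\<^bsub>T\<^esub> b" if "x \<in> range (\<lambda>n. f (level n) a)" for x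
    using that level_IQ T.leq_refl c(2) by blast
  show ?thesis using T.is_supremum_cofinal[OF _ c 1 2] T.is_supremum_cofinal[OF _ c(2,1) 2 1] by blast
qed

text \<open>The representative picked by the choice operator need not be f, but equivalent paths
  have mutually cofinal values at a.\<close>

lemma endpoint_is_supremum:
  assumes f: "f \<in> paths S T" and a: "a \<in> carrier S"
  shows "is_supremum T ((\<lambda>l. f l a) ` IQ) (endpoint S T (path_class S T f) a)"
proof -
  define g where "g = (SOME g. g \<in> path_class S T f)"
  have "g \<in> path_class S T f" unfolding g_def
    using path_class_self[OF f] by (rule someI[where P = "\<lambda>g. g \<in> path_class S T f"])
  then have g: "g \<in> paths S T" "path_lesssim S T f g" "path_lesssim S T g f"
    by (auto simp: path_class_def)
  obtain s where "is_supremum T (range (\<lambda>n. g (level n) a)) s"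
    using T.O1[OF path_levels_increasing[OF g(1) a]] by blast
  then have s: "is_supremum T ((\<lambda>l. g l a) ` IQ) s" using path_supremum_iff_levels[OF g(1) a] by blast
  then have "endpoint S T (path_class S T f) a = s"
    using a by (simp add: endpoint_def g_def[symmetric] T.supremum_eq)
  moreover have "is_supremum T ((\<lambda>l. f l a) ` IQ) s"
  proof (rule T.is_supremum_cofinal[OF s])
    show "\<exists>b\<in>(\<lambda>l. f l a) ` IQ. x \<preceq>\<^bsub>T\<^esub> b" if "x \<in> (\<lambda>l. g l a) ` IQ" for x
      using that path_lesssim_leq[OF g(1) f g(3) _ a] by blast
    show "\<exists>b\<in>(\<lambda>l. g l a) ` IQ. x \<preceq>\<^bsub>T\<^esub> b" if "x \<in> (\<lambda>l. f l a) ` IQ" for x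
      using that path_lesssim_leq[OF f g(1,2) _ a] by blast
  qed (use path_value_closed f g(1) a in auto)
  ultimately show ?thesis by simp
qed

lemma endpoint_levels:
  "f \<in> paths S T \<Longrightarrow> a \<in> carrier S \<Longrightarrow>
    is_supremum T (range (\<lambda>n. f (level n) a)) (endpoint S T (path_class S T f) a)"
  using endpoint_is_supremum path_supremum_iff_levels by blast

lemma endpoint_closed:
  "f \<in> paths S T \<Longrightarrow> a \<in> carrier S \<Longrightarrow> endpoint S T (path_class S T f) a \<in> carrier T"
  using endpoint_is_supremum by (auto simp: is_supremum_def)

lemma endpoint_upper:
  "f \<in> paths S T \<Longrightarrow> a \<in> carrier S \<Longrightarrow> l \<in> IQ \<Longrightarrow> f l a \<preceq>\<^bsub>T\<^esub> endpoint S T (path_class S T f) a"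
  using endpoint_is_supremum[of f a] by (simp add: is_supremum_def)

lemma endpoint_least:
  "f \<in> paths S T \<Longrightarrow> a \<in> carrier S \<Longrightarrow> u \<in> carrier T \<Longrightarrow> (\<And>l. l \<in> IQ \<Longrightarrow> f l a \<preceq>\<^bsub>T\<^esub> u) \<Longrightarrow>
    endpoint S T (path_class S T f) a \<preceq>\<^bsub>T\<^esub> u"
  using endpoint_is_supremum[of f a] by (simp add: is_supremum_def)

lemma endpoint_mono_path:
  assumes f: "f \<in> paths S T" and g: "g \<in> paths S T" and fg: "path_lesssim S T f g" and a: "a \<in> carrier S"
  shows "endpoint S T (path_class S T f) a \<preceq>\<^bsub>T\<^esub> endpoint S T (path_class S T g) a"
proof (rule endpoint_least[OF f a endpoint_closed[OF g a]])
  fix l assume l: "l \<in> IQ"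
  then obtain m where m: "m \<in> IQ" "f l a \<preceq>\<^bsub>T\<^esub> g m a" using path_lesssim_leq[OF f g fg _ a] by blast
  show "f l a \<preceq>\<^bsub>T\<^esub> endpoint S T (path_class S T g) a"
    by (rule T.leq_trans[OF m(2) endpoint_upper[OF g a m(1)]])
      (simp_all add: path_value_closed endpoint_closed f g a l m(1))
qed

lemma endpoint_mono:
  assumes f: "f \<in> paths S T" and ab: "a \<in> carrier S" "b \<in> carrier S" "a \<preceq>\<^bsub>S\<^esub> b"
  shows "endpoint S T (path_class S T f) a \<preceq>\<^bsub>T\<^esub> endpoint S T (path_class S T f) b"
proof (rule endpoint_least[OF f ab(1) endpoint_closed[OF f ab(2)]])
  fix l assume l: "l \<in> IQ"
  have "f l a \<preceq>\<^bsub>T\<^esub> f l b" using gen_cu_morphismD(5)[OF pathsD(1)[OF f l] ab] .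
  then show "f l a \<preceq>\<^bsub>T\<^esub> endpoint S T (path_class S T f) b"
    by (rule T.leq_trans[OF _ endpoint_upper[OF f ab(2) l]])
      (simp_all add: path_value_closed endpoint_closed f ab l)
qed

lemma endpoint_eqI:
  "f \<in> paths S T \<Longrightarrow> a \<in> carrier S \<Longrightarrow> is_supremum T (range (\<lambda>n. f (level n) a)) s \<Longrightarrow>
    endpoint S T (path_class S T f) a = s"
  using endpoint_levels T.is_supremum_unique by blast

text \<open>Additivity is O4 along the levels. Joint continuity and way-below rest on the path
  descriptions of suprema and way-below in the internal hom.\<close>

lemma endpoint_bimorphism: "cu_bimorphism (internal_hom S T) S T (endpoint S T)"
  unfolding cu_bimorphism_def
proof (intro conjI ballI allI impI)
  fix x a assume x: "x \<in> carrier (internal_hom S T)" and a: "a \<in> carrier S"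
  obtain f where f: "f \<in> paths S T" "x = path_class S T f" using internal_hom_carrierE[OF x] .
  show "endpoint S T x a \<in> carrier T" using endpoint_closed f a by simp
  fix b assume b: "b \<in> carrier S"
  show "endpoint S T x (a \<oplus>\<^bsub>S\<^esub> b) = endpoint S T x a \<oplus>\<^bsub>T\<^esub> endpoint S T x b"
    unfolding f(2)
  proof (rule endpoint_eqI[OF f(1)])
    show "is_supremum T (range (\<lambda>n. f (level n) (a \<oplus>\<^bsub>S\<^esub> b)))
        (endpoint S T (path_class S T f) a \<oplus>\<^bsub>T\<^esub> endpoint S T (path_class S T f) b)"
      using T.O4[OF path_levels_increasing[OF f(1) a] path_levels_increasing[OF f(1) b]
          endpoint_levels[OF f(1) a] endpoint_levels[OF f(1) b]]
      by (simp add: gen_cu_morphismD(3)[OF pathsD(1)[OF f(1) level_IQ] a b])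
  qed (use a b in simp)
  show "endpoint S T x b \<preceq>\<^bsub>T\<^esub> endpoint S T x a" if "b \<preceq>\<^bsub>S\<^esub> a"
    using endpoint_mono f a b that by simp
next
  fix x y a assume x: "x \<in> carrier (internal_hom S T)" and y: "y \<in> carrier (internal_hom S T)"
    and a: "a \<in> carrier S"
  obtain f where f: "f \<in> paths S T" "x = path_class S T f" using internal_hom_carrierE[OF x] .
  obtain g where g: "g \<in> paths S T" "y = path_class S T g" using internal_hom_carrierE[OF y] .
  show "endpoint S T (x \<oplus>\<^bsub>internal_hom S T\<^esub> y) a = endpoint S T x a \<oplus>\<^bsub>T\<^esub> endpoint S T y a"
    unfolding f(2) g(2) internal_hom_add[OF f(1) g(1)]
  proof (rule endpoint_eqI[OF path_add_path[OF f(1) g(1)] a])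
    show "is_supremum T (range (\<lambda>n. path_add S T f g (level n) a))
        (endpoint S T (path_class S T f) a \<oplus>\<^bsub>T\<^esub> endpoint S T (path_class S T g) a)"
      using T.O4[OF path_levels_increasing[OF f(1) a] path_levels_increasing[OF g(1) a]
          endpoint_levels[OF f(1) a] endpoint_levels[OF g(1) a]]
      by (simp add: path_add_def level_IQ a)
  qed
  show "endpoint S T y a \<preceq>\<^bsub>T\<^esub> endpoint S T x a" if "y \<preceq>\<^bsub>internal_hom S T\<^esub> x"
    using that f g a endpoint_mono_path by (simp add: internal_hom_leq_iff)
next
  show "endpoint S T \<zero>\<^bsub>internal_hom S T\<^esub> a = \<zero>\<^bsub>T\<^esub>" if a: "a \<in> carrier S" for a
    unfolding internal_hom_zero
    using T.is_supremum_const[OF T.one_closed]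
    by (intro endpoint_eqI[OF zero_path a]) (simp add: level_IQ a)
next
  fix x assume x: "x \<in> carrier (internal_hom S T)"
  obtain f where f: "f \<in> paths S T" "x = path_class S T f" using internal_hom_carrierE[OF x] .
  show "endpoint S T x \<zero>\<^bsub>S\<^esub> = \<zero>\<^bsub>T\<^esub>"
    unfolding f(2)
    using T.is_supremum_const[OF T.one_closed]
    by (intro endpoint_eqI[OF f(1)]) (simp_all add: gen_cu_morphismD(4)[OF pathsD(1)[OF f(1) level_IQ]])
next
  fix c d s t
  assume a: "increasing (internal_hom S T) c \<and> increasing S d \<and>
    is_supremum (internal_hom S T) (range c) s \<and> is_supremum S (range d) t"
  have c: "c n \<in> carrier (internal_hom S T)" "d n \<in> carrier S" for n using a by (auto simp: increasing_def)
  have st: "s \<in> carrier (internal_hom S T)" "t \<in> carrier S" using a by (auto simp: is_supremum_def)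
  obtain F where F: "\<And>n. F n \<in> paths S T" "c = (\<lambda>n. path_class S T (F n))"
    by (rule internal_hom_seqE[of c, OF c(1)]) blast
  obtain f where f: "f \<in> paths S T" "s = path_class S T f" using internal_hom_carrierE[OF st(1)] .
  show "is_supremum T (range (\<lambda>k. endpoint S T (c k) (d k))) (endpoint S T s t)"
    unfolding is_supremum_def
  proof (intro conjI ballI impI)
    show E: "endpoint S T s t \<in> carrier T" using f st(2) endpoint_closed by simp
    show "z \<preceq>\<^bsub>T\<^esub> endpoint S T s t" if z: "z \<in> range (\<lambda>k. endpoint S T (c k) (d k))" for z
    proof -
      obtain k where k: "z = endpoint S T (path_class S T (F k)) (d k)" using z F(2) by auto
      have "c k \<preceq>\<^bsub>internal_hom S T\<^esub> s" "d k \<preceq>\<^bsub>S\<^esub> t" using a by (auto simp: is_supremum_def)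
      then have "endpoint S T (path_class S T (F k)) (d k) \<preceq>\<^bsub>T\<^esub> endpoint S T s (d k)"
        "endpoint S T s (d k) \<preceq>\<^bsub>T\<^esub> endpoint S T s t"
        using endpoint_mono_path endpoint_mono f F c(2) st(2) by (auto simp: internal_hom_leq_iff)
      then show ?thesis
        unfolding k using T.leq_trans endpoint_closed f F(1) c(2) st(2) by metis
    qed
    show "endpoint S T s t \<preceq>\<^bsub>T\<^esub> u"
      if u: "u \<in> carrier T" "\<forall>z\<in>range (\<lambda>k. endpoint S T (c k) (d k)). z \<preceq>\<^bsub>T\<^esub> u" for u
      unfolding f(2)
    proof (rule endpoint_least[OF f(1) st(2) u(1)])
      fix l assume l: "l \<in> IQ"
      obtain n m where nm: "m \<in> IQ" "f l \<prec> F n m"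
        using internal_hom_supremumD[where F = F, OF F(1) f(1) _ _ l] a F(2) f(2) by auto
      have "f l (d k) \<preceq>\<^bsub>T\<^esub> u" for k
      proof -
        \<comment> \<open>The index n bounds f l through F n m, the index k bounds the argument;
          both sequences increase, so the diagonal entry at the maximum controls both.\<close>
        let ?j = "max n k"
        have j: "d k \<preceq>\<^bsub>S\<^esub> d ?j" using S.increasing_leq[of d k ?j] a by simp
        have "c n \<preceq>\<^bsub>internal_hom S T\<^esub> c ?j" using internal_hom_increasing_leq[of c n ?j] a by simp
        then have 1: "endpoint S T (c n) (d ?j) \<preceq>\<^bsub>T\<^esub> endpoint S T (c ?j) (d ?j)"
          using endpoint_mono_path F c(2) by (simp add: internal_hom_leq_iff)
        have 2: "f l (d k) \<preceq>\<^bsub>T\<^esub> f l (d ?j)"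
          using gen_cu_morphismD(5)[OF pathsD(1)[OF f(1) l] c(2) c(2) j] .
        have 3: "f l (d ?j) \<preceq>\<^bsub>T\<^esub> F n m (d ?j)"
          using mor_prec_leq[OF nm(2) pathsD(1)[OF f(1) l] pathsD(1)[OF F(1) nm(1)] c(2)] .
        have 4: "F n m (d ?j) \<preceq>\<^bsub>T\<^esub> endpoint S T (c n) (d ?j)"
          using endpoint_upper[OF F(1) c(2) nm(1)] F(2) by simp
        have 5: "endpoint S T (c ?j) (d ?j) \<preceq>\<^bsub>T\<^esub> u" using u(2) by blast
        have cl: "f l (d k) \<in> carrier T" "f l (d ?j) \<in> carrier T" "F n m (d ?j) \<in> carrier T"
          "endpoint S T (c n) (d ?j) \<in> carrier T" "endpoint S T (c ?j) (d ?j) \<in> carrier T"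
          using path_value_closed f(1) F(1) c(2) l nm(1) endpoint_closed F(2) by auto
        show ?thesis
          using T.leq_trans[OF 2 3] T.leq_trans[OF 4 1] T.leq_trans[OF _ 5] T.leq_trans cl u(1) by metis
      qed
      then show "f l t \<preceq>\<^bsub>T\<^esub> u"
        using gen_cu_morphismD(6)[OF pathsD(1)[OF f(1) l], of d t] a u(1) by (auto simp: is_supremum_def)
    qed
  qed
next
  fix x' x a' a assume wb: "x' \<lless>\<^bsub>internal_hom S T\<^esub> x \<and> a' \<lless>\<^bsub>S\<^esub> a"
  then have c: "x' \<in> carrier (internal_hom S T)" "x \<in> carrier (internal_hom S T)"
    "a' \<in> carrier S" "a \<in> carrier S" by (auto simp: way_below_def)
  obtain f where f: "f \<in> paths S T" "x' = path_class S T f" using internal_hom_carrierE[OF c(1)] .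
  obtain g where g: "g \<in> paths S T" "x = path_class S T g" using internal_hom_carrierE[OF c(2)] .
  obtain m where m: "m \<in> IQ" "\<And>l. l \<in> IQ \<Longrightarrow> f l \<prec> g m"
    using wb internal_hom_way_below_iff[OF f(1) g(1)] f(2) g(2) by auto
  \<comment> \<open>The time m only gives an inequality for the endpoint; the way-below step comes
    from moving on from g m to the later g m'.\<close>
  obtain m' where m': "m' \<in> IQ" "m < m'" using IQ_greater[OF m(1)] .
  have "endpoint S T x' a' \<preceq>\<^bsub>T\<^esub> g m a'"
    unfolding f(2)
    by (rule endpoint_least[OF f(1) c(3)])
      (use path_value_closed g(1) m c(3) mor_prec_leq pathsD(1) f(1) in metis)+
  moreover have "g m a' \<lless>\<^bsub>T\<^esub> g m' a"
    using pathsD(2)[OF g(1) m(1) m'] wb unfolding mor_prec_def by blast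
  moreover have "g m' a \<preceq>\<^bsub>T\<^esub> endpoint S T x a" using endpoint_upper g m'(1) c(4) by simp
  moreover have "endpoint S T x' a' \<in> carrier T" "endpoint S T x a \<in> carrier T"
    using endpoint_closed f g c by auto
  ultimately show "endpoint S T x' a' \<lless>\<^bsub>T\<^esub> endpoint S T x a"
    using T.leq_way_below_trans T.way_below_leq_trans by blast
qed

text \<open>Way-below elements leave room to insert an endpoint between them, so a Cu-morphism into the
  internal hom is determined by its endpoints.\<close>

lemma cu_morphism_leq_if_endpoint_leq:
  assumes A: "cu_semigroup A" and \<alpha>: "\<alpha> \<in> cu_morphisms A (internal_hom S T)"
    and \<beta>: "\<beta> \<in> cu_morphisms A (internal_hom S T)"
    and leq: "\<And>u a. u \<in> carrier A \<Longrightarrow> a \<in> carrier S \<Longrightarrow> endpoint S T (\<alpha> u) a \<preceq>\<^bsub>T\<^esub> endpoint S T (\<beta> u) a"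
    and u: "u \<in> carrier A"
  shows "\<alpha> u \<preceq>\<^bsub>internal_hom S T\<^esub> \<beta> u"
proof -
  interpret A: cu_semigroup A by (rule A)
  note a = gen_cu_morphismD[OF cu_morphismD(1)[OF \<alpha>]] and b = gen_cu_morphismD[OF cu_morphismD(1)[OF \<beta>]]
  obtain c where c: "\<And>n. c n \<lless>\<^bsub>A\<^esub> c (Suc n)" "increasing A c" "is_supremum A (range c) u"
    using A.way_below_chain_obtains[OF u] by metis
  have cA: "c n \<in> carrier A" for n using c(2) by (simp add: increasing_def)
  have "\<alpha> (c n) \<preceq>\<^bsub>internal_hom S T\<^esub> \<beta> u" for n
  proof -
    obtain g where g: "g \<in> paths S T" "\<alpha> (c n) = path_class S T g"
      using internal_hom_carrierE[OF a(2)[OF cA]] .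
    obtain f where f: "f \<in> paths S T" "\<alpha> (c (Suc n)) = path_class S T f"
      using internal_hom_carrierE[OF a(2)[OF cA]] .
    obtain h' where h': "h' \<in> paths S T" "\<beta> (c (Suc n)) = path_class S T h'"
      using internal_hom_carrierE[OF b(2)[OF cA]] .
    obtain h where h: "h \<in> paths S T" "\<beta> (c (Suc (Suc n))) = path_class S T h"
      using internal_hom_carrierE[OF b(2)[OF cA]] .
    obtain m where m: "m \<in> IQ" "\<And>l. l \<in> IQ \<Longrightarrow> g l \<prec> f m"
      using cu_morphismD(2)[OF \<alpha> c(1)[of n]] internal_hom_way_below_iff[OF g(1) f(1)] g(2) f(2) by auto
    obtain k where k: "k \<in> IQ" "\<And>l. l \<in> IQ \<Longrightarrow> h' l \<prec> h k"
      using cu_morphismD(2)[OF \<beta> c(1)[of "Suc n"]] internal_hom_way_below_iff[OF h'(1) h(1)] h'(2) h(2)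
      by auto
    \<comment> \<open>The way-below steps of \<alpha> and \<beta> make room on both sides: f m is
      below the endpoint of \<alpha> (c (n + 1)), hence below that of \<beta> (c (n + 1)), which is
      below the single value h k of a path for \<beta> (c (n + 2)).\<close>
    have "f m a \<preceq>\<^bsub>T\<^esub> h k a" if a: "a \<in> carrier S" for a
    proof -
      have 1: "f m a \<preceq>\<^bsub>T\<^esub> endpoint S T (\<alpha> (c (Suc n))) a"
        unfolding f(2) by (rule endpoint_upper[OF f(1) a m(1)])
      have 2: "endpoint S T (\<alpha> (c (Suc n))) a \<preceq>\<^bsub>T\<^esub> endpoint S T (\<beta> (c (Suc n))) a"
        by (rule leq[OF cA a])
      have 3: "endpoint S T (\<beta> (c (Suc n))) a \<preceq>\<^bsub>T\<^esub> h k a"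
        unfolding h'(2)
        by (rule endpoint_least[OF h'(1) a path_value_closed[OF h(1) k(1) a]])
          (rule mor_prec_leq[OF k(2) pathsD(1)[OF h'(1)] pathsD(1)[OF h(1) k(1)] a])
      have cl: "endpoint S T (\<alpha> (c (Suc n))) a \<in> carrier T" "endpoint S T (\<beta> (c (Suc n))) a \<in> carrier T"
        using endpoint_closed f h' a by auto
      show ?thesis
        by (rule T.leq_trans[OF 1 T.leq_trans[OF 2 3]])
          (simp_all add: cl path_value_closed f(1) h(1) m(1) k(1) a)
    qed
    then have "g l \<prec> h k" if "l \<in> IQ" for l
      by (intro mor_prec_leq_trans[OF m(2)[OF that]] pathsD(1)[OF h(1) k(1)])
    then have "path_lesssim S T g h" unfolding path_lesssim_def using k(1) by blast
    then have "\<alpha> (c n) \<preceq>\<^bsub>internal_hom S T\<^esub> \<beta> (c (Suc (Suc n)))"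
      using g h by (simp add: internal_hom_leq_iff)
    moreover have "\<beta> (c (Suc (Suc n))) \<preceq>\<^bsub>internal_hom S T\<^esub> \<beta> u"
      using c(3) by (intro b(5) cA u) (auto simp: is_supremum_def)
    ultimately show ?thesis using IH.leq_trans a(2) b(2) cA u by blast
  qed
  then show ?thesis using a(6)[OF c(2,3)] b(2)[OF u] by (auto simp: is_supremum_def)
qed

end

lemma internal_hom_is_cu_semigroup:
  "cu_semigroup S \<Longrightarrow> cu_semigroup T \<Longrightarrow> cu_semigroup (internal_hom S T)"
  by (rule hom_model.internal_hom_cu_semigroup) (simp add: hom_model_def)

section \<open>Pointwise composition of paths\<close>

definition path_comp :: "'a po_monoid \<Rightarrow> (rat \<Rightarrow> 'b \<Rightarrow> 'c) \<Rightarrow> (rat \<Rightarrow> 'a \<Rightarrow> 'b) \<Rightarrow> rat \<Rightarrow> 'a \<Rightarrow> 'c" where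
  "path_comp S f g = (\<lambda>l\<in>IQ. compose (carrier S) (f l) (g l))"

definition class_comp ::
    "'a po_monoid \<Rightarrow> 'c po_monoid \<Rightarrow> (rat \<Rightarrow> 'b \<Rightarrow> 'c) set \<Rightarrow> (rat \<Rightarrow> 'a \<Rightarrow> 'b) set \<Rightarrow> (rat \<Rightarrow> 'a \<Rightarrow> 'c) set" where
  "class_comp S P y x = path_class S P (path_comp S (SOME f. f \<in> y) (SOME g. g \<in> x))"

locale composition_model = ST: hom_model S T + TP: hom_model T P + SP: hom_model S P
  for S :: "'a po_monoid" and T :: "'b po_monoid" and P :: "'c po_monoid"
begin

lemma path_comp_prec:
  assumes "mor_prec T P \<phi> \<phi>'" "mor_prec S T \<psi> \<psi>'"
  shows "mor_prec S P (compose (carrier S) \<phi> \<psi>) (compose (carrier S) \<phi>' \<psi>')"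
  using assms ST.S.way_below_carrier unfolding mor_prec_def compose_def by simp

lemma path_comp_path:
  assumes "f \<in> paths T P" "g \<in> paths S T"
  shows "path_comp S f g \<in> paths S P"
  using pathsD[OF assms(1)] pathsD[OF assms(2)]
  by (auto simp: paths_def path_comp_def
      intro!: path_comp_prec gen_cu_morphism_compose[OF ST.S.cu_semigroup_axioms])

lemma path_comp_lesssim:
  assumes f: "f \<in> paths T P" "f' \<in> paths T P" "path_lesssim T P f f'"
    and g: "g \<in> paths S T" "g' \<in> paths S T" "path_lesssim S T g g'"
  shows "path_lesssim S P (path_comp S f g) (path_comp S f' g')"
  unfolding path_lesssim_def
proof (intro ballI)
  fix l assume l: "l \<in> IQ"
  obtain m where m: "m \<in> IQ" "mor_prec T P (f l) (f' m)" using f(3) l unfolding path_lesssim_def by blast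
  obtain n where n: "n \<in> IQ" "mor_prec S T (g l) (g' n)" using g(3) l unfolding path_lesssim_def by blast
  have k: "max m n \<in> IQ" using m n by (simp add: max_def)
  have "mor_prec T P (f l) (f' (max m n))"
    using TP.mor_prec_path_mono[OF f(2) m(2,1) k] by simp
  moreover have "mor_prec S T (g l) (g' (max m n))"
    using ST.mor_prec_path_mono[OF g(2) n(2,1) k] by simp
  ultimately have "mor_prec S P (path_comp S f g l) (path_comp S f' g' (max m n))"
    using l k by (simp add: path_comp_def path_comp_prec)
  then show "\<exists>m\<in>IQ. mor_prec S P (path_comp S f g l) (path_comp S f' g' m)" using k by blast
qed

text \<open>The representatives picked in \<open>class_comp\<close> do not matter, since composition
  respects the path preorder in both arguments.\<close>

lemma class_comp_path_class:
  assumes f: "f \<in> paths T P" and g: "g \<in> paths S T"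
  shows "class_comp S P (path_class T P f) (path_class S T g) = path_class S P (path_comp S f g)"
proof -
  have "(SOME f'. f' \<in> path_class T P f) \<in> path_class T P f"
    using TP.path_class_self[OF f] by (rule someI[where P = "\<lambda>f'. f' \<in> path_class T P f"])
  moreover have "(SOME g'. g' \<in> path_class S T g) \<in> path_class S T g"
    using ST.path_class_self[OF g] by (rule someI[where P = "\<lambda>g'. g' \<in> path_class S T g"])
  moreover have "path_class S P (path_comp S f' g') = path_class S P (path_comp S f g)"
    if "f' \<in> path_class T P f" "g' \<in> path_class S T g" for f' g'
    using that f g by (intro SP.path_class_eqI path_comp_path path_comp_lesssim) (auto simp: path_class_def)
  ultimately show ?thesis unfolding class_comp_def by blast
qed

text \<open>Each clause reduces to composition of maps at a common time; times belonging to the two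
  factors are raised to their maximum.\<close>

lemma class_comp_bimorphism:
  "cu_bimorphism (internal_hom T P) (internal_hom S T) (internal_hom S P) (class_comp S P)"
  unfolding cu_bimorphism_def
proof (intro conjI ballI allI impI)
  fix y x assume yx: "y \<in> carrier (internal_hom T P)" "x \<in> carrier (internal_hom S T)"
  obtain f where f: "f \<in> paths T P" "y = path_class T P f" using TP.internal_hom_carrierE[OF yx(1)] .
  obtain g where g: "g \<in> paths S T" "x = path_class S T g" using ST.internal_hom_carrierE[OF yx(2)] .
  show "class_comp S P y x \<in> carrier (internal_hom S P)"
    unfolding f(2) g(2) class_comp_path_class[OF f(1) g(1)]
    by (rule SP.path_class_closed[OF path_comp_path[OF f(1) g(1)]])
next
  fix y y' x assume yx: "y \<in> carrier (internal_hom T P)" "y' \<in> carrier (internal_hom T P)"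
    "x \<in> carrier (internal_hom S T)"
  obtain f where f: "f \<in> paths T P" "y = path_class T P f" using TP.internal_hom_carrierE[OF yx(1)] .
  obtain f' where f': "f' \<in> paths T P" "y' = path_class T P f'" using TP.internal_hom_carrierE[OF yx(2)] .
  obtain g where g: "g \<in> paths S T" "x = path_class S T g" using ST.internal_hom_carrierE[OF yx(3)] .
  have "path_comp S (path_add T P f f') g = path_add S P (path_comp S f g) (path_comp S f' g)"
    by (auto simp: path_comp_def path_add_def compose_def fun_eq_iff
        gen_cu_morphismD(2)[OF pathsD(1)[OF g(1)]])
  then show "class_comp S P (y \<oplus>\<^bsub>internal_hom T P\<^esub> y') x =
      class_comp S P y x \<oplus>\<^bsub>internal_hom S P\<^esub> class_comp S P y' x"
    unfolding f(2) f'(2) g(2)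
    by (simp add: f(1) f'(1) g(1) TP.internal_hom_add SP.internal_hom_add class_comp_path_class
        TP.path_add_path path_comp_path)
  show "class_comp S P y' x \<preceq>\<^bsub>internal_hom S P\<^esub> class_comp S P y x" if "y' \<preceq>\<^bsub>internal_hom T P\<^esub> y"
    \<comment> \<open>Reflexivity of the path preorder at g, read off from inclusion of ideals; g l
      \<prec> g l itself may fail.\<close>
    using that f f' g ST.path_lesssim_iff[OF g(1) g(1)]
    by (simp add: TP.internal_hom_leq_iff SP.internal_hom_leq_iff class_comp_path_class
        path_comp_path path_comp_lesssim)
next
  fix y x x' assume yx: "y \<in> carrier (internal_hom T P)" "x \<in> carrier (internal_hom S T)"
    "x' \<in> carrier (internal_hom S T)"
  obtain f where f: "f \<in> paths T P" "y = path_class T P f" using TP.internal_hom_carrierE[OF yx(1)] .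
  obtain g where g: "g \<in> paths S T" "x = path_class S T g" using ST.internal_hom_carrierE[OF yx(2)] .
  obtain g' where g': "g' \<in> paths S T" "x' = path_class S T g'" using ST.internal_hom_carrierE[OF yx(3)] .
  have "path_comp S f (path_add S T g g') = path_add S P (path_comp S f g) (path_comp S f g')"
    by (auto simp: path_comp_def path_add_def compose_def fun_eq_iff
        gen_cu_morphismD(2)[OF pathsD(1)[OF g(1)]] gen_cu_morphismD(2)[OF pathsD(1)[OF g'(1)]]
        gen_cu_morphismD(3)[OF pathsD(1)[OF f(1)]])
  then show "class_comp S P y (x \<oplus>\<^bsub>internal_hom S T\<^esub> x') =
      class_comp S P y x \<oplus>\<^bsub>internal_hom S P\<^esub> class_comp S P y x'"
    unfolding f(2) g(2) g'(2)
    by (simp add: f(1) g(1) g'(1) ST.internal_hom_add SP.internal_hom_add class_comp_path_class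
        ST.path_add_path path_comp_path)
  show "class_comp S P y x' \<preceq>\<^bsub>internal_hom S P\<^esub> class_comp S P y x" if "x' \<preceq>\<^bsub>internal_hom S T\<^esub> x"
    using that f g g' TP.path_lesssim_iff[OF f(1) f(1)]
    by (simp add: ST.internal_hom_leq_iff SP.internal_hom_leq_iff class_comp_path_class
        path_comp_path path_comp_lesssim)
next
  fix x assume x: "x \<in> carrier (internal_hom S T)"
  obtain g where g: "g \<in> paths S T" "x = path_class S T g" using ST.internal_hom_carrierE[OF x] .
  have "path_comp S (\<lambda>l\<in>IQ. \<lambda>a\<in>carrier T. \<zero>\<^bsub>P\<^esub>) g = (\<lambda>l\<in>IQ. \<lambda>a\<in>carrier S. \<zero>\<^bsub>P\<^esub>)"
    by (auto simp: path_comp_def compose_def fun_eq_iff gen_cu_morphismD(2)[OF pathsD(1)[OF g(1)]])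
  then show "class_comp S P \<zero>\<^bsub>internal_hom T P\<^esub> x = \<zero>\<^bsub>internal_hom S P\<^esub>"
    by (simp add: g TP.internal_hom_zero SP.internal_hom_zero class_comp_path_class TP.zero_path)
next
  fix y assume y: "y \<in> carrier (internal_hom T P)"
  obtain f where f: "f \<in> paths T P" "y = path_class T P f" using TP.internal_hom_carrierE[OF y] .
  have "path_comp S f (\<lambda>l\<in>IQ. \<lambda>a\<in>carrier S. \<zero>\<^bsub>T\<^esub>) = (\<lambda>l\<in>IQ. \<lambda>a\<in>carrier S. \<zero>\<^bsub>P\<^esub>)"
    by (auto simp: path_comp_def compose_def fun_eq_iff gen_cu_morphismD(4)[OF pathsD(1)[OF f(1)]])
  then show "class_comp S P y \<zero>\<^bsub>internal_hom S T\<^esub> = \<zero>\<^bsub>internal_hom S P\<^esub>"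
    by (simp add: f ST.internal_hom_zero SP.internal_hom_zero class_comp_path_class ST.zero_path)
next
  fix c d s t
  assume a: "increasing (internal_hom T P) c \<and> increasing (internal_hom S T) d \<and>
    is_supremum (internal_hom T P) (range c) s \<and> is_supremum (internal_hom S T) (range d) t"
  have cl: "c n \<in> carrier (internal_hom T P)" "d n \<in> carrier (internal_hom S T)" for n
    using a by (auto simp: increasing_def)
  have st: "s \<in> carrier (internal_hom T P)" "t \<in> carrier (internal_hom S T)"
    using a by (auto simp: is_supremum_def)
  obtain F where F: "\<And>n. F n \<in> paths T P" "c = (\<lambda>n. path_class T P (F n))"
    by (rule TP.internal_hom_seqE[of c, OF cl(1)]) blast
  obtain G where G: "\<And>n. G n \<in> paths S T" "d = (\<lambda>n. path_class S T (G n))"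
    by (rule ST.internal_hom_seqE[of d, OF cl(2)]) blast
  obtain f where f: "f \<in> paths T P" "s = path_class T P f" using TP.internal_hom_carrierE[OF st(1)] .
  obtain g where g: "g \<in> paths S T" "t = path_class S T g" using ST.internal_hom_carrierE[OF st(2)] .
  have Ff: "path_lesssim T P (F n) f" for n
    using a f F TP.internal_hom_leq_iff by (auto simp: is_supremum_def)
  have Gg: "path_lesssim S T (G n) g" for n
    using a g G ST.internal_hom_leq_iff by (auto simp: is_supremum_def)
  have FF: "path_lesssim T P (F i) (F j)" if "i \<le> j" for i j
    using TP.internal_hom_increasing_leq[of c i j] a that F by (simp add: TP.internal_hom_leq_iff)
  have GG: "path_lesssim S T (G i) (G j)" if "i \<le> j" for i j
    using ST.internal_hom_increasing_leq[of d i j] a that G by (simp add: ST.internal_hom_leq_iff)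
  have "is_supremum (internal_hom S P) (range (\<lambda>n. path_class S P (path_comp S (F n) (G n))))
      (path_class S P (path_comp S f g))"
  proof (rule SP.internal_hom_supremumI)
    show "\<exists>n. \<exists>m\<in>IQ. mor_prec S P (path_comp S f g l) (path_comp S (F n) (G n) m)" if l: "l \<in> IQ" for l
    proof -
      obtain i m where i: "m \<in> IQ" "mor_prec T P (f l) (F i m)"
        using TP.internal_hom_supremumD[where F = F, OF F(1) f(1) _ _ l] a F(2) f(2) by auto
      obtain j n where j: "n \<in> IQ" "mor_prec S T (g l) (G j n)"
        using ST.internal_hom_supremumD[where F = G, OF G(1) g(1) _ _ l] a G(2) g(2) by auto
      \<comment> \<open>Two alignments are needed: first the indices in the two sequences, then,
        after moving to the common index, the times in the two paths.\<close>
      let ?k = "max i j"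
      obtain m' where m': "m' \<in> IQ" "mor_prec T P (F i m) (F ?k m')"
        using FF[of i ?k] i(1) unfolding path_lesssim_def by auto
      obtain n' where n': "n' \<in> IQ" "mor_prec S T (G j n) (G ?k n')"
        using GG[of j ?k] j(1) unfolding path_lesssim_def by auto
      have q: "max m' n' \<in> IQ" using m' n' by (simp add: max_def)
      have "mor_prec T P (f l) (F ?k (max m' n'))"
        using TP.mor_prec_path_mono[OF F(1) TP.mor_prec_trans[OF i(2) m'(2)] m'(1) q] by simp
      moreover have "mor_prec S T (g l) (G ?k (max m' n'))"
        using ST.mor_prec_path_mono[OF G(1) ST.mor_prec_trans[OF j(2) n'(2)] n'(1) q] by simp
      ultimately have "mor_prec S P (path_comp S f g l) (path_comp S (F ?k) (G ?k) (max m' n'))"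
        using l q by (simp add: path_comp_def path_comp_prec)
      then show ?thesis using q by blast
    qed
  qed (intro path_comp_path path_comp_lesssim F G f g Ff Gg)+
  then show "is_supremum (internal_hom S P) (range (\<lambda>k. class_comp S P (c k) (d k))) (class_comp S P s t)"
    by (simp add: F G f g class_comp_path_class)
next
  fix y' y x' x assume wb: "y' \<lless>\<^bsub>internal_hom T P\<^esub> y \<and> x' \<lless>\<^bsub>internal_hom S T\<^esub> x"
  then have c: "y' \<in> carrier (internal_hom T P)" "y \<in> carrier (internal_hom T P)"
    "x' \<in> carrier (internal_hom S T)" "x \<in> carrier (internal_hom S T)" by (auto simp: way_below_def)
  obtain f' where f': "f' \<in> paths T P" "y' = path_class T P f'" using TP.internal_hom_carrierE[OF c(1)] .
  obtain f where f: "f \<in> paths T P" "y = path_class T P f" using TP.internal_hom_carrierE[OF c(2)] .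
  obtain g' where g': "g' \<in> paths S T" "x' = path_class S T g'" using ST.internal_hom_carrierE[OF c(3)] .
  obtain g where g: "g \<in> paths S T" "x = path_class S T g" using ST.internal_hom_carrierE[OF c(4)] .
  obtain m where m: "m \<in> IQ" "\<And>l. l \<in> IQ \<Longrightarrow> mor_prec T P (f' l) (f m)"
    using wb f f' TP.internal_hom_way_below_iff by auto
  obtain n where n: "n \<in> IQ" "\<And>l. l \<in> IQ \<Longrightarrow> mor_prec S T (g' l) (g n)"
    using wb g g' ST.internal_hom_way_below_iff by auto
  have q: "max m n \<in> IQ" using m n by (simp add: max_def)
  have "mor_prec S P (path_comp S f' g' l) (path_comp S f g (max m n))" if l: "l \<in> IQ" for l
    using TP.mor_prec_path_mono[OF f(1) m(2)[OF l] m(1) q] ST.mor_prec_path_mono[OF g(1) n(2)[OF l] n(1) q]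
      l q by (simp add: path_comp_def path_comp_prec)
  then show "class_comp S P y' x' \<lless>\<^bsub>internal_hom S P\<^esub> class_comp S P y x"
    using q by (auto simp: f f' g g' class_comp_path_class SP.internal_hom_way_below_iff path_comp_path)
qed

text \<open>The right-hand side is the supremum of f l (g n a) over all pairs of times, the
  left-hand side that over equal times. The diagonal is cofinal by monotonicity, and continuity of
  the endpoint of y exchanges the two suprema.\<close>

lemma endpoint_class_comp:
  assumes y: "y \<in> carrier (internal_hom T P)" and x: "x \<in> carrier (internal_hom S T)" and a: "a \<in> carrier S"
  shows "endpoint S P (class_comp S P y x) a = endpoint T P y (endpoint S T x a)"
proof -
  obtain f where f: "f \<in> paths T P" "y = path_class T P f" using TP.internal_hom_carrierE[OF y] .
  obtain g where g: "g \<in> paths S T" "x = path_class S T g" using ST.internal_hom_carrierE[OF x] .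
  have fg: "path_comp S f g \<in> paths S P" by (rule path_comp_path[OF f(1) g(1)])
  have ga: "g l a \<in> carrier T" if "l \<in> IQ" for l using ST.path_value_closed[OF g(1) that a] .
  have xa: "endpoint S T x a \<in> carrier T" using ST.endpoint_closed g a by simp
  have fga: "path_comp S f g l a = f l (g l a)" if "l \<in> IQ" for l
    using that a by (simp add: path_comp_def compose_def)
  have e: "endpoint T P y b \<in> carrier P" if "b \<in> carrier T" for b
    using TP.endpoint_closed f that by simp
  have ea: "endpoint S P (class_comp S P y x) a \<in> carrier P"
    using SP.endpoint_closed[OF fg a] by (simp add: f g class_comp_path_class)
  have "endpoint S P (class_comp S P y x) a \<preceq>\<^bsub>P\<^esub> endpoint T P y (endpoint S T x a)"
    unfolding f(2) g(2) class_comp_path_class[OF f(1) g(1)]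
  proof (rule SP.endpoint_least[OF fg a])
    show "endpoint T P (path_class T P f) (endpoint S T (path_class S T g) a) \<in> carrier P"
      using e[OF xa] f g by simp
    fix l assume l: "l \<in> IQ"
    have 1: "f l (g l a) \<preceq>\<^bsub>P\<^esub> endpoint T P y (g l a)"
      using TP.endpoint_upper[OF f(1) ga[OF l] l] f(2) by simp
    have 2: "endpoint T P y (g l a) \<preceq>\<^bsub>P\<^esub> endpoint T P y (endpoint S T x a)"
      unfolding f(2) using ST.endpoint_upper[OF g(1) a l] g(2)
      by (intro TP.endpoint_mono[OF f(1) ga[OF l] xa]) simp
    show "path_comp S f g l a \<preceq>\<^bsub>P\<^esub> endpoint T P (path_class T P f) (endpoint S T (path_class S T g) a)"
      using TP.T.leq_trans[OF 1 2] TP.path_value_closed[OF f(1) l ga[OF l]] e ga[OF l] xa f(2) g(2)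
      by (simp add: fga[OF l])
  qed
  moreover have "endpoint T P y (endpoint S T x a) \<preceq>\<^bsub>P\<^esub> endpoint S P (class_comp S P y x) a"
  proof -
    have sup: "is_supremum P (range (\<lambda>n. endpoint T P y (g (ST.level n) a))) (endpoint T P y (endpoint S T x a))"
      using gen_cu_bimorphismD(8)[OF cu_bimorphism_gen[OF TP.endpoint_bimorphism]
          TP.IH.increasing_const[OF y] ST.path_levels_increasing[OF g(1) a]
          TP.IH.is_supremum_const[OF y] ST.endpoint_levels[OF g(1) a]] g(2) by simp
    have "endpoint T P y (g n a) \<preceq>\<^bsub>P\<^esub> endpoint S P (class_comp S P y x) a" if n: "n \<in> IQ" for n
      unfolding f(2)
    proof (rule TP.endpoint_least[OF f(1) ga[OF n]])
      show "endpoint S P (class_comp S P (path_class T P f) x) a \<in> carrier P" using ea f(2) by simp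
      fix l assume l: "l \<in> IQ"
      \<comment> \<open>The diagonal entry that dominates f l (g n a).\<close>
      let ?k = "max l n"
      have k: "?k \<in> IQ" using l n by (simp add: max_def)
      have 1: "f l (g n a) \<preceq>\<^bsub>P\<^esub> f ?k (g n a)" using TP.path_leq[OF f(1) l k _ ga[OF n]] by simp
      have 2: "f ?k (g n a) \<preceq>\<^bsub>P\<^esub> f ?k (g ?k a)"
        using gen_cu_morphismD(5)[OF pathsD(1)[OF f(1) k] ga[OF n] ga[OF k]] ST.path_leq[OF g(1) n k _ a] by simp
      have 3: "f ?k (g ?k a) \<preceq>\<^bsub>P\<^esub> endpoint S P (class_comp S P y x) a"
        using SP.endpoint_upper[OF fg a k] by (simp add: f g class_comp_path_class fga[OF k])
      show "f l (g n a) \<preceq>\<^bsub>P\<^esub> endpoint S P (class_comp S P (path_class T P f) x) a"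
        unfolding f(2)[symmetric]
        by (rule TP.T.leq_trans[OF 1 TP.T.leq_trans[OF 2 3]])
          (simp_all add: TP.path_value_closed[OF f(1)] ga l n k ea)
    qed
    then show ?thesis using sup ea ST.level_IQ by (auto simp: is_supremum_def)
  qed
  ultimately show ?thesis using TP.T.leq_antisym ea e xa by blast
qed

end

section \<open>The composition product\<close>


lemma hom_tensor_properties:
  assumes A: "cu_semigroup A" and S: "cu_semigroup S" and P: "cu_semigroup P"
    and \<alpha>: "\<alpha> \<in> cu_morphisms A (internal_hom S P)"
  shows "hom_tensor A S P \<alpha> \<in> cu_morphisms (tensor_product A S) P"
    and "u \<in> carrier A \<Longrightarrow> s \<in> carrier S \<Longrightarrow>
      hom_tensor A S P \<alpha> (pure_tensor A S u s) = endpoint S P (\<alpha> u) s"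
proof -
  interpret hom_model S P using S P by (simp add: hom_model_def)
  have "cu_bimorphism A S P (\<lambda>u s. endpoint S P (\<alpha> u) ((\<lambda>s\<in>carrier S. s) s))"
    by (rule cu_bimorphism_comp[OF endpoint_bimorphism \<alpha> cu_morphism_id[OF S]])
  then have "cu_bimorphism A S P (\<lambda>u s. endpoint S P (\<alpha> u) s)"
    by (rule cu_bimorphism_cong[OF A S]) simp
  from theI'[OF tensor_product_lift[OF A S P this], folded hom_tensor_def]
  show "hom_tensor A S P \<alpha> \<in> cu_morphisms (tensor_product A S) P"
    "u \<in> carrier A \<Longrightarrow> s \<in> carrier S \<Longrightarrow>
      hom_tensor A S P \<alpha> (pure_tensor A S u s) = endpoint S P (\<alpha> u) s"
    by blast+
qed

text \<open>Equal images have equal endpoints on pure tensors, and endpoints determine a Cu-morphism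
  into the internal hom. Injectivity is what makes \<open>the_inv_into\<close> return the intended
  preimage.\<close>

lemma hom_tensor_inj:
  assumes A: "cu_semigroup A" and S: "cu_semigroup S" and P: "cu_semigroup P"
  shows "inj_on (hom_tensor A S P) (cu_morphisms A (internal_hom S P))"
proof (rule inj_onI)
  interpret hom_model S P using S P by (simp add: hom_model_def)
  fix \<alpha> \<beta>
  assume \<alpha>: "\<alpha> \<in> cu_morphisms A (internal_hom S P)" and \<beta>: "\<beta> \<in> cu_morphisms A (internal_hom S P)"
    and eq: "hom_tensor A S P \<alpha> = hom_tensor A S P \<beta>"
  have ends: "endpoint S P (\<alpha> u) s = endpoint S P (\<beta> u) s" if "u \<in> carrier A" "s \<in> carrier S" for u s
    using hom_tensor_properties(2)[OF A S P \<alpha> that] hom_tensor_properties(2)[OF A S P \<beta> that] eq by simp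
  have closed: "endpoint S P (\<beta> u) s \<in> carrier P" if "u \<in> carrier A" "s \<in> carrier S" for u s
    using gen_cu_bimorphismD(1)[OF cu_bimorphism_gen[OF endpoint_bimorphism]
        gen_cu_morphismD(2)[OF cu_morphismD(1)[OF \<beta>]]] that .
  show "\<alpha> = \<beta>"
  proof (rule gen_cu_morphism_eqI[OF IH.cu_semigroup_axioms cu_morphismD(1)[OF \<alpha>] cu_morphismD(1)[OF \<beta>]])
    fix u assume u: "u \<in> carrier A"
    show "\<alpha> u \<preceq>\<^bsub>internal_hom S P\<^esub> \<beta> u"
      by (rule cu_morphism_leq_if_endpoint_leq[OF A \<alpha> \<beta> _ u]) (simp add: ends closed T.leq_refl)
    show "\<beta> u \<preceq>\<^bsub>internal_hom S P\<^esub> \<alpha> u"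
      by (rule cu_morphism_leq_if_endpoint_leq[OF A \<beta> \<alpha> _ u]) (simp add: ends closed T.leq_refl)
  qed
qed

lemma evaluation_properties:
  assumes S: "cu_semigroup S" and T: "cu_semigroup T"
  shows "evaluation S T \<in> cu_morphisms (tensor_product (internal_hom S T) S) T"
    and "x \<in> carrier (internal_hom S T) \<Longrightarrow> a \<in> carrier S \<Longrightarrow>
      evaluation S T (pure_tensor (internal_hom S T) S x a) = endpoint S T x a"
proof -
  note I = internal_hom_is_cu_semigroup[OF S T]
  note props = hom_tensor_properties[OF I S T cu_morphism_id[OF I]]
  show "evaluation S T \<in> cu_morphisms (tensor_product (internal_hom S T) S) T"
    unfolding evaluation_def by (rule props(1))
  show "evaluation S T (pure_tensor (internal_hom S T) S x a) = endpoint S T x a"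
    if "x \<in> carrier (internal_hom S T)" "a \<in> carrier S"
    unfolding evaluation_def using props(2)[OF that] that by simp
qed

lemma tensor_map_properties:
  assumes S: "cu_semigroup S" and T: "cu_semigroup T" and S': "cu_semigroup S'" and T': "cu_semigroup T'"
    and \<alpha>: "\<alpha> \<in> cu_morphisms S S'" and \<beta>: "\<beta> \<in> cu_morphisms T T'"
  shows "tensor_map S T S' T' \<alpha> \<beta> \<in> cu_morphisms (tensor_product S T) (tensor_product S' T')"
    and "a \<in> carrier S \<Longrightarrow> b \<in> carrier T \<Longrightarrow>
      tensor_map S T S' T' \<alpha> \<beta> (pure_tensor S T a b) = pure_tensor S' T' (\<alpha> a) (\<beta> b)"
proof -
  have "cu_bimorphism S T (tensor_product S' T') (\<lambda>a b. pure_tensor S' T' (\<alpha> a) (\<beta> b))"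
    by (rule cu_bimorphism_comp[OF pure_tensor_bimorphism[OF S' T'] \<alpha> \<beta>])
  from theI'[OF tensor_product_lift[OF S T tensor_product_cu_semigroup[OF S' T'] this], folded tensor_map_def]
  show "tensor_map S T S' T' \<alpha> \<beta> \<in> cu_morphisms (tensor_product S T) (tensor_product S' T')"
    "a \<in> carrier S \<Longrightarrow> b \<in> carrier T \<Longrightarrow>
      tensor_map S T S' T' \<alpha> \<beta> (pure_tensor S T a b) = pure_tensor S' T' (\<alpha> a) (\<beta> b)"
    by blast+
qed

text \<open>For fixed \<open>z\<close>, the map \<open>u \<mapsto> \<gamma> (u \<otimes> z)\<close> preserves suprema but not the way-below relation; this is
  why pure tensors have to determine generalized Cu-morphisms.\<close>

lemma triple_tensor_eq:
  assumes X: "cu_semigroup X" and Y: "cu_semigroup Y" and Z: "cu_semigroup Z" and P: "cu_semigroup P"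
    and \<gamma>: "\<gamma> \<in> cu_morphisms (tensor_product (tensor_product X Y) Z) P"
    and \<phi>: "cu_bimorphism (tensor_product X Y) Z P \<phi>"
    and eq: "\<And>x y z. x \<in> carrier X \<Longrightarrow> y \<in> carrier Y \<Longrightarrow> z \<in> carrier Z \<Longrightarrow>
      \<gamma> (pure_tensor (tensor_product X Y) Z (pure_tensor X Y x y) z) = \<phi> (pure_tensor X Y x y) z"
    and u: "u \<in> carrier (tensor_product X Y)" and z: "z \<in> carrier Z"
  shows "\<gamma> (pure_tensor (tensor_product X Y) Z u z) = \<phi> u z"
proof -
  let ?U = "tensor_product X Y"
  have U: "cu_semigroup ?U" by (rule tensor_product_cu_semigroup[OF X Y])
  have \<gamma>': "cu_bimorphism ?U Z P (\<lambda>u z. \<gamma> (pure_tensor ?U Z u z))"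
    by (rule cu_bimorphism_post[OF tensor_product_cu_semigroup[OF U Z] pure_tensor_bimorphism[OF U Z] \<gamma>])
  have "(\<lambda>u\<in>carrier ?U. \<gamma> (pure_tensor ?U Z u z)) = (\<lambda>u\<in>carrier ?U. \<phi> u z)"
    by (rule tensor_product_gen_cu_morphism_eq[OF X Y P
          gen_cu_bimorphism_left[OF U Z cu_bimorphism_gen[OF \<gamma>'] z]
          gen_cu_bimorphism_left[OF U Z cu_bimorphism_gen[OF \<phi>] z]])
      (simp add: pure_tensor_closed[OF X Y] eq z)
  from fun_cong[OF this, of u] show ?thesis using u by simp
qed

text \<open>Existence: the trilinear lift gives a bimorphism on (X \<otimes> Y) and Z, which is
  lifted once more. Uniqueness: \<open>triple_tensor_eq\<close> extends agreement on triple tensors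
  to a general first factor u.\<close>

lemma tensor_assoc_properties:
  assumes X: "cu_semigroup X" and Y: "cu_semigroup Y" and Z: "cu_semigroup Z"
  shows "tensor_assoc X Y Z \<in> cu_morphisms (tensor_product (tensor_product X Y) Z)
      (tensor_product X (tensor_product Y Z))" (is "_ \<in> cu_morphisms ?L ?R")
    and "x \<in> carrier X \<Longrightarrow> y \<in> carrier Y \<Longrightarrow> z \<in> carrier Z \<Longrightarrow>
      tensor_assoc X Y Z (pure_tensor (tensor_product X Y) Z (pure_tensor X Y x y) z) =
      pure_tensor X (tensor_product Y Z) x (pure_tensor Y Z y z)"
proof -
  let ?U = "tensor_product X Y" and ?V = "tensor_product Y Z"
  have U: "cu_semigroup ?U" by (rule tensor_product_cu_semigroup[OF X Y])
  have V: "cu_semigroup ?V" by (rule tensor_product_cu_semigroup[OF Y Z])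
  have R: "cu_semigroup ?R" by (rule tensor_product_cu_semigroup[OF X V])
  obtain B where B: "cu_bimorphism ?U Z ?R B"
    "\<And>x y z. x \<in> carrier X \<Longrightarrow> y \<in> carrier Y \<Longrightarrow> z \<in> carrier Z \<Longrightarrow>
      B (pure_tensor X Y x y) z = pure_tensor X ?V x (pure_tensor Y Z y z)"
    by (rule tensor_product_trilinear_lift[OF X Y V Z R pure_tensor_bimorphism[OF X V]
          pure_tensor_bimorphism[OF Y Z]]) blast
  obtain \<gamma> where \<gamma>: "\<gamma> \<in> cu_morphisms ?L ?R"
    "\<forall>u\<in>carrier ?U. \<forall>z\<in>carrier Z. \<gamma> (pure_tensor ?U Z u z) = B u z"
    using tensor_product_lift[OF U Z R B(1)] by blast
  let ?assoc = "\<lambda>\<gamma>. \<gamma> \<in> cu_morphisms ?L ?R \<and> (\<forall>x\<in>carrier X. \<forall>y\<in>carrier Y. \<forall>z\<in>carrier Z.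
      \<gamma> (pure_tensor ?U Z (pure_tensor X Y x y) z) = pure_tensor X ?V x (pure_tensor Y Z y z))"
  have "\<exists>!\<gamma>. ?assoc \<gamma>"
  proof (rule ex1I)
    show "?assoc \<gamma>" using \<gamma> B(2) pure_tensor_closed[OF X Y] by simp
    fix \<delta> assume \<delta>: "?assoc \<delta>"
    show "\<delta> = \<gamma>"
    proof (rule tensor_product_gen_cu_morphism_eq[OF U Z R])
      show "\<delta> \<in> gen_cu_morphisms ?L ?R" "\<gamma> \<in> gen_cu_morphisms ?L ?R"
        using \<delta> \<gamma>(1) by (simp_all add: cu_morphismD(1))
      show "\<delta> (pure_tensor ?U Z u z) = \<gamma> (pure_tensor ?U Z u z)" if uz: "u \<in> carrier ?U" "z \<in> carrier Z" for u z
      proof -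
        have "\<delta> (pure_tensor ?U Z u z) = B u z"
          by (rule triple_tensor_eq[OF X Y Z R _ B(1) _ uz]) (use \<delta> B(2) in simp_all)
        then show ?thesis using \<gamma>(2) uz by simp
      qed
    qed
  qed
  from theI'[OF this, folded tensor_assoc_def]
  show "tensor_assoc X Y Z \<in> cu_morphisms ?L ?R"
    "x \<in> carrier X \<Longrightarrow> y \<in> carrier Y \<Longrightarrow> z \<in> carrier Z \<Longrightarrow>
      tensor_assoc X Y Z (pure_tensor ?U Z (pure_tensor X Y x y) z) = pure_tensor X ?V x (pure_tensor Y Z y z)"
    by blast+
qed

text \<open>The lift \<kappa> of the concrete composition has the endpoints that the defining map E
  prescribes, by \<open>endpoint_class_comp\<close>. So \<kappa> is a preimage of E under
  \<open>hom_tensor\<close>, and injectivity makes it the value of the inverse.\<close>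

lemma comp_prod_eq_class_comp:
  assumes S: "cu_semigroup S" and T: "cu_semigroup T" and P: "cu_semigroup P"
    and y: "y \<in> carrier (internal_hom T P)" and x: "x \<in> carrier (internal_hom S T)"
  shows "comp_prod S T P y x = class_comp S P y x"
proof -
  interpret composition_model S T P using S T P by (simp add: composition_model_def hom_model_def)
  let ?Y = "internal_hom T P" and ?X = "internal_hom S T" and ?Z = "internal_hom S P"
  let ?A = "tensor_product ?Y ?X" and ?XS = "tensor_product ?X S"
  let ?AS = "tensor_product ?A S" and ?e = "evaluation S T" and ?e' = "evaluation T P"
  have Y: "cu_semigroup ?Y" and X: "cu_semigroup ?X" and Z: "cu_semigroup ?Z"
    using internal_hom_is_cu_semigroup S T P by blast+
  have A: "cu_semigroup ?A" and XS: "cu_semigroup ?XS" and YT: "cu_semigroup (tensor_product ?Y T)"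
    using tensor_product_cu_semigroup X Y S T by blast+
  have AS: "cu_semigroup ?AS" by (rule tensor_product_cu_semigroup[OF A S])
  note e = evaluation_properties[OF S T] and e' = evaluation_properties[OF T P]
  define m where "m = tensor_map ?Y ?XS ?Y T (\<lambda>y\<in>carrier ?Y. y) ?e"
  note m = tensor_map_properties[OF Y XS Y T cu_morphism_id[OF Y] e(1), folded m_def]
  note assoc = tensor_assoc_properties[OF Y X S]
  define E where "E = compose (carrier ?AS) ?e' (compose (carrier ?AS) m (tensor_assoc ?Y ?X S))"
  have E: "E \<in> cu_morphisms ?AS P"
    unfolding E_def
    by (rule cu_morphism_compose[OF AS cu_morphism_compose[OF AS assoc(1) m(1)] e'(1)])
  obtain \<kappa> where \<kappa>: "\<kappa> \<in> cu_morphisms ?A ?Z"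
    "\<forall>y\<in>carrier ?Y. \<forall>x\<in>carrier ?X. \<kappa> (pure_tensor ?Y ?X y x) = class_comp S P y x"
    using tensor_product_lift[OF Y X Z class_comp_bimorphism] by blast
  note ht = hom_tensor_properties[OF A S P \<kappa>(1)]
  have "cu_bimorphism ?A S P (\<lambda>u a. endpoint S P (\<kappa> u) ((\<lambda>a\<in>carrier S. a) a))"
    by (rule cu_bimorphism_comp[OF SP.endpoint_bimorphism \<kappa>(1) cu_morphism_id[OF S]])
  then have endp: "cu_bimorphism ?A S P (\<lambda>u a. endpoint S P (\<kappa> u) a)"
    by (rule cu_bimorphism_cong[OF A S]) simp
  have E_pure: "E (pure_tensor ?A S (pure_tensor ?Y ?X y x) a) = endpoint S P (\<kappa> (pure_tensor ?Y ?X y x)) a"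
    if yxa: "y \<in> carrier ?Y" "x \<in> carrier ?X" "a \<in> carrier S" for y x a
  proof -
    have "?e (pure_tensor ?X S x a) = endpoint S T x a" using e(2) yxa by simp
    moreover have "endpoint S T x a \<in> carrier T"
      using gen_cu_bimorphismD(1)[OF cu_bimorphism_gen[OF ST.endpoint_bimorphism]] yxa by blast
    moreover have "pure_tensor ?A S (pure_tensor ?Y ?X y x) a \<in> carrier ?AS"
      using pure_tensor_closed[OF A S pure_tensor_closed[OF Y X yxa(1,2)] yxa(3)] .
    ultimately show ?thesis
      using yxa assoc(2) m(2) e'(2) pure_tensor_closed[OF X S yxa(2,3)] \<kappa>(2)
      by (simp add: E_def compose_def endpoint_class_comp)
  qed
  \<comment> \<open>\<open>E_pure\<close> covers only pure tensors in the first factor;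
    \<open>triple_tensor_eq\<close> gives agreement at every u in it, as equality of morphisms on
    the tensor product with S demands.\<close>
  have "hom_tensor ?A S P \<kappa> = E"
    by (rule tensor_product_gen_cu_morphism_eq[OF A S P cu_morphismD(1)[OF ht(1)] cu_morphismD(1)[OF E]])
      (simp add: ht(2) triple_tensor_eq[OF Y X S P E endp E_pure])
  then have "tensor_hom ?A S P E = \<kappa>"
    unfolding tensor_hom_def using the_inv_into_f_f[OF hom_tensor_inj[OF A S P] \<kappa>(1)] by simp
  then have "composition_product S T P = \<kappa>"
    by (simp add: composition_product_def Let_def E_def m_def)
  then show ?thesis using \<kappa>(2) y x by (simp add: comp_prod_def)
qed

section \<open>Algebraic laws of the composition product\<close>

context
  fixes S :: "'a po_monoid" and T :: "'b po_monoid"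
  assumes S: "cu_semigroup S" and T: "cu_semigroup T"
begin

interpretation ST: hom_model S T using S T by (simp add: hom_model_def)

lemma comp_prod_bimorphism:
  assumes "cu_semigroup P"
  shows "cu_bimorphism (internal_hom T P) (internal_hom S T) (internal_hom S P) (comp_prod S T P)"
proof -
  interpret composition_model S T P using S T assms by (simp add: composition_model_def hom_model_def)
  show ?thesis
    by (rule cu_bimorphism_cong[OF _ _ class_comp_bimorphism])
      (simp_all add: internal_hom_is_cu_semigroup S T assms comp_prod_eq_class_comp)
qed

lemma comp_prod_path_class:
  assumes P: "cu_semigroup P" and f: "f \<in> paths T P" and g: "g \<in> paths S T"
  shows "comp_prod S T P (path_class T P f) (path_class S T g) = path_class S P (path_comp S f g)"
    and "path_comp S f g \<in> paths S P"
proof -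
  interpret composition_model S T P using S T P by (simp add: composition_model_def hom_model_def)
  show "comp_prod S T P (path_class T P f) (path_class S T g) = path_class S P (path_comp S f g)"
    using comp_prod_eq_class_comp[OF S T P TP.path_class_closed[OF f] ST.path_class_closed[OF g]]
      class_comp_path_class[OF f g] by simp
  show "path_comp S f g \<in> paths S P" by (rule path_comp_path[OF f g])
qed

lemma id_path: "(\<lambda>l\<in>IQ. \<lambda>a\<in>carrier S. a) \<in> paths S S"
proof -
  interpret SS: hom_model S S using S by (simp add: hom_model_def)
  have "mor_prec S S (\<lambda>a\<in>carrier S. a) (\<lambda>a\<in>carrier S. a)"
    using ST.S.way_below_carrier by (simp add: mor_prec_def)
  then show ?thesis by (intro SS.const_path gen_cu_morphism_id S)
qed

text \<open>An equality of functions and not only of classes: paths and their values are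
  extensional, so they agree outside the time set and the carrier as well.\<close>

lemma path_comp_id_right:
  assumes f: "f \<in> paths S T"
  shows "path_comp S f (\<lambda>l\<in>IQ. \<lambda>a\<in>carrier S. a) = f"
proof -
  have "f l \<in> extensional (carrier S)" if "l \<in> IQ" for l
    using gen_cu_morphismD(1)[OF pathsD(1)[OF f that]] by (simp add: PiE_def)
  moreover have "f \<in> extensional IQ" using f by (simp add: paths_def PiE_def)
  ultimately show ?thesis
    by (auto simp: path_comp_def compose_def fun_eq_iff extensional_def)
qed

lemma path_comp_id_left:
  assumes f: "f \<in> paths S T"
  shows "path_comp S (\<lambda>l\<in>IQ. \<lambda>a\<in>carrier T. a) f = f"
proof -
  have "f l \<in> extensional (carrier S)" if "l \<in> IQ" for l
    using gen_cu_morphismD(1)[OF pathsD(1)[OF f that]] by (simp add: PiE_def)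
  moreover have "f \<in> extensional IQ" using f by (simp add: paths_def PiE_def)
  ultimately show ?thesis
    using gen_cu_morphismD(2)[OF pathsD(1)[OF f]]
    by (auto simp: path_comp_def compose_def fun_eq_iff extensional_def)
qed

end

lemma path_comp_assoc:
  assumes "h \<in> paths S T"
  shows "path_comp S f (path_comp S g h) = path_comp S (path_comp T f g) h"
  using gen_cu_morphismD(2)[OF pathsD(1)[OF assms]]
  by (auto simp: path_comp_def compose_def fun_eq_iff)

text \<open>With four independent objects this covers associativity of both semirings, both action
  laws and the compatibility of the actions, by letting neighbouring objects coincide.\<close>

lemma comp_prod_assoc:
  assumes S: "cu_semigroup S" and T: "cu_semigroup T" and P: "cu_semigroup P" and Q: "cu_semigroup Q"
    and z: "z \<in> carrier (internal_hom P Q)" and y: "y \<in> carrier (internal_hom T P)"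
    and x: "x \<in> carrier (internal_hom S T)"
  shows "comp_prod S T Q (comp_prod T P Q z y) x = comp_prod S P Q z (comp_prod S T P y x)"
proof -
  obtain h where h: "h \<in> paths P Q" "z = path_class P Q h"
    using z hom_model.internal_hom_carrierE[of P Q] P Q by (metis hom_model_def)
  obtain f where f: "f \<in> paths T P" "y = path_class T P f"
    using y hom_model.internal_hom_carrierE[of T P] P T by (metis hom_model_def)
  obtain g where g: "g \<in> paths S T" "x = path_class S T g"
    using x hom_model.internal_hom_carrierE[of S T] S T by (metis hom_model_def)
  note hf = comp_prod_path_class[OF T P Q h(1) f(1)] and fg = comp_prod_path_class[OF S T P f(1) g(1)]
  show ?thesis
    by (simp add: h(2) f(2) g(2) hf(1) fg(1) comp_prod_path_class(1)[OF S T Q hf(2) g(1)]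
        comp_prod_path_class(1)[OF S P Q h(1) fg(2)] path_comp_assoc[OF g(1)])
qed

lemma comp_prod_unit:
  assumes S: "cu_semigroup S" and T: "cu_semigroup T" and x: "x \<in> carrier (internal_hom S T)"
  shows "comp_prod S T T (hom_unit T) x = x" and "comp_prod S S T x (hom_unit S) = x"
proof -
  obtain f where f: "f \<in> paths S T" "x = path_class S T f"
    using x hom_model.internal_hom_carrierE[of S T] S T by (metis hom_model_def)
  show "comp_prod S T T (hom_unit T) x = x"
    unfolding hom_unit_def const_class_def f(2)
    by (simp add: comp_prod_path_class(1)[OF S T T id_path[OF T T] f(1)] path_comp_id_left[OF S T f(1)])
  show "comp_prod S S T x (hom_unit S) = x"
    unfolding hom_unit_def const_class_def f(2)
    by (simp add: comp_prod_path_class(1)[OF S S T f(1) id_path[OF S S]] path_comp_id_right[OF S T f(1)])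
qed

lemma hom_unit_closed:
  assumes S: "cu_semigroup S"
  shows "hom_unit S \<in> carrier (internal_hom S S)"
  unfolding hom_unit_def const_class_def
  by (rule hom_model.path_class_closed[OF _ id_path[OF S S]]) (simp add: hom_model_def S)

lemma internal_hom_cu_semiring:
  assumes S: "cu_semigroup S"
  shows "cu_semiring (internal_hom S S) (comp_prod S S S) (hom_unit S)"
  by (intro cu_semiring.intro cu_semiring_axioms.intro internal_hom_is_cu_semigroup S
      comp_prod_bimorphism comp_prod_assoc comp_prod_unit hom_unit_closed)

theorem proposition5p6:
  fixes S :: "'a po_monoid" and T :: "'b po_monoid"
  assumes "cu_semigroup S" and "cu_semigroup T"
  shows "cu_left_action (internal_hom T T) (comp_prod T T T) (hom_unit T)
           (internal_hom S T) (comp_prod S T T) \<and>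
         cu_right_action (internal_hom S S) (comp_prod S S S) (hom_unit S)
           (internal_hom S T) (comp_prod S S T) \<and>
         cu_semibimodule (internal_hom T T) (comp_prod T T T) (hom_unit T)
           (internal_hom S S) (comp_prod S S S) (hom_unit S)
           (internal_hom S T) (comp_prod S T T) (comp_prod S S T)"
proof -
  have left: "cu_left_action (internal_hom T T) (comp_prod T T T) (hom_unit T)
      (internal_hom S T) (comp_prod S T T)"
    by (intro cu_left_action.intro cu_left_action_axioms.intro internal_hom_cu_semiring
        internal_hom_is_cu_semigroup comp_prod_bimorphism comp_prod_assoc comp_prod_unit assms)
  have right: "cu_right_action (internal_hom S S) (comp_prod S S S) (hom_unit S)
      (internal_hom S T) (comp_prod S S T)"
    by (intro cu_right_action.intro cu_right_action_axioms.intro internal_hom_cu_semiring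
        internal_hom_is_cu_semigroup comp_prod_bimorphism comp_prod_assoc[symmetric] comp_prod_unit assms)
  have "cu_semibimodule (internal_hom T T) (comp_prod T T T) (hom_unit T)
      (internal_hom S S) (comp_prod S S S) (hom_unit S)
      (internal_hom S T) (comp_prod S T T) (comp_prod S S T)"
    by (intro cu_semibimodule.intro cu_semibimodule_axioms.intro left right
        comp_prod_assoc[symmetric] assms)
  with left right show ?thesis by blast
qed

end
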